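(* Let $(X,d,\mu)$ be a space of homogeneous type, $\mathcal D$ a dyadic lattice of $X$, $\gamma>0$, $0<q<\infty$, $1\le p_0<p_i<\infty$ for $i=1,\dots,m$, and $\eta:=\sum_{i=1}^m\frac1{p_i}-\frac1q\in[0,m)$. Let $u$ and $\vec\sigma=(\sigma_1,\dots,\sigma_m)$ be weights satisfying $\|u,\vec\sigma\|_{A^\star_{\vec p,q}(X)}<\infty$, and let $\omega_i=\sigma_i^{1-p_i/p_0}$. If $p_0\le\gamma<\min_{1\le i\le m}p_i$, then $$\sup_{\mathcal S\subseteq\mathcal D}\|\mathcal A_{\eta,\mathcal S,p_0,\gamma}\|_{L^{p_1}(X,\omega_1)\times\cdots\times L^{p_m}(X,\omega_m)\to L^q(X,u)}\lesssim\|u,\vec\sigma\|_{A^\star_{\vec p/p_0,q/p_0}(X)}^{1/q}\Big([\vec\sigma]_{H^\infty_{\vec p,q}(X)}^{\frac1q}+\sum_{i=1}^m[\vec\sigma^i]_{H^\infty_{(\vec p,q)^i}(X)}^{\frac1{p_i'}}\Big),$$ where the supremum is over sparse families $\mathcal S\subseteq\mathcal D$, $[\vec\sigma^i]_{H^\infty_{(\vec p,q)^i}(X)}=1$ if $q\le\gamma$, and otherwise $$[\vec\sigma^i]_{H^\infty_{(\vec p,q)^i}(X)}=\sup_{Q\in\mathcal D}\langle u\rangle_Q^{p_i'(\frac1\gamma-\frac1q)_+}\exp\big(\langle\log u^{-1}\rangle_Q\big)^{p_i'(\frac1\gamma-\frac1q)_+}\prod_{j\ne i}\langle\sigma_j\rangle_Q^{p_i'/p_j}\exp\big(\langle\log\sigma_j^{-1}\rangle_Q\big)^{p_i'/p_j}.$$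 If $0<\gamma<p_0$, then the same estimate still holds for all $q>\gamma$.
   Context: **Space.** $(X,d,\mu)$ is a space of homogeneous type: $d$ is a quasi-metric on the non-empty set $X$ (symmetric, $d(x,x)=0$, $d(x,y)\le A_0(d(x,z)+d(z,y))$ with $A_0\ge1$), and $\mu$ is a regular measure on the $\sigma$-algebra generated by open sets and quasi-metric balls with $0<\mu(B(x,2r))\le C_\mu\,\mu(B(x,r))<\infty$ for all balls. **Dyadic lattices.** A dyadic lattice is a countable family $\mathcal D=\bigcup_{k\in\mathbb Z}\mathcal D_k$, $\mathcal D_k=\{Q^k_\alpha\}_\alpha$, with parameters $\delta_0\in(0,1)$, $0<a_1\le A_1<\infty$, such that: for each $k$, $X$ is the disjoint union of the cubes of $\mathcal D_k$; if $l\ge k$ then $Q^l_\beta\subseteq Q^k_\alpha$ or $Q^l_\beta\cap Q^k_\alpha=\emptyset$; for $l\le k$ each $Q^k_\alpha$ is contained in a unique $Q^l_\beta$; each $Q^k_\alpha$ is the union of at most $M$ cubes of $\mathcal D_{k+1}$; $B(x^k_\alpha,a_1\delta_0^k)\subseteq Q^k_\alpha\subseteq B(x^k_\alpha,A_1\delta_0^k)=:B(Q^k_\alpha)$; and $B(Q^l_\beta)\subseteq B(Q^k_\alpha)$ whenever $l\ge k$, $Q^l_\beta\subseteq Q^k_\alpha$. $\mathcal S\subseteq\mathcal D$ is sparse ($\delta$-sparse, for a fixed $\delta\in(0,1)$) if for each $Q\in\mathcal S$ there is a measurable $E_Q\subseteq Q$ with $\mu(E_Q)\ge\delta\mu(Q)$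 and the sets $E_Q$ are pairwise disjoint. **Weights.** A weight is a locally integrable $\omega$ with $0<\omega<\infty$ a.e.; $L^p(X,\omega)$ is $L^p$ with respect to $\omega\,d\mu$. $\langle g\rangle_Q=\mu(Q)^{-1}\int_Qg\,d\mu$; $s'=s/(s-1)$; $(a)_+=\max\{a,0\}$. For exponents $\vec s=(s_1,\dots,s_m)$, $s_i>1$, and $t>0$, $$\|u,\vec\sigma\|_{A^\star_{\vec s,t}(X)}=\sup_{Q\in\mathcal D}\langle u\rangle_Q\prod_{i=1}^m\langle\sigma_i\rangle_Q^{t/s_i'};$$ $\vec p/p_0=(p_1/p_0,\dots,p_m/p_0)$. Moreover $$[\vec\sigma]_{H^\infty_{\vec p,q}(X)}=\sup_{Q\in\mathcal D}\prod_{i=1}^m\langle\sigma_i\rangle_Q^{\frac q{p_i}}\exp\big(\langle\log\sigma_i^{-1}\rangle_Q\big)^{\frac q{p_i}}.$$ **Sparse operator.** With $\langle f\rangle_{Q,p_0}=\langle|f|^{p_0}\rangle_Q^{1/p_0}$, $$\mathcal A_{\eta,\mathcal S,p_0,\gamma}(\vec f)(x)=\Big(\sum_{Q\in\mathcal S}\Big[\mu(Q)^\eta\prod_{i=1}^m\langle f_i\rangle_{Q,p_0}\Big]^\gamma\chi_Q(x)\Big)^{1/\gamma}.$$ The operator norm is the least $C$ with $\|\mathcal A(\vec f)\|_{L^q(X,u)}\le C\prod_i\|f_i\|_{L^{p_i}(X,\omega_i)}$ for all $\vec f$. $A\lesssim B$ means $A\le CB$ with $C$ independent of the weights and of $\mathcal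 S$ (it may depend on $m$, the exponents, $\delta$ and $X$). *)

theory Defs
  imports "HOL-Analysis.Analysis"
begin

section \<open>Spaces of homogeneous type\<close>

definition quasi_metric :: "('a \<Rightarrow> 'a \<Rightarrow> real) \<Rightarrow> real \<Rightarrow> bool" where
  "quasi_metric d A0 \<longleftrightarrow> 1 \<le> A0 \<and> (\<forall>x y. 0 \<le> d x y) \<and> (\<forall>x. d x x = 0) \<and> (\<forall>x y. d x y = d y x) \<and>
     (\<forall>x y z. d x y \<le> A0 * (d x z + d z y))"

definition qball :: "('a \<Rightarrow> 'a \<Rightarrow> real) \<Rightarrow> 'a \<Rightarrow> real \<Rightarrow> 'a set" where
  "qball d x r = {y. d x y < r}"

text \<open>The topology induced by a quasi-metric; quasi-metric balls need not be open in it, nor even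
  Borel, which is why the \<open>\<sigma>\<close>-algebra below is generated by open sets and balls together.\<close>

definition qopen :: "('a \<Rightarrow> 'a \<Rightarrow> real) \<Rightarrow> 'a set \<Rightarrow> bool" where
  "qopen d U \<longleftrightarrow> (\<forall>x\<in>U. \<exists>r>0. qball d x r \<subseteq> U)"

text \<open>Regularity in the sense usual for measures on metric spaces: approximation from outside by open
  sets and from inside by closed sets.\<close>

definition regular_measure :: "('a \<Rightarrow> 'a \<Rightarrow> real) \<Rightarrow> 'a measure \<Rightarrow> bool" where
  "regular_measure d \<mu> \<longleftrightarrow> (\<forall>A\<in>sets \<mu>. \<forall>e>0. \<exists>F G. qopen d (- F) \<and> qopen d G \<and> F \<subseteq> A \<and> A \<subseteq> G \<and>
     emeasure \<mu> (G - F) < ennreal e)"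

text \<open>The underlying set is the whole type \<open>'a\<close>.\<close>

definition homogeneous_space :: "('a \<Rightarrow> 'a \<Rightarrow> real) \<Rightarrow> 'a measure \<Rightarrow> bool" where
  "homogeneous_space d \<mu> \<longleftrightarrow>
     (\<exists>A0. quasi_metric d A0) \<and>
     space \<mu> = UNIV \<and>
     sets \<mu> = sigma_sets UNIV ({U. qopen d U} \<union> {qball d x r | x r. 0 < r}) \<and>
     regular_measure d \<mu> \<and>
     (\<exists>C\<mu>::real. \<forall>x r. 0 < r \<longrightarrow>
        0 < emeasure \<mu> (qball d x (2 * r)) \<and>
        emeasure \<mu> (qball d x (2 * r)) \<le> ennreal C\<mu> * emeasure \<mu> (qball d x r) \<and>
        ennreal C\<mu> * emeasure \<mu> (qball d x r) < \<infinity>)"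


section \<open>Dyadic lattices and sparse families\<close>

text \<open>A lattice is given by its generations \<open>D k\<close>. The cubes of one generation are pairwise disjoint
  and non-empty, so they serve as their own indices: \<open>c k Q\<close> is the centre of \<open>Q\<close> regarded as a cube
  of generation \<open>k\<close> (the same set may occur in several generations, with different centres).\<close>

definition cubes :: "(int \<Rightarrow> 'a set set) \<Rightarrow> 'a set set" where
  "cubes D = (\<Union>k. D k)"

definition dyadic_lattice_with ::
  "('a \<Rightarrow> 'a \<Rightarrow> real) \<Rightarrow> 'a measure \<Rightarrow> (int \<Rightarrow> 'a set set) \<Rightarrow> real \<Rightarrow> real \<Rightarrow> real \<Rightarrow> nat \<Rightarrow> (int \<Rightarrow> 'a set \<Rightarrow> 'a) \<Rightarrow> bool"
where
  "dyadic_lattice_with d \<mu> D \<delta>0 a1 A1 M c \<longleftrightarrow>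
     0 < \<delta>0 \<and> \<delta>0 < 1 \<and> 0 < a1 \<and> a1 \<le> A1 \<and>
     countable (cubes D) \<and> cubes D \<subseteq> sets \<mu> \<and>
     (\<forall>k. \<Union>(D k) = UNIV \<and> disjoint (D k)) \<and>
     (\<forall>k l. k \<le> l \<longrightarrow> (\<forall>Q\<in>D l. \<forall>R\<in>D k. Q \<subseteq> R \<or> Q \<inter> R = {})) \<and>
     (\<forall>k l. l \<le> k \<longrightarrow> (\<forall>Q\<in>D k. \<exists>!R. R \<in> D l \<and> Q \<subseteq> R)) \<and>
     (\<forall>k. \<forall>Q\<in>D k. \<exists>F\<subseteq>D (k + 1). finite F \<and> card F \<le> M \<and> Q = \<Union>F) \<and>
     (\<forall>k. \<forall>Q\<in>D k. qball d (c k Q) (a1 * \<delta>0 powi k) \<subseteq> Q \<and> Q \<subseteq> qball d (c k Q) (A1 * \<delta>0 powi k)) \<and>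
     (\<forall>k l. k \<le> l \<longrightarrow> (\<forall>Q\<in>D l. \<forall>R\<in>D k. Q \<subseteq> R \<longrightarrow>
        qball d (c l Q) (A1 * \<delta>0 powi l) \<subseteq> qball d (c k R) (A1 * \<delta>0 powi k)))"

definition dyadic_lattice :: "('a \<Rightarrow> 'a \<Rightarrow> real) \<Rightarrow> 'a measure \<Rightarrow> (int \<Rightarrow> 'a set set) \<Rightarrow> bool" where
  "dyadic_lattice d \<mu> D \<longleftrightarrow> (\<exists>\<delta>0 a1 A1 M c. dyadic_lattice_with d \<mu> D \<delta>0 a1 A1 M c)"

definition sparse_family :: "'a measure \<Rightarrow> real \<Rightarrow> 'a set set \<Rightarrow> bool" where
  "sparse_family \<mu> \<delta> S \<longleftrightarrow> (\<exists>E. (\<forall>Q\<in>S. E Q \<in> sets \<mu> \<and> E Q \<subseteq> Q \<and> ennreal \<delta> * emeasure \<mu> Q \<le> emeasure \<mu> (E Q)) \<and>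
     disjoint_family_on E S)"


section \<open>Powers, averages and norms with values in the extended half-line\<close>

definition epowr :: "ennreal \<Rightarrow> real \<Rightarrow> ennreal" (infixr "epowr" 80) where
  "x epowr a =
     (if a = 0 then 1
      else if x = 0 then (if 0 < a then 0 else \<infinity>)
      else if x = \<infinity> then (if 0 < a then \<infinity> else 0)
      else ennreal (enn2real x powr a))"

definition avg :: "'a measure \<Rightarrow> 'a set \<Rightarrow> ('a \<Rightarrow> ennreal) \<Rightarrow> ennreal" where
  "avg \<mu> Q g = (\<integral>\<^sup>+x\<in>Q. g x \<partial>\<mu>) / emeasure \<mu> Q"

definition conj_exp :: "real \<Rightarrow> real" where
  "conj_exp s = s / (s - 1)"

definition weight :: "('a \<Rightarrow> 'a \<Rightarrow> real) \<Rightarrow> 'a measure \<Rightarrow> ('a \<Rightarrow> real) \<Rightarrow> bool" where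
  "weight d \<mu> w \<longleftrightarrow> w \<in> borel_measurable \<mu> \<and> (\<forall>x r. 0 < r \<longrightarrow> set_integrable \<mu> (qball d x r) w) \<and>
     (AE x in \<mu>. 0 < w x)"

text \<open>\<open>exp_avg_log_inv \<mu> Q w\<close> is the exponential of the average of \<open>log w\<^sup>-\<^sup>1\<close> over \<open>Q\<close>. For a weight the
  negative part of \<open>log w\<^sup>-\<^sup>1\<close> is at most \<open>w\<close>, hence integrable over \<open>Q\<close>; so if \<open>log w\<^sup>-\<^sup>1\<close> fails to be
  integrable, its average is \<open>+\<infinity>\<close>.\<close>

definition exp_avg_log_inv :: "'a measure \<Rightarrow> 'a set \<Rightarrow> ('a \<Rightarrow> real) \<Rightarrow> ennreal" where
  "exp_avg_log_inv \<mu> Q w =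
     (if set_integrable \<mu> Q (\<lambda>x. ln (inverse (w x)))
      then ennreal (exp ((LINT x:Q|\<mu>. ln (inverse (w x))) / measure \<mu> Q))
      else \<infinity>)"

definition Lnorm :: "'a measure \<Rightarrow> real \<Rightarrow> ('a \<Rightarrow> real) \<Rightarrow> ('a \<Rightarrow> ennreal) \<Rightarrow> ennreal" where
  "Lnorm \<mu> s w g = (\<integral>\<^sup>+x. g x epowr s * ennreal (w x) \<partial>\<mu>) epowr (1 / s)"


section \<open>Weight constants\<close>

definition Astar ::
  "'a measure \<Rightarrow> (int \<Rightarrow> 'a set set) \<Rightarrow> nat \<Rightarrow> (nat \<Rightarrow> real) \<Rightarrow> real \<Rightarrow> ('a \<Rightarrow> real) \<Rightarrow> (nat \<Rightarrow> 'a \<Rightarrow> real) \<Rightarrow> ennreal"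
where
  "Astar \<mu> D m s t u \<sigma> =
     (SUP Q\<in>cubes D. avg \<mu> Q (\<lambda>x. ennreal (u x)) * (\<Prod>i=1..m. avg \<mu> Q (\<lambda>x. ennreal (\<sigma> i x)) epowr (t / conj_exp (s i))))"

definition Hinf ::
  "'a measure \<Rightarrow> (int \<Rightarrow> 'a set set) \<Rightarrow> nat \<Rightarrow> (nat \<Rightarrow> real) \<Rightarrow> real \<Rightarrow> (nat \<Rightarrow> 'a \<Rightarrow> real) \<Rightarrow> ennreal"
where
  "Hinf \<mu> D m p q \<sigma> =
     (SUP Q\<in>cubes D. \<Prod>i=1..m. avg \<mu> Q (\<lambda>x. ennreal (\<sigma> i x)) epowr (q / p i) * exp_avg_log_inv \<mu> Q (\<sigma> i) epowr (q / p i))"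

definition Hinf_dual ::
  "'a measure \<Rightarrow> (int \<Rightarrow> 'a set set) \<Rightarrow> nat \<Rightarrow> (nat \<Rightarrow> real) \<Rightarrow> real \<Rightarrow> real \<Rightarrow> ('a \<Rightarrow> real) \<Rightarrow> (nat \<Rightarrow> 'a \<Rightarrow> real) \<Rightarrow> nat \<Rightarrow> ennreal"
where
  "Hinf_dual \<mu> D m p q \<gamma> u \<sigma> i =
     (if q \<le> \<gamma> then 1
      else SUP Q\<in>cubes D.
        avg \<mu> Q (\<lambda>x. ennreal (u x)) epowr (conj_exp (p i) * max (1 / \<gamma> - 1 / q) 0) *
        exp_avg_log_inv \<mu> Q u epowr (conj_exp (p i) * max (1 / \<gamma> - 1 / q) 0) *
        (\<Prod>j\<in>{1..m} - {i}. avg \<mu> Q (\<lambda>x. ennreal (\<sigma> j x)) epowr (conj_exp (p i) / p j) *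
           exp_avg_log_inv \<mu> Q (\<sigma> j) epowr (conj_exp (p i) / p j)))"


section \<open>Sparse operators and operator norms\<close>

definition sparse_op ::
  "'a measure \<Rightarrow> nat \<Rightarrow> real \<Rightarrow> 'a set set \<Rightarrow> real \<Rightarrow> real \<Rightarrow> (nat \<Rightarrow> 'a \<Rightarrow> real) \<Rightarrow> 'a \<Rightarrow> ennreal"
where
  "sparse_op \<mu> m \<eta> S p0 \<gamma> f x =
     (\<Sum>\<^sub>\<infinity>Q\<in>S. (emeasure \<mu> Q epowr \<eta> *
         (\<Prod>i=1..m. avg \<mu> Q (\<lambda>y. ennreal \<bar>f i y\<bar> epowr p0) epowr (1 / p0))) epowr \<gamma> * indicator Q x)
       epowr (1 / \<gamma>)"

text \<open>The norm of \<open>T\<close> from \<open>L\<^bsup>p 1\<^esup>(\<omega> 1) \<times> \<dots> \<times> L\<^bsup>p m\<^esup>(\<omega> m)\<close> to \<open>L\<^bsup>q\<^esup>(u)\<close>; it is \<open>\<infinity>\<close> if \<open>T\<close> is unbounded.\<close>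

definition op_norm ::
  "'a measure \<Rightarrow> nat \<Rightarrow> (nat \<Rightarrow> real) \<Rightarrow> (nat \<Rightarrow> 'a \<Rightarrow> real) \<Rightarrow> real \<Rightarrow> ('a \<Rightarrow> real) \<Rightarrow>
     ((nat \<Rightarrow> 'a \<Rightarrow> real) \<Rightarrow> 'a \<Rightarrow> ennreal) \<Rightarrow> ennreal"
where
  "op_norm \<mu> m p \<omega> q u T =
     Inf {C. \<forall>f. (\<forall>i\<in>{1..m}. f i \<in> borel_measurable \<mu> \<and> Lnorm \<mu> (p i) (\<omega> i) (\<lambda>x. ennreal \<bar>f i x\<bar>) < \<infinity>) \<longrightarrow>
            Lnorm \<mu> q u (T f) \<le> C * (\<Prod>i=1..m. Lnorm \<mu> (p i) (\<omega> i) (\<lambda>x. ennreal \<bar>f i x\<bar>))}"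

end

theory Submission
  imports Defs
begin

text \<open>
  Fix a sparse family. By monotone convergence it may be taken finite, and then the only geometry left
  is that its cubes are nested or disjoint and satisfy the Carleson condition
  \<open>\<Sum> {\<mu>(Q) | Q \<subseteq> R} \<le> \<mu>(R) / \<delta>\<close>. Writing \<open>\<bar>f\<^sub>i\<bar> powr p0 = g\<^sub>i * \<sigma>\<^sub>i\<close> turns the averages of \<open>\<bar>f\<^sub>i\<bar> powr p0\<close> into averages
  of \<open>\<sigma>\<^sub>i\<close> times averages of \<open>g\<^sub>i\<close> with respect to \<open>\<sigma>\<^sub>i\<close>, and the norm of \<open>f\<^sub>i\<close> into a norm of \<open>g\<^sub>i\<close> in
  \<open>L\<^bsup>p i / p0\<^esup>(\<sigma>\<^sub>i)\<close>.

  For \<open>q \<le> \<gamma>\<close> the power \<open>q / \<gamma>\<close> goes inside the sum. The weight constant absorbs \<open>u\<close>, the \<open>H\<^sup>\<infinity>\<close> constant exchanges the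
  averages of \<open>\<sigma>\<^sub>i\<close> for their geometric means, and Hoelder's inequality, whose exponents \<open>q / p i\<close> have total
  \<open>1 + q * \<eta> \<ge> 1\<close>, leaves one Carleson embedding for each \<open>i\<close>. With geometric means
  this embedding holds for every weight (\<open>log_Carleson_embedding\<close>): since a maximal function
  bounds the averages pointwise on the cube, it can be put under the logarithm, and two applications of the dyadic maximal theorem suffice.

  For \<open>q > \<gamma>\<close> duality introduces a function \<open>h\<close> attached to the weight \<open>u\<close>, so that \<open>m + 1\<close> weights occur
  symmetrically, with exponents \<open>\<theta> j\<close> of total \<open>1 + \<gamma> * \<eta>\<close>. On the cubes where the
  quantity in the weight constant lies between \<open>2 powr k\<close> and \<open>2 * 2 powr k\<close>, the numbers
  \<open>\<Prod> v j(Q) powr \<theta> j\<close> themselves satisfy a Carleson condition (\<open>Carleson_packing_on_level\<close>): a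
  small power of the nearly constant quantity can be divided out, after which Kolmogorov's
  inequality applies. Replace the averages of the functions by running
  maxima over ancestors, which grow along the tree, and sum by parts. The product rule then yields one term for
  each \<open>k\<close>, in which only the \<open>k\<close>-th running maximum is differentiated. Its increments are
  controlled by the maximal theorem for the measure \<open>v k\<close>, whatever the weight; the other factors
  need geometric means, and the price is the product of the quotients \<open>\<langle>v j\<rangle> / exp \<langle>ln v j\<rangle>\<close> over \<open>j \<noteq> k\<close>. These
  are exactly the constants in the sum on the right-hand side: omitting \<open>u\<close> gives the first, and omitting \<open>\<sigma>\<^sub>i\<close>
  the \<open>i\<close>-th of the others (\<open>multilinear_level_embedding\<close>). The sum over \<open>k\<close> of the level sets is geometric.
  Both ranges of \<open>\<gamma>\<close> in the theorem are used through \<open>\<gamma> < p i\<close> for all \<open>i\<close>, which makes \<open>\<theta> j \<le> 1\<close>.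
\<close>

section \<open>Inequalities for real numbers\<close>

lemma weighted_geometric_mean_le:
  fixes w t :: "'j \<Rightarrow> real"
  assumes "finite J" "J \<noteq> {}" and w: "\<And>j. j \<in> J \<Longrightarrow> 0 < w j" "(\<Sum>j\<in>J. w j) = 1"
    and t: "\<And>j. j \<in> J \<Longrightarrow> 0 \<le> t j"
  shows "(\<Prod>j\<in>J. t j powr w j) \<le> (\<Sum>j\<in>J. w j * t j)"
proof (cases "\<exists>j\<in>J. t j = 0")
  case True
  then have "(\<Prod>j\<in>J. t j powr w j) = 0"
    using \<open>finite J\<close> by (auto intro!: prod_zero)
  then show ?thesis
    using w t by (simp add: sum_nonneg less_imp_le)
next
  case False
  with t have pos: "0 < t j" if "j \<in> J" for j
    using that by (metis order_le_less)
  have "(\<Prod>j\<in>J. t j powr w j) = exp (\<Sum>j\<in>J. w j * ln (t j))"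
    unfolding exp_sum[OF \<open>finite J\<close>] using pos by (intro prod.cong refl) (simp add: powr_def less_imp_neq[symmetric])
  also have "\<dots> \<le> (\<Sum>j\<in>J. w j * exp (ln (t j)))"
    using convex_on_sum[of J UNIV exp w "\<lambda>j. ln (t j)"] assms
    by (auto simp: exp_convex less_imp_le)
  also have "\<dots> = (\<Sum>j\<in>J. w j * t j)"
    using pos by (intro sum.cong) auto
  finally show ?thesis .
qed

text \<open>Exponents summing to more than 1 are harmless on a discrete family: once every sum is normalized to 1
  the terms are at most 1, and shrinking the exponents to total 1 only enlarges the products. In the
  application the total is \<open>1 + \<gamma> * \<eta>\<close> or \<open>1 + q * \<eta>\<close>, so this is where \<open>\<eta> \<ge> 0\<close> enters.\<close>

lemma Holder_sum_prod_powr: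
  fixes x :: "'j \<Rightarrow> 'b \<Rightarrow> real" and \<theta> :: "'j \<Rightarrow> real"
  assumes "finite S" "finite J" and \<theta>: "\<And>j. j \<in> J \<Longrightarrow> 0 < \<theta> j" "1 \<le> (\<Sum>j\<in>J. \<theta> j)"
    and x: "\<And>j Q. j \<in> J \<Longrightarrow> Q \<in> S \<Longrightarrow> 0 \<le> x j Q"
  shows "(\<Sum>Q\<in>S. \<Prod>j\<in>J. x j Q powr \<theta> j) \<le> (\<Prod>j\<in>J. (\<Sum>Q\<in>S. x j Q) powr \<theta> j)"
proof (cases "\<exists>j\<in>J. (\<Sum>Q\<in>S. x j Q) = 0")
  case True
  then obtain j where j: "j \<in> J" "(\<Sum>Q\<in>S. x j Q) = 0" by auto
  then have "x j Q = 0" if "Q \<in> S" for Q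
    using that x \<open>finite S\<close> by (simp add: sum_nonneg_eq_0_iff)
  then have "(\<Prod>j\<in>J. x j Q powr \<theta> j) = 0" if "Q \<in> S" for Q
    using that j \<open>finite J\<close> by (auto intro!: prod_zero bexI[of _ j])
  then show ?thesis by (simp add: prod_nonneg)
next
  case False
  define X where "X j = (\<Sum>Q\<in>S. x j Q)" for j
  define A where "A = (\<Sum>j\<in>J. \<theta> j)"
  have J: "J \<noteq> {}" using \<theta> by auto
  have A: "1 \<le> A" using \<theta> by (simp add: A_def)
  have X: "0 < X j" if "j \<in> J" for j
    using False that x sum_nonneg[of S "x j"] by (force simp: X_def order_less_le)
  have le: "x j Q \<le> X j" if "j \<in> J" "Q \<in> S" for j Q
    using that x \<open>finite S\<close> by (auto simp: X_def intro!: member_le_sum)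
  have pt: "(\<Prod>j\<in>J. x j Q powr \<theta> j) \<le> (\<Prod>j\<in>J. X j powr \<theta> j) * (\<Sum>j\<in>J. \<theta> j / A * (x j Q / X j))"
    if Q: "Q \<in> S" for Q
  proof -
    have "(\<Prod>j\<in>J. x j Q powr \<theta> j) = (\<Prod>j\<in>J. X j powr \<theta> j) * (\<Prod>j\<in>J. (x j Q / X j) powr \<theta> j)"
      unfolding prod.distrib[symmetric]
    proof (intro prod.cong refl)
      fix j assume j: "j \<in> J"
      show "x j Q powr \<theta> j = X j powr \<theta> j * (x j Q / X j) powr \<theta> j"
        using X[OF j] x[OF j Q] by (subst powr_mult[symmetric]) auto
    qed
    also have "(\<Prod>j\<in>J. (x j Q / X j) powr \<theta> j) \<le> (\<Prod>j\<in>J. (x j Q / X j) powr (\<theta> j / A))"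
    proof (intro prod_mono conjI)
      fix j assume j: "j \<in> J"
      have "\<theta> j / A \<le> \<theta> j" using A \<theta>(1)[OF j] by (simp add: field_simps)
      then show "(x j Q / X j) powr \<theta> j \<le> (x j Q / X j) powr (\<theta> j / A)"
        using x[OF j Q] X[OF j] le[OF j Q] by (intro powr_mono') auto
    qed auto
    also have "\<dots> \<le> (\<Sum>j\<in>J. \<theta> j / A * (x j Q / X j))"
    proof (intro weighted_geometric_mean_le)
      show "(\<Sum>j\<in>J. \<theta> j / A) = 1"
        using A by (simp add: A_def flip: sum_divide_distrib)
    qed (use \<open>finite J\<close> J \<theta> A x Q X in \<open>auto simp: less_imp_le\<close>)
    finally show ?thesis
      by (simp add: mult_left_mono prod_nonneg)
  qed
  have "(\<Sum>Q\<in>S. \<Prod>j\<in>J. x j Q powr \<theta> j)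
      \<le> (\<Sum>Q\<in>S. (\<Prod>j\<in>J. X j powr \<theta> j) * (\<Sum>j\<in>J. \<theta> j / A * (x j Q / X j)))"
    by (intro sum_mono pt)
  also have "\<dots> = (\<Prod>j\<in>J. X j powr \<theta> j) * (\<Sum>j\<in>J. \<Sum>Q\<in>S. \<theta> j / A * (x j Q / X j))"
    by (simp add: sum_distrib_left[symmetric] sum.swap[of _ J S])
  also have "(\<Sum>j\<in>J. \<Sum>Q\<in>S. \<theta> j / A * (x j Q / X j)) = (\<Sum>j\<in>J. \<theta> j / A)"
  proof (intro sum.cong refl)
    fix j assume j: "j \<in> J"
    have "(\<Sum>Q\<in>S. \<theta> j / A * (x j Q / X j)) = \<theta> j / A * (X j / X j)"
      by (simp only: X_def sum_distrib_left sum_divide_distrib)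
    then show "(\<Sum>Q\<in>S. \<theta> j / A * (x j Q / X j)) = \<theta> j / A"
      using X[OF j] by simp
  qed
  also have "\<dots> = 1" using A by (simp add: A_def flip: sum_divide_distrib)
  finally show ?thesis by (simp add: X_def)
qed

text \<open>A finite form of \<open>d(t\<^sup>r) = r' t d(t\<^sup>r\<^sup>-\<^sup>1)\<close> with \<open>r' = r / (r - 1)\<close>, where \<open>t\<close> is replaced by the larger end point.
  When \<open>x\<close> is the average of \<open>h\<close> over \<open>R\<close>, the product of the measure of \<open>R\<close> and \<open>x\<close> is the integral of \<open>h\<close> over \<open>R\<close>; this
  trades one power of the maximal function for \<open>h\<close>.\<close>

lemma powr_diff_le_mult_powr_diff:
  fixes x y r :: real
  assumes "1 < r" "0 \<le> y" "y \<le> x"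
  shows "x powr r - y powr r \<le> r / (r - 1) * x * (x powr (r - 1) - y powr (r - 1))"
proof -
  have "x * y powr (r - 1) \<le> x powr r / r + (y powr (r - 1)) powr (r / (r - 1)) / (r / (r - 1))"
    using assms by (intro Youngs_inequality) (auto simp: field_simps)
  also have "(y powr (r - 1)) powr (r / (r - 1)) = y powr r"
    using assms by (simp add: powr_powr)
  finally have *: "x * y powr (r - 1) \<le> x powr r / r + y powr r * (r - 1) / r"
    using assms by simp
  have "r * (x * y powr (r - 1)) \<le> x powr r + y powr r * (r - 1)"
    using mult_left_mono[OF *, of r] assms by (simp add: distrib_left)
  moreover have "x * x powr (r - 1) = x powr r"
    using assms by (cases "x = 0") (auto simp: powr_diff)
  ultimately show ?thesis
    using assms by (simp add: field_simps)
qed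

text \<open>The counterpart for exponents below 1, where \<open>t powr (\<beta> - 1)\<close> decreases and the sign of the increment flips.\<close>

lemma mult_powr_diff_le:
  fixes x y \<beta> :: real
  assumes "0 < \<beta>" "\<beta> < 1" "0 < y" "y \<le> x"
  shows "x powr \<beta> - y powr \<beta> \<le> \<beta> / (1 - \<beta>) * x * (y powr (\<beta> - 1) - x powr (\<beta> - 1))"
proof -
  have "x powr \<beta> * (y powr (1 - \<beta>)) \<le> \<beta> * x + (1 - \<beta>) * y"
    using assms by (intro Youngs_inequality_0) auto
  then have "x powr \<beta> * (y powr (1 - \<beta>)) * y powr (\<beta> - 1) \<le> (\<beta> * x + (1 - \<beta>) * y) * y powr (\<beta> - 1)"
    by (intro mult_right_mono) auto
  moreover have "y powr (1 - \<beta>) * y powr (\<beta> - 1) = 1"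
    using assms by (simp flip: powr_add)
  moreover have y: "y * y powr (\<beta> - 1) = y powr \<beta>" and x: "x * x powr (\<beta> - 1) = x powr \<beta>"
    using assms by (auto simp: powr_diff)
  ultimately have "x powr \<beta> \<le> \<beta> * x * y powr (\<beta> - 1) + (1 - \<beta>) * y powr \<beta>"
    by (simp add: algebra_simps)
  then have "(1 - \<beta>) * (x powr \<beta> - y powr \<beta>) \<le> \<beta> * (x * y powr (\<beta> - 1) - x * x powr (\<beta> - 1))"
    by (simp add: x algebra_simps)
  then show ?thesis
    using assms by (simp add: field_simps)
qed

lemma powr_diff_superadditive:
  fixes x y a :: real
  assumes "1 \<le> a" "0 \<le> y" "y \<le> x"
  shows "(x - y) powr a \<le> x powr a - y powr a"
proof (cases "x = 0")
  case False
  then have x: "0 < x" using assms by simp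
  have "s powr a \<le> s" if "0 \<le> s" "s \<le> 1" for s :: real
    using powr_mono'[of 1 a s] that assms by simp
  then have "((x - y) / x) powr a + (y / x) powr a \<le> (x - y) / x + y / x"
    using assms x by (intro add_mono) auto
  also have "\<dots> = 1" using x by (simp add: field_simps)
  finally have "(x - y) powr a / x powr a + y powr a / x powr a \<le> 1"
    using assms x by (simp add: powr_divide)
  then show ?thesis
    using x by (simp add: field_simps)
qed (use assms in auto)

text \<open>The product rule for increments of monotone quantities, with all undifferentiated factors at their larger values.\<close>

lemma prod_diff_le_sum_diff:
  fixes a b :: "'j \<Rightarrow> real"
  assumes "finite J" "\<And>j. j \<in> J \<Longrightarrow> 0 \<le> b j" "\<And>j. j \<in> J \<Longrightarrow> b j \<le> a j"
  shows "(\<Prod>j\<in>J. a j) - (\<Prod>j\<in>J. b j) \<le> (\<Sum>k\<in>J. (a k - b k) * (\<Prod>j\<in>J - {k}. a j))"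
  using assms
proof (induction J rule: finite_induct)
  case (insert i J)
  have a0: "0 \<le> a j" if "j \<in> insert i J" for j
    using insert.prems that by (meson order_trans)
  have "(\<Sum>k\<in>J. (a k - b k) * (\<Prod>j\<in>insert i J - {k}. a j))
      = a i * (\<Sum>k\<in>J. (a k - b k) * (\<Prod>j\<in>J - {k}. a j))"
    unfolding sum_distrib_left
  proof (intro sum.cong refl)
    fix k assume k: "k \<in> J"
    then have "insert i J - {k} = insert i (J - {k})" using insert.hyps by auto
    then show "(a k - b k) * (\<Prod>j\<in>insert i J - {k}. a j) = a i * ((a k - b k) * (\<Prod>j\<in>J - {k}. a j))"
      using insert.hyps by (simp add: mult.left_commute)
  qed
  also have "\<dots> \<ge> a i * ((\<Prod>j\<in>J. a j) - (\<Prod>j\<in>J. b j))"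
    using insert a0 by (intro mult_left_mono) auto
  finally have 1: "a i * ((\<Prod>j\<in>J. a j) - (\<Prod>j\<in>J. b j)) \<le> (\<Sum>k\<in>J. (a k - b k) * (\<Prod>j\<in>insert i J - {k}. a j))" .
  have "(a i - b i) * (\<Prod>j\<in>J. b j) \<le> (a i - b i) * (\<Prod>j\<in>J. a j)"
    using insert.prems by (intro mult_left_mono prod_mono) auto
  moreover have "insert i J - {i} = J" using insert.hyps by auto
  ultimately show ?case
    using 1 insert.hyps by (simp add: algebra_simps)
qed simp

section \<open>Finite laminar families\<close>

text \<open>Finitely many dyadic cubes, with the generations forgotten.\<close>

locale laminar_family =
  fixes S :: "'a set set"
  assumes finite_family: "finite S"
    and empty_notin: "{} \<notin> S"
    and nested_or_disjoint: "\<And>Q R. Q \<in> S \<Longrightarrow> R \<in> S \<Longrightarrow> Q \<subseteq> R \<or> R \<subseteq> Q \<or> Q \<inter> R = {}"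
begin

lemma subfamily: "T \<subseteq> S \<Longrightarrow> laminar_family T"
  using finite_family empty_notin nested_or_disjoint
  by unfold_locales (auto intro: finite_subset)

lemma comparable:
  assumes "Q \<in> S" "R \<in> S" "R' \<in> S" "Q \<subseteq> R" "Q \<subseteq> R'"
  shows "R \<subseteq> R' \<or> R' \<subseteq> R"
proof -
  have "Q \<noteq> {}" using assms(1) empty_notin by auto
  then show ?thesis using nested_or_disjoint[OF assms(2,3)] assms(4,5) by blast
qed

lemma Inter_of_chain_in:
  assumes "Q \<in> S" "T \<subseteq> S" "T \<noteq> {}" "\<And>R. R \<in> T \<Longrightarrow> Q \<subseteq> R"
  shows "\<Inter>T \<in> T"
proof (rule finite_Inf_in)
  fix R R' assume "R \<in> T" "R' \<in> T"
  then have "R \<subseteq> R' \<or> R' \<subseteq> R" using comparable[OF assms(1)] assms by blast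
  then show "inf R R' \<in> T" using \<open>R \<in> T\<close> \<open>R' \<in> T\<close> by (auto simp: inf.absorb1 inf.absorb2)
qed (use assms finite_subset[OF _ finite_family] in auto)

text \<open>The ancestors of a member form a finite chain, so their intersection is the smallest one. For a
  maximal member the intersection is over the empty set and has no meaning.\<close>

definition parent :: "'a set \<Rightarrow> 'a set" where
  "parent Q = \<Inter>{R \<in> S. Q \<subset> R}"

text \<open>The discrete derivative of \<open>\<Phi>\<close> along the tree. Putting the value 0 above the maximal members makes the
  increments over all ancestors of \<open>Q\<close>, including \<open>Q\<close>, telescope to \<open>\<Phi> Q\<close>.\<close>

definition incr :: "('a set \<Rightarrow> real) \<Rightarrow> 'a set \<Rightarrow> real" where
  "incr \<Phi> Q = \<Phi> Q - (if \<exists>R\<in>S. Q \<subset> R then \<Phi> (parent Q) else 0)"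

lemma parent:
  assumes "Q \<in> S" "\<exists>R\<in>S. Q \<subset> R"
  shows "parent Q \<in> S" "Q \<subset> parent Q" "{R \<in> S. Q \<subset> R} = {R \<in> S. parent Q \<subseteq> R}"
proof -
  have *: "parent Q \<in> {R \<in> S. Q \<subset> R}"
    unfolding parent_def using assms by (intro Inter_of_chain_in[of Q]) auto
  then show "parent Q \<in> S" "Q \<subset> parent Q" by auto
  with * show "{R \<in> S. Q \<subset> R} = {R \<in> S. parent Q \<subseteq> R}"
    by (auto simp: parent_def)
qed

lemma sum_incr:
  assumes "Q \<in> S"
  shows "(\<Sum>R | R \<in> S \<and> Q \<subseteq> R. incr \<Phi> R) = \<Phi> Q"
  using assms
proof (induction "card {R \<in> S. Q \<subseteq> R}" arbitrary: Q rule: less_induct)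
  case less
  have split: "{R \<in> S. Q \<subseteq> R} = insert Q {R \<in> S. Q \<subset> R}"
    using less.prems by auto
  have fin: "finite {R \<in> S. P R}" for P using finite_family by simp
  have eq: "(\<Sum>R | R \<in> S \<and> Q \<subseteq> R. incr \<Phi> R) = incr \<Phi> Q + (\<Sum>R | R \<in> S \<and> Q \<subset> R. incr \<Phi> R)"
    unfolding split using fin by (subst sum.insert) auto
  show ?case
  proof (cases "\<exists>R\<in>S. Q \<subset> R")
    case True
    note par = parent[OF less.prems True]
    have "card {R \<in> S. parent Q \<subseteq> R} < card {R \<in> S. Q \<subseteq> R}"
      unfolding par(3)[symmetric] split using fin by simp
    then have "(\<Sum>R | R \<in> S \<and> Q \<subset> R. incr \<Phi> R) = \<Phi> (parent Q)"
      using less.hyps[OF _ par(1)] par(3) by simp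
    then show ?thesis using eq True by (simp add: incr_def)
  next
    case False
    then have "{R \<in> S. Q \<subset> R} = {}" by auto
    then have "(\<Sum>R | R \<in> S \<and> Q \<subset> R. incr \<Phi> R) = 0" by (simp only: sum.empty)
    then show ?thesis using eq False by (simp add: incr_def)
  qed
qed

text \<open>At a point \<open>x\<close> the telescoping sum picks out the value at the smallest member containing \<open>x\<close>. Hence sums
  of \<open>\<nu>(R)\<close> times \<open>incr \<Phi> R\<close> are integrals, with respect to \<open>\<nu>\<close>, of the function \<open>\<Phi>\<close> of that smallest member.\<close>

lemma incr_at_point:
  obtains "\<And>Q. Q \<in> S \<Longrightarrow> x \<notin> Q"
  | Q where "Q \<in> S" "x \<in> Q" "\<And>R. R \<in> S \<Longrightarrow> x \<in> R \<Longrightarrow> Q \<subseteq> R"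
    "\<And>\<Phi>. (\<Sum>R\<in>S. indicator R x * incr \<Phi> R) = \<Phi> Q"
proof (cases "\<exists>Q\<in>S. x \<in> Q")
  case True
  define T where "T = {R \<in> S. x \<in> R}"
  define Q where "Q = \<Inter>T"
  have "Q \<in> T" unfolding Q_def
  proof (rule finite_Inf_in)
    fix R R' assume "R \<in> T" "R' \<in> T"
    then have "R \<subseteq> R' \<or> R' \<subseteq> R" using nested_or_disjoint unfolding T_def by blast
    then show "inf R R' \<in> T" using \<open>R \<in> T\<close> \<open>R' \<in> T\<close> by (auto simp: inf.absorb1 inf.absorb2)
  qed (use True finite_family in \<open>auto simp: T_def\<close>)
  then have Q: "Q \<in> S" "x \<in> Q" and T: "T = {R. R \<in> S \<and> Q \<subseteq> R}"
    by (auto simp: T_def Q_def)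
  have "(\<Sum>R\<in>S. indicator R x * incr \<Phi> R) = \<Phi> Q" for \<Phi>
  proof -
    have "(\<Sum>R\<in>S. indicator R x * incr \<Phi> R) = (\<Sum>R\<in>T. incr \<Phi> R)"
      unfolding T_def using finite_family
      by (intro sum.mono_neutral_cong_right) (auto simp: indicator_def)
    then show ?thesis using sum_incr[OF Q(1)] by (simp add: T)
  qed
  moreover have "\<And>R. R \<in> S \<Longrightarrow> x \<in> R \<Longrightarrow> Q \<subseteq> R" by (auto simp: Q_def T_def)
  ultimately show ?thesis using that(2) Q by blast
qed (use that in blast)

definition antitone :: "('a set \<Rightarrow> real) \<Rightarrow> bool" where
  "antitone \<Phi> \<longleftrightarrow> (\<forall>Q\<in>S. 0 \<le> \<Phi> Q) \<and> (\<forall>Q\<in>S. \<forall>R\<in>S. Q \<subseteq> R \<longrightarrow> \<Phi> R \<le> \<Phi> Q)"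

lemma antitone_parent:
  assumes "antitone \<Phi>" "Q \<in> S" "\<exists>R\<in>S. Q \<subset> R"
  shows "0 \<le> \<Phi> (parent Q)" "\<Phi> (parent Q) \<le> \<Phi> Q"
  using assms parent(1,2)[OF assms(2,3)] by (auto simp: antitone_def)

lemma incr_nonneg: "antitone \<Phi> \<Longrightarrow> Q \<in> S \<Longrightarrow> 0 \<le> incr \<Phi> Q"
  using antitone_parent[of \<Phi> Q] by (auto simp: antitone_def incr_def)

text \<open>Summation by parts: a packing condition on \<open>c\<close> replaces the values of a function that grows towards
  smaller cubes by its increments, and the increments, unlike the values, are summable along chains.\<close>

lemma Carleson_summation:
  assumes \<Phi>: "antitone \<Phi>"
    and c: "\<And>R. R \<in> S \<Longrightarrow> (\<Sum>Q | Q \<in> S \<and> Q \<subseteq> R. c Q) \<le> K * c R"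
  shows "(\<Sum>Q\<in>S. c Q * \<Phi> Q) \<le> K * (\<Sum>R\<in>S. c R * incr \<Phi> R)"
proof -
  have "(\<Sum>Q\<in>S. c Q * \<Phi> Q) = (\<Sum>Q\<in>S. \<Sum>R | R \<in> S \<and> Q \<subseteq> R. c Q * incr \<Phi> R)"
    by (intro sum.cong refl) (simp add: sum_incr flip: sum_distrib_left)
  also have "\<dots> = (\<Sum>R\<in>S. \<Sum>Q | Q \<in> S \<and> Q \<subseteq> R. c Q * incr \<Phi> R)"
    using finite_family by (intro sum.swap_restrict)
  also have "\<dots> \<le> (\<Sum>R\<in>S. (K * c R) * incr \<Phi> R)"
    unfolding sum_distrib_right[symmetric]
    by (intro sum_mono mult_right_mono c incr_nonneg \<Phi>)
  finally show ?thesis by (simp add: sum_distrib_left mult.assoc)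
qed

definition runmax :: "('a set \<Rightarrow> real) \<Rightarrow> 'a set \<Rightarrow> real" where
  "runmax a Q = Max (a ` {R \<in> S. Q \<subseteq> R})"

lemma runmax_ge: "Q \<in> S \<Longrightarrow> R \<in> S \<Longrightarrow> Q \<subseteq> R \<Longrightarrow> a R \<le> runmax a Q"
  unfolding runmax_def using finite_family by (intro Max_ge) auto

lemma runmax_antitone:
  assumes "\<And>Q. Q \<in> S \<Longrightarrow> 0 \<le> a Q"
  shows "antitone (runmax a)"
proof -
  have "runmax a R \<le> runmax a Q" if "Q \<in> S" "R \<in> S" "Q \<subseteq> R" for Q R
    unfolding runmax_def using that finite_family by (intro Max_mono) auto
  moreover have "0 \<le> runmax a Q" if "Q \<in> S" for Q
    using runmax_ge[OF that that order_refl, of a] assms[OF that] by linarith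
  ultimately show ?thesis by (auto simp: antitone_def)
qed

text \<open>Increments of a running maximum of averages vanish at \<open>Q\<close> unless its value is the average over \<open>Q\<close> itself;
  this is how integrals over \<open>Q\<close> enter the estimates.\<close>

lemma runmax_cases:
  assumes "Q \<in> S"
  obtains "\<exists>R\<in>S. Q \<subset> R" "runmax a Q = runmax a (parent Q)"
  | "runmax a Q = a Q"
proof (cases "\<exists>R\<in>S. Q \<subset> R")
  case True
  note par = parent[OF assms True]
  have "{R \<in> S. Q \<subseteq> R} = insert Q {R \<in> S. parent Q \<subseteq> R}"
    using assms par(3) by auto
  then have "runmax a Q = max (a Q) (runmax a (parent Q))"
    unfolding runmax_def using finite_family par(1) by (auto intro!: Max_insert)
  then show ?thesis using that True by (metis max_def)
next
  case False
  then have "{R \<in> S. Q \<subseteq> R} = {Q}" using assms by auto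
  then show ?thesis using that by (simp add: runmax_def)
qed

lemma antitone_compose:
  assumes "antitone \<Phi>" "\<And>x y. 0 \<le> x \<Longrightarrow> x \<le> y \<Longrightarrow> \<phi> x \<le> \<phi> y" "0 \<le> \<phi> 0"
  shows "antitone (\<lambda>Q. \<phi> (\<Phi> Q))"
  using assms unfolding antitone_def by (meson order_trans order_refl)

lemma antitone_powr: "antitone \<Phi> \<Longrightarrow> 0 \<le> r \<Longrightarrow> antitone (\<lambda>Q. \<Phi> Q powr r)"
  using antitone_compose[of \<Phi> "\<lambda>x. x powr r"] by (auto intro: powr_mono2)

lemma antitone_prod:
  assumes "\<And>j. j \<in> J \<Longrightarrow> antitone (\<Phi> j)"
  shows "antitone (\<lambda>Q. \<Prod>j\<in>J. \<Phi> j Q)"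
  using assms unfolding antitone_def by (auto intro!: prod_nonneg prod_mono)

lemma incr_prod_le:
  assumes "finite J" "J \<noteq> {}" "\<And>j. j \<in> J \<Longrightarrow> antitone (\<Phi> j)" "Q \<in> S"
  shows "incr (\<lambda>Q. \<Prod>j\<in>J. \<Phi> j Q) Q \<le> (\<Sum>k\<in>J. incr (\<Phi> k) Q * (\<Prod>j\<in>J - {k}. \<Phi> j Q))"
proof -
  define b where "b j = (if \<exists>R\<in>S. Q \<subset> R then \<Phi> j (parent Q) else 0)" for j
  have "incr (\<lambda>Q. \<Prod>j\<in>J. \<Phi> j Q) Q = (\<Prod>j\<in>J. \<Phi> j Q) - (\<Prod>j\<in>J. b j)"
    using assms(1,2) by (auto simp: incr_def b_def)
  also have "\<dots> \<le> (\<Sum>k\<in>J. (\<Phi> k Q - b k) * (\<Prod>j\<in>J - {k}. \<Phi> j Q))"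
  proof (intro prod_diff_le_sum_diff assms(1))
    fix j assume j: "j \<in> J"
    show "0 \<le> b j" "b j \<le> \<Phi> j Q"
      using antitone_parent[OF assms(3)[OF j] assms(4)] assms(3)[OF j] assms(4)
      by (auto simp: b_def antitone_def)
  qed
  also have "\<dots> = (\<Sum>k\<in>J. incr (\<Phi> k) Q * (\<Prod>j\<in>J - {k}. \<Phi> j Q))"
    by (simp add: incr_def b_def)
  finally show ?thesis .
qed

lemma incr_powr_le:
  assumes "antitone \<Phi>" "1 \<le> a" "Q \<in> S"
  shows "incr \<Phi> Q powr a \<le> incr (\<lambda>Q. \<Phi> Q powr a) Q"
  using assms antitone_parent[OF assms(1,3)] unfolding incr_def
  by (auto intro!: powr_diff_superadditive)

end

section \<open>The maximal inequality\<close>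

definition mean :: "'a measure \<Rightarrow> 'a set \<Rightarrow> ('a \<Rightarrow> real) \<Rightarrow> real" where
  "mean M Q f = (LINT x:Q|M. f x) / measure M Q"

lemma set_integral_pos:
  fixes f :: "'a \<Rightarrow> real"
  assumes "0 < measure M Q" "Q \<in> sets M" "set_integrable M Q f" "\<And>x. x \<in> Q \<Longrightarrow> 0 < f x"
  shows "0 < (LINT x:Q|M. f x)"
proof -
  have nn: "0 \<le> indicator Q x *\<^sub>R f x" for x
    using assms(4)[of x] by (auto simp: indicator_def less_imp_le)
  have "(LINT x:Q|M. f x) \<noteq> 0"
  proof
    assume "(LINT x:Q|M. f x) = 0"
    then have "AE x in M. indicator Q x *\<^sub>R f x = 0"
      using assms(3) nn unfolding set_lebesgue_integral_def set_integrable_def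
      by (subst (asm) integral_nonneg_eq_0_iff_AE) auto
    then have "AE x in M. x \<notin> Q"
      by eventually_elim (use assms(4) in \<open>force simp: indicator_def split: if_splits\<close>)
    then have "emeasure M Q = 0"
      using AE_iff_null_sets[OF assms(2)] by auto
    then show False using assms(1) by (simp add: measure_def)
  qed
  moreover have "0 \<le> (LINT x:Q|M. f x)"
    unfolding set_lebesgue_integral_def using nn by simp
  ultimately show ?thesis by simp
qed

lemma set_integrable_density_iff:
  fixes f v :: "'a \<Rightarrow> real"
  assumes "v \<in> borel_measurable M" "\<And>x. 0 \<le> v x" "f \<in> borel_measurable M" "Q \<in> sets M"
  shows "set_integrable (density M (\<lambda>x. ennreal (v x))) Q f \<longleftrightarrow> set_integrable M Q (\<lambda>x. f x * v x)"
  unfolding set_integrable_def using assms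
  by (subst integrable_density) (auto simp: mult_ac)

lemma set_integral_density:
  fixes f v :: "'a \<Rightarrow> real"
  assumes "v \<in> borel_measurable M" "\<And>x. 0 \<le> v x" "f \<in> borel_measurable M" "Q \<in> sets M"
  shows "(LINT x:Q|density M (\<lambda>x. ennreal (v x)). f x) = (LINT x:Q|M. f x * v x)"
  unfolding set_lebesgue_integral_def using assms
  by (subst integral_density) (auto simp: mult_ac)

lemma measure_density_eq:
  fixes v :: "'a \<Rightarrow> real"
  assumes "v \<in> borel_measurable M" "\<And>x. 0 \<le> v x" "Q \<in> sets M"
  shows "measure (density M (\<lambda>x. ennreal (v x))) Q = (LINT x:Q|M. v x)"
proof -
  have "measure (density M (\<lambda>x. ennreal (v x))) Q = (\<integral>x. indicator Q x \<partial>density M (\<lambda>x. ennreal (v x)))"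
    using assms sets.sets_into_space[of Q M] by (simp add: Int_absorb2)
  also have "\<dots> = (LINT x:Q|M. v x)"
    unfolding set_lebesgue_integral_def using assms
    by (subst integral_density) (auto simp: mult_ac)
  finally show ?thesis .
qed

lemma powr_le_add_1:
  fixes x a b :: real
  assumes "0 \<le> x" "0 \<le> a" "a \<le> b"
  shows "x powr a \<le> 1 + x powr b"
proof (cases "x \<le> 1")
  case True
  then have "x powr a \<le> 1" using assms powr_mono2[of a x 1] by simp
  then show ?thesis by (smt (verit) powr_ge_zero)
next
  case False
  then have "x powr a \<le> x powr b" using assms by (intro powr_mono) auto
  then show ?thesis by simp
qed

lemma set_integrable_of_powr:
  fixes f v :: "'a \<Rightarrow> real"
  assumes [measurable]: "v \<in> borel_measurable M" "f \<in> borel_measurable M" "Q \<in> sets M"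
    and "\<And>x. 0 \<le> v x" "\<And>x. 0 \<le> f x" "1 \<le> r"
    and "set_integrable M Q v" "integrable M (\<lambda>x. f x powr r * v x)"
  shows "set_integrable M Q (\<lambda>x. f x * v x)"
  unfolding set_integrable_def
proof (rule Bochner_Integration.integrable_bound)
  show "integrable M (\<lambda>x. indicator Q x *\<^sub>R v x + f x powr r * v x)"
    using assms(7,8) unfolding set_integrable_def by (rule Bochner_Integration.integrable_add)
  show "AE x in M. norm (indicator Q x *\<^sub>R (f x * v x)) \<le> norm (indicator Q x *\<^sub>R v x + f x powr r * v x)"
  proof (rule AE_I2)
    fix x
    have "f x * v x \<le> (1 + f x powr r) * v x"
      using powr_le_add_1[of "f x" 1 r] assms(4-6) by (intro mult_right_mono) auto
    then show "norm (indicator Q x *\<^sub>R (f x * v x)) \<le> norm (indicator Q x *\<^sub>R v x + f x powr r * v x)"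
      using assms(4,5) by (auto simp: indicator_def abs_mult algebra_simps)
  qed
qed measurable

text \<open>A real-valued measure is 0 on sets of infinite measure, so positivity also makes the members finite.\<close>

locale measured_laminar_family = laminar_family S for S :: "'a set set" +
  fixes M :: "'a measure"
  assumes sets_family: "S \<subseteq> sets M"
    and measure_pos: "\<And>Q. Q \<in> S \<Longrightarrow> 0 < measure M Q"
begin

lemma sets_member [measurable]: "Q \<in> S \<Longrightarrow> Q \<in> sets M"
  using sets_family by auto

lemma emeasure_finite: "Q \<in> S \<Longrightarrow> emeasure M Q < \<infinity>"
  using measure_pos[of Q] by (cases "emeasure M Q = top") (auto simp: measure_def less_top)

lemma integrable_indicator_member: "Q \<in> S \<Longrightarrow> integrable M (\<lambda>x. indicator Q x * (c::real))"
  using emeasure_finite sets_member by (intro integrable_mult_left integrable_real_indicator) auto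

lemma integrable_incr: "integrable M (\<lambda>x. \<Sum>R\<in>S. indicator R x * incr \<Phi> R)"
  by (intro Bochner_Integration.integrable_sum integrable_indicator_member)

lemma integral_incr: "(\<integral>x. (\<Sum>R\<in>S. indicator R x * incr \<Phi> R) \<partial>M) = (\<Sum>R\<in>S. measure M R * incr \<Phi> R)"
proof -
  have "(\<integral>x. (\<Sum>R\<in>S. indicator R x * incr \<Phi> R) \<partial>M) = (\<Sum>R\<in>S. \<integral>x. indicator R x * incr \<Phi> R \<partial>M)"
    by (intro Bochner_Integration.integral_sum integrable_indicator_member)
  also have "\<dots> = (\<Sum>R\<in>S. measure M R * incr \<Phi> R)"
    using sets_family by (intro sum.cong refl) (simp add: Int_absorb2 sets.sets_into_space subset_iff)
  finally show ?thesis .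
qed

abbreviation maxav :: "('a \<Rightarrow> real) \<Rightarrow> 'a set \<Rightarrow> real" where
  "maxav h \<equiv> runmax (\<lambda>Q. mean M Q h)"

lemma mean_nonneg: "(\<And>x. 0 \<le> h x) \<Longrightarrow> 0 \<le> mean M Q h"
  by (auto simp: mean_def set_lebesgue_integral_def)

lemma maxav_antitone: "(\<And>x. 0 \<le> h x) \<Longrightarrow> antitone (maxav h)"
  by (intro runmax_antitone mean_nonneg)

lemma Doob_step:
  assumes h: "\<And>x. 0 \<le> h x" and "1 < r" "R \<in> S"
  shows "measure M R * incr (\<lambda>Q. maxav h Q powr r) R
     \<le> r / (r - 1) * ((LINT x:R|M. h x) * incr (\<lambda>Q. maxav h Q powr (r - 1)) R)"
  using assms(3)
proof (cases rule: runmax_cases[of R "\<lambda>Q. mean M Q h"])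
  case 1
  then show ?thesis by (simp add: incr_def)
next
  case 2
  define y where "y = (if \<exists>Q\<in>S. R \<subset> Q then maxav h (parent R) else 0)"
  have y: "0 \<le> y" "y \<le> maxav h R"
    using antitone_parent[OF maxav_antitone[of h, OF h] assms(3)] maxav_antitone[of h, OF h] assms(3)
    by (auto simp: y_def antitone_def)
  have i: "incr (\<lambda>Q. maxav h Q powr s) R = maxav h R powr s - y powr s" for s
    by (simp add: incr_def y_def)
  have "measure M R * (maxav h R powr r - y powr r)
      \<le> measure M R * (r / (r - 1) * maxav h R * (maxav h R powr (r - 1) - y powr (r - 1)))"
    using powr_diff_le_mult_powr_diff[OF assms(2) y] by (intro mult_left_mono) auto
  also have "\<dots> = r / (r - 1) * ((measure M R * mean M R h) * (maxav h R powr (r - 1) - y powr (r - 1)))"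
    using 2 by simp
  also have "measure M R * mean M R h = (LINT x:R|M. h x)"
    using measure_pos[OF assms(3)] by (simp add: mean_def)
  finally show ?thesis by (simp add: i)
qed

text \<open>Each increment of the \<open>r\<close>-th power of the running maximum of averages, weighted by the measure of the
  cube, is at most \<open>r'\<close> times the integral of \<open>h\<close> over the cube times an increment of the power \<open>r - 1\<close>. Summed up, this bounds the
  integral of \<open>(M h)\<^sup>r\<close> by \<open>r'\<close> times that of \<open>h (M h)\<^sup>r\<^sup>-\<^sup>1\<close>, and Young's inequality returns the fraction \<open>1 / r'\<close> of
  the left-hand side, which is finite because the family is.\<close>

theorem Doob_maximal_inequality:
  assumes r: "1 < r" and [measurable]: "h \<in> borel_measurable M" and h: "\<And>x. 0 \<le> h x"
    and hr: "integrable M (\<lambda>x. h x powr r)" and hQ: "\<And>Q. Q \<in> S \<Longrightarrow> set_integrable M Q h"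
  shows "(\<Sum>R\<in>S. measure M R * incr (\<lambda>Q. maxav h Q powr r) R) \<le> (r / (r - 1)) powr r * (\<integral>x. h x powr r \<partial>M)"
proof -
  define r' where "r' = r / (r - 1)"
  have r': "1 < r'" "1 / r + 1 / r' = 1" using r by (auto simp: r'_def field_simps)
  define G where "G s x = (\<Sum>R\<in>S. indicator R x * incr (\<lambda>Q. maxav h Q powr s) R)" for s x
  define X where "X = (\<Sum>R\<in>S. measure M R * incr (\<lambda>Q. maxav h Q powr r) R)"
  have int: "integrable M (\<lambda>x. \<Sum>R\<in>S. (indicator R x * h x) * incr (\<lambda>Q. maxav h Q powr (r - 1)) R)"
    using hQ unfolding set_integrable_def by (intro Bochner_Integration.integrable_sum integrable_mult_left) auto
  have pt: "r' * (\<Sum>R\<in>S. (indicator R x * h x) * incr (\<lambda>Q. maxav h Q powr (r - 1)) R)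
      \<le> r' powr r / r * h x powr r + 1 / r' * G r x" for x
  proof -
    have "r' * (\<Sum>R\<in>S. (indicator R x * h x) * incr (\<lambda>Q. maxav h Q powr (r - 1)) R) = (r' * h x) * G (r - 1) x"
      by (simp add: G_def sum_distrib_left mult_ac)
    also have "\<dots> \<le> (r' * h x) powr r / r + G (r - 1) x powr r' / r'"
    proof (rule Youngs_inequality)
      show "0 \<le> G (r - 1) x" unfolding G_def
        using incr_nonneg[OF antitone_powr[OF maxav_antitone[of h]]] h r
        by (intro sum_nonneg mult_nonneg_nonneg) auto
    qed (use r r' h in auto)
    also have "G (r - 1) x powr r' = G r x"
    proof (cases rule: incr_at_point[of x])
      case 1
      then show ?thesis by (simp add: G_def)
    next
      case (2 Q)
      then show ?thesis using r by (simp add: G_def powr_powr r'_def)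
    qed
    finally show ?thesis using r' h by (simp add: powr_mult)
  qed
  have "X \<le> (\<Sum>R\<in>S. r' * ((LINT x:R|M. h x) * incr (\<lambda>Q. maxav h Q powr (r - 1)) R))"
    unfolding X_def r'_def by (intro sum_mono Doob_step h r)
  also have "\<dots> = r' * (\<integral>x. (\<Sum>R\<in>S. (indicator R x * h x) * incr (\<lambda>Q. maxav h Q powr (r - 1)) R) \<partial>M)"
    using hQ unfolding set_integrable_def set_lebesgue_integral_def sum_distrib_left[symmetric]
    by (subst Bochner_Integration.integral_sum) auto
  also have "\<dots> = (\<integral>x. r' * (\<Sum>R\<in>S. (indicator R x * h x) * incr (\<lambda>Q. maxav h Q powr (r - 1)) R) \<partial>M)"
    by simp
  also have "\<dots> \<le> (\<integral>x. r' powr r / r * h x powr r + 1 / r' * G r x \<partial>M)"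
    using int hr integrable_incr unfolding G_def
    by (intro integral_mono pt[unfolded G_def] Bochner_Integration.integrable_add integrable_mult_right) auto
  also have "\<dots> = r' powr r / r * (\<integral>x. h x powr r \<partial>M) + 1 / r' * X"
    using hr integrable_incr unfolding G_def X_def integral_incr[symmetric]
    by (subst Bochner_Integration.integral_add) auto
  finally have "X * (1 - 1 / r') \<le> r' powr r / r * (\<integral>x. h x powr r \<partial>M)"
    by (simp add: algebra_simps)
  also have "1 - 1 / r' = 1 / r" using r' by simp
  finally show ?thesis using r by (simp add: X_def r'_def field_simps)
qed

end

section \<open>Carleson embedding with geometric means\<close>

context measured_laminar_family
begin

lemma measured_density:
  fixes v :: "'a \<Rightarrow> real"
  assumes "v \<in> borel_measurable M" "\<And>x. 0 < v x" "\<And>Q. Q \<in> S \<Longrightarrow> set_integrable M Q v"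
  shows "measured_laminar_family S (density M (\<lambda>x. ennreal (v x)))"
proof
  show "S \<subseteq> sets (density M (\<lambda>x. ennreal (v x)))" using sets_family by simp
  fix Q assume Q: "Q \<in> S"
  then show "0 < measure (density M (\<lambda>x. ennreal (v x))) Q"
    using assms by (subst measure_density_eq) (auto intro!: set_integral_pos measure_pos less_imp_le)
qed

lemma set_integrable_const: "Q \<in> S \<Longrightarrow> set_integrable M Q (\<lambda>x. c::real)"
  using integrable_indicator_member by (simp add: set_integrable_def)

lemma set_integral_const: "Q \<in> S \<Longrightarrow> (LINT x:Q|M. c) = measure M Q * (c::real)"
  unfolding set_lebesgue_integral_def using sets_member[of Q] emeasure_finite[of Q]
  by (simp add: Int_absorb2 sets.sets_into_space)

text \<open>Jensen's inequality for the logarithm, from \<open>ln t \<le> t - 1\<close> applied to \<open>f / c\<close> with \<open>c\<close> the mean of \<open>f\<close>.\<close>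

lemma exp_mean_ln_le:
  fixes f g :: "'a \<Rightarrow> real"
  assumes Q: "Q \<in> S" and f: "set_integrable M Q f" "\<And>x. x \<in> Q \<Longrightarrow> 0 < f x"
    and g: "set_integrable M Q g" "\<And>x. x \<in> Q \<Longrightarrow> g x \<le> ln (f x)"
  shows "exp (mean M Q g) \<le> mean M Q f"
proof -
  define c where "c = mean M Q f"
  have c: "0 < c"
    unfolding c_def mean_def using set_integral_pos[of M Q f] measure_pos[OF Q] f Q by simp
  have "(LINT x:Q|M. g x) \<le> (LINT x:Q|M. f x / c + (ln c - 1))"
  proof (rule set_integral_mono[OF g(1)])
    show "set_integrable M Q (\<lambda>x. f x / c + (ln c - 1))"
      using f(1) Q by (intro set_integral_add set_integrable_const) auto
    fix x assume x: "x \<in> Q"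
    have "g x \<le> ln c + ln (f x / c)"
      using g(2)[OF x] f(2)[OF x] c by (simp add: ln_div)
    also have "ln (f x / c) \<le> f x / c - 1"
      using f(2)[OF x] c by (intro ln_le_minus_one) simp
    finally show "g x \<le> f x / c + (ln c - 1)" by simp
  qed
  also have "\<dots> = (LINT x:Q|M. f x) / c + measure M Q * (ln c - 1)"
    using f(1) Q by (subst set_integral_add) (auto simp: set_integrable_const set_integral_const algebra_simps)
  also have "(LINT x:Q|M. f x) = c * measure M Q"
    using measure_pos[OF Q] by (simp add: c_def mean_def)
  finally have "(LINT x:Q|M. g x) \<le> measure M Q * ln c"
    using c by (simp add: algebra_simps)
  then have "mean M Q g \<le> ln c"
    using measure_pos[OF Q] by (simp add: mean_def field_simps)
  then show ?thesis using c unfolding c_def[symmetric] by (metis exp_le_cancel_iff exp_ln)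
qed

definition Carleson :: "real \<Rightarrow> bool" where
  "Carleson K \<longleftrightarrow> (\<forall>R\<in>S. (\<Sum>Q | Q \<in> S \<and> Q \<subseteq> R. measure M Q) \<le> K * measure M R)"

definition wmean :: "('a \<Rightarrow> real) \<Rightarrow> ('a \<Rightarrow> real) \<Rightarrow> 'a set \<Rightarrow> real" where
  "wmean v h Q = (LINT x:Q|M. h x * v x) / (LINT x:Q|M. v x)"

lemma weighted_maximal_inequality:
  fixes v h :: "'a \<Rightarrow> real"
  assumes r: "1 < r" and v: "v \<in> borel_measurable M" "\<And>x. 0 < v x" "\<And>Q. Q \<in> S \<Longrightarrow> set_integrable M Q v"
    and h: "h \<in> borel_measurable M" "\<And>x. 0 \<le> h x" "integrable M (\<lambda>x. h x powr r * v x)"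
  shows "(\<Sum>R\<in>S. (LINT x:R|M. v x) * incr (\<lambda>Q. runmax (wmean v h) Q powr r) R)
     \<le> (r / (r - 1)) powr r * (\<integral>x. h x powr r * v x \<partial>M)"
    and "antitone (runmax (wmean v h))"
proof -
  define \<nu> where "\<nu> = density M (\<lambda>x. ennreal (v x))"
  interpret \<nu>: measured_laminar_family S \<nu>
    unfolding \<nu>_def by (rule measured_density[OF v])
  have hv: "set_integrable M Q (\<lambda>x. h x * v x)" if "Q \<in> S" for Q
    using that r v h by (intro set_integrable_of_powr[where r = r]) (auto intro: less_imp_le)
  have v0: "0 \<le> v x" for x using v(2)[of x] by simp
  have 1: "\<nu>.maxav h = runmax (wmean v h)"
  proof
    fix Q
    have "(\<lambda>Q. mean \<nu> Q h) ` {R \<in> S. Q \<subseteq> R} = wmean v h ` {R \<in> S. Q \<subseteq> R}"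
      unfolding mean_def wmean_def \<nu>_def
      using v v0 h by (intro image_cong refl) (auto simp: measure_density_eq set_integral_density)
    then show "\<nu>.maxav h Q = runmax (wmean v h) Q" by (simp add: runmax_def)
  qed
  show "antitone (runmax (wmean v h))"
    using \<nu>.maxav_antitone[of h] h by (simp add: 1)
  have "(\<Sum>R\<in>S. measure \<nu> R * incr (\<lambda>Q. \<nu>.maxav h Q powr r) R) \<le> (r / (r - 1)) powr r * (\<integral>x. h x powr r \<partial>\<nu>)"
    using r h v v0 hv unfolding \<nu>_def
    by (intro \<nu>.Doob_maximal_inequality[unfolded \<nu>_def])
      (auto simp: integrable_density set_integrable_density_iff mult_ac)
  moreover have "(\<integral>x. h x powr r \<partial>\<nu>) = (\<integral>x. h x powr r * v x \<partial>M)"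
    unfolding \<nu>_def using h v v0 by (subst integral_density) (auto simp: mult_ac)
  moreover have "measure \<nu> R = (LINT x:R|M. v x)" if "R \<in> S" for R
    unfolding \<nu>_def using v v0 that by (intro measure_density_eq) auto
  ultimately show "(\<Sum>R\<in>S. (LINT x:R|M. v x) * incr (\<lambda>Q. runmax (wmean v h) Q powr r) R)
     \<le> (r / (r - 1)) powr r * (\<integral>x. h x powr r * v x \<partial>M)"
    unfolding 1 by simp
qed

text \<open>With \<open>exp \<langle>ln v\<rangle>\<^bsub>Q\<^esub>\<close> in place of the average of \<open>v\<close> the embedding has a constant independent of the weight.
  The maximal function of \<open>h\<close> with respect to \<open>v\<close> dominates the running maximum \<open>H\<close> on all of \<open>Q\<close>, so it
  can be taken into the logarithm: \<open>exp \<langle>ln v\<rangle>\<^bsub>Q\<^esub> (H Q)\<^sup>r \<le> exp \<langle>ln V\<rangle>\<^bsub>Q\<^esub>\<close> with \<open>V\<close> the product of \<open>v\<close> and the \<open>r\<close>-th power of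
  that maximal function. By Jensen's inequality this is at most the square of the mean of \<open>sqrt V\<close>. The
  maximal inequality with exponent 2 for the unweighted measure and then with exponent \<open>r\<close> for the weighted one finish the proof; the
  former gives the factor 4.\<close>

theorem log_Carleson_embedding:
  fixes v h :: "'a \<Rightarrow> real"
  assumes K: "Carleson K" "0 \<le> K" and r: "1 < r"
    and v: "v \<in> borel_measurable M" "\<And>x. 0 < v x" "\<And>Q. Q \<in> S \<Longrightarrow> set_integrable M Q v"
      "\<And>Q. Q \<in> S \<Longrightarrow> set_integrable M Q (\<lambda>x. ln (v x))"
    and h: "h \<in> borel_measurable M" "\<And>x. 0 \<le> h x" "integrable M (\<lambda>x. h x powr r * v x)"
  shows "(\<Sum>Q\<in>S. measure M Q * exp (mean M Q (\<lambda>x. ln (v x))) * runmax (wmean v h) Q powr r)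
     \<le> 4 * K * (r / (r - 1)) powr r * (\<integral>x. h x powr r * v x \<partial>M)"
proof -
  note [measurable] = v(1) h(1)
  define H where "H = runmax (wmean v h)"
  note W = weighted_maximal_inequality[OF r v(1-3) h, folded H_def]
  define G where "G x = (\<Sum>R\<in>S. indicator R x * incr (\<lambda>Q. H Q powr r) R)" for x
  have incr0: "0 \<le> incr (\<lambda>Q. H Q powr r) R" if "R \<in> S" for R
    using that W(2) r by (intro incr_nonneg antitone_powr) auto
  have G0: "0 \<le> G x" for x
    unfolding G_def using incr0 by (intro sum_nonneg mult_nonneg_nonneg) auto
  define V where "V x = G x * v x" for x
  define f where "f x = sqrt (V x)" for x
  have V0: "0 \<le> V x" for x using G0[of x] v(2)[of x] by (simp add: V_def)
  have [measurable]: "G \<in> borel_measurable M" "V \<in> borel_measurable M" "f \<in> borel_measurable M"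
    unfolding f_def V_def G_def using sets_family by measurable
  have V_sum: "V x = (\<Sum>R\<in>S. (indicator R x *\<^sub>R v x) * incr (\<lambda>Q. H Q powr r) R)" for x
    unfolding V_def G_def by (simp add: sum_distrib_left sum_distrib_right mult_ac)
  have intV: "integrable M V"
    unfolding V_sum[abs_def] using v(3) unfolding set_integrable_def
    by (intro Bochner_Integration.integrable_sum integrable_mult_left) auto
  have f2: "f x powr 2 = V x" for x using V0[of x] by (simp add: f_def)
  have "(\<integral>x. V x \<partial>M) = (\<Sum>R\<in>S. (LINT x:R|M. v x) * incr (\<lambda>Q. H Q powr r) R)"
    unfolding V_sum using v(3) unfolding set_integrable_def set_lebesgue_integral_def
    by (subst Bochner_Integration.integral_sum) (auto intro!: integrable_mult_left)
  with W(1) have VX: "(\<integral>x. V x \<partial>M) \<le> (r / (r - 1)) powr r * (\<integral>x. h x powr r * v x \<partial>M)"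
    by simp
  have f0: "0 \<le> f x" for x using V0 by (simp add: f_def)
  have intf: "set_integrable M Q f" if Q: "Q \<in> S" for Q
    using set_integrable_of_powr[of "\<lambda>_. 1" M f Q 2] Q f0 intV f2 sets_member[OF Q] set_integrable_const[OF Q]
    by simp
  have key: "exp (mean M Q (\<lambda>x. ln (v x))) * H Q powr r \<le> maxav f Q powr 2" if Q: "Q \<in> S" for Q
  proof (cases "H Q = 0")
    case False
    then have HQ: "0 < H Q" using W(2) Q unfolding antitone_def by (metis order_le_less)
    have VQ: "v x * H Q powr r \<le> V x" if x: "x \<in> Q" for x
    proof (cases rule: incr_at_point[of x])
      case 1
      then show ?thesis using Q x by auto
    next
      case (2 Q')
      then have "H Q \<le> H Q'" using W(2) Q x unfolding antitone_def by blast
      then have "H Q powr r \<le> G x"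
        using 2(4) HQ r by (simp add: G_def powr_mono2)
      then show ?thesis using v(2)[of x] by (simp add: V_def mult.commute)
    qed
    have Vpos: "0 < V x" if "x \<in> Q" for x
      using VQ[OF that] HQ v(2)[of x] by (smt (verit) mult_pos_pos powr_gt_zero)
    have g: "set_integrable M Q (\<lambda>x. 1/2 * ln (v x) + 1/2 * r * ln (H Q))"
      using v(4)[OF Q] Q by (intro set_integral_add set_integrable_const set_integrable_mult_right) auto
    have "exp (mean M Q (\<lambda>x. 1/2 * ln (v x) + 1/2 * r * ln (H Q))) \<le> mean M Q f"
    proof (rule exp_mean_ln_le[OF Q intf[OF Q] _ g])
      fix x assume x: "x \<in> Q"
      show "0 < f x" using Vpos[OF x] by (simp add: f_def)
      have "ln (v x) + r * ln (H Q) = ln (v x * H Q powr r)"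
        using HQ v(2)[of x] by (simp add: ln_mult ln_powr)
      also have "\<dots> \<le> ln (V x)" using VQ[OF x] HQ v(2)[of x] by (intro ln_mono) auto
      finally show "1/2 * ln (v x) + 1/2 * r * ln (H Q) \<le> ln (f x)"
        using Vpos[OF x] by (simp add: f_def ln_sqrt)
    qed
    also have "mean M Q (\<lambda>x. 1/2 * ln (v x) + 1/2 * r * ln (H Q))
        = 1/2 * mean M Q (\<lambda>x. ln (v x)) + 1/2 * r * ln (H Q)"
      unfolding mean_def using v(4)[OF Q] Q measure_pos[OF Q]
      by (subst set_integral_add) (auto simp: set_integrable_const set_integral_const add_divide_distrib)
    finally have "exp (1/2 * mean M Q (\<lambda>x. ln (v x)) + 1/2 * r * ln (H Q)) powr 2 \<le> mean M Q f powr 2"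
      by (intro powr_mono2) auto
    also have "exp (1/2 * mean M Q (\<lambda>x. ln (v x)) + 1/2 * r * ln (H Q)) powr 2
        = exp (mean M Q (\<lambda>x. ln (v x))) * H Q powr r"
      using HQ by (simp add: powr_def flip: exp_add)
    also have "mean M Q f powr 2 \<le> maxav f Q powr 2"
      using runmax_ge[OF Q Q order_refl, of "\<lambda>Q. mean M Q f"] mean_nonneg[of f] f0
      by (intro powr_mono2) auto
    finally show ?thesis .
  qed simp
  have "(\<Sum>Q\<in>S. measure M Q * exp (mean M Q (\<lambda>x. ln (v x))) * H Q powr r)
      \<le> (\<Sum>Q\<in>S. measure M Q * maxav f Q powr 2)"
    using key measure_pos by (auto intro!: sum_mono mult_left_mono simp: mult.assoc less_imp_le)
  also have "\<dots> \<le> K * (\<Sum>R\<in>S. measure M R * incr (\<lambda>Q. maxav f Q powr 2) R)"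
    using K(1) maxav_antitone[of f, OF f0] unfolding Carleson_def
    by (intro Carleson_summation antitone_powr) auto
  also have "(\<Sum>R\<in>S. measure M R * incr (\<lambda>Q. maxav f Q powr 2) R)
      \<le> (2 / (2 - 1)) powr 2 * (\<integral>x. f x powr 2 \<partial>M)"
    using f0 intf intV by (intro Doob_maximal_inequality) (auto simp: f2)
  also have "\<dots> = 4 * (\<integral>x. V x \<partial>M)" unfolding f2 by simp
  also have "\<dots> \<le> 4 * ((r / (r - 1)) powr r * (\<integral>x. h x powr r * v x \<partial>M))"
    using VX by simp
  finally have "(\<Sum>Q\<in>S. measure M Q * exp (mean M Q (\<lambda>x. ln (v x))) * H Q powr r)
      \<le> K * (4 * ((r / (r - 1)) powr r * (\<integral>x. h x powr r * v x \<partial>M)))"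
    using K(2) by (simp add: mult_left_mono)
  then show ?thesis by (simp add: H_def mult_ac)
qed

end

section \<open>Packing of small powers of averages\<close>

context measured_laminar_family
begin

text \<open>By the evaluation at points the sum is the integral of a function bounded by \<open>B\<close> on the top cube.\<close>

lemma sum_measure_incr_le:
  assumes top: "Q0 \<in> S" "\<And>Q. Q \<in> S \<Longrightarrow> Q \<subseteq> Q0" and B: "\<And>Q. Q \<in> S \<Longrightarrow> \<Psi> Q \<le> B" "0 \<le> B"
  shows "(\<Sum>R\<in>S. measure M R * incr \<Psi> R) \<le> measure M Q0 * B"
proof -
  have "(\<integral>x. (\<Sum>R\<in>S. indicator R x * incr \<Psi> R) \<partial>M) \<le> (\<integral>x. indicator Q0 x * B \<partial>M)"
  proof (intro integral_mono integrable_incr integrable_indicator_member top)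
    fix x
    show "(\<Sum>R\<in>S. indicator R x * incr \<Psi> R) \<le> indicator Q0 x * B"
    proof (cases rule: incr_at_point[of x])
      case 1
      then show ?thesis using B(2) by simp
    next
      case (2 Q)
      then have "x \<in> Q0" using top(2)[OF 2(1)] by auto
      then show ?thesis using 2 B by simp
    qed
  qed
  then show ?thesis
    using top(1) by (simp add: integral_incr Int_absorb2 sets.sets_into_space)
qed

text \<open>Powers below 1 of averages are packed without any condition on the weight. This is Kolmogorov's
  inequality for the maximal function, here in summed form: by parts, the sum is controlled by increments of
  \<open>H powr \<beta>\<close>, and below the top cube these are controlled by the integral of \<open>v\<close> against increments
  of \<open>\<Psi>\<close>, which is bounded by \<open>m powr (\<beta> - 1)\<close>.\<close>

lemma Kolmogorov_top:
  fixes v :: "'a \<Rightarrow> real"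
  assumes K: "Carleson K" "0 \<le> K" and \<beta>: "0 < \<beta>" "\<beta> < 1"
    and v: "v \<in> borel_measurable M" "\<And>x. 0 < v x" "\<And>Q. Q \<in> S \<Longrightarrow> set_integrable M Q v"
    and top: "Q0 \<in> S" "\<And>Q. Q \<in> S \<Longrightarrow> Q \<subseteq> Q0"
  shows "(\<Sum>Q\<in>S. measure M Q * mean M Q v powr \<beta>) \<le> K / (1 - \<beta>) * (measure M Q0 * mean M Q0 v powr \<beta>)"
proof -
  have v0: "0 \<le> v x" for x using v(2)[of x] by simp
  have mp: "0 < mean M Q v" if "Q \<in> S" for Q
    unfolding mean_def using that measure_pos v by (auto intro!: divide_pos_pos set_integral_pos)
  define m where "m = mean M Q0 v"
  have m: "0 < m" using mp[OF top(1)] by (simp add: m_def)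
  have anti: "antitone (maxav v)" by (intro maxav_antitone v0)
  have "{R \<in> S. Q0 \<subseteq> R} = {Q0}" using top(1) top(2) by blast
  then have H0: "maxav v Q0 = m" by (simp add: runmax_def m_def)
  have Hm: "m \<le> maxav v Q" if "Q \<in> S" for Q
    using runmax_ge[OF that top(1) top(2)[OF that], of "\<lambda>Q. mean M Q v"] by (simp add: m_def)
  \<comment> \<open>Increments of this bounded function replace those of the decreasing function \<open>maxav v Q powr (\<beta> - 1)\<close>.\<close>
  define \<Psi> where "\<Psi> Q = m powr (\<beta> - 1) - maxav v Q powr (\<beta> - 1)" for Q
  have \<Psi>: "antitone \<Psi>"
    unfolding antitone_def
  proof (intro conjI ballI impI)
    fix Q assume Q: "Q \<in> S"
    have "maxav v Q powr (\<beta> - 1) \<le> m powr (\<beta> - 1)"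
      using Hm[OF Q] m \<beta> by (intro powr_mono2') auto
    then show "0 \<le> \<Psi> Q" by (simp add: \<Psi>_def)
    fix R assume R: "R \<in> S" "Q \<subseteq> R"
    have "maxav v R \<le> maxav v Q" using anti Q R by (auto simp: antitone_def)
    then have "maxav v Q powr (\<beta> - 1) \<le> maxav v R powr (\<beta> - 1)"
      using Hm[OF R(1)] m \<beta> by (intro powr_mono2') auto
    then show "\<Psi> R \<le> \<Psi> Q" by (simp add: \<Psi>_def)
  qed
  have step: "measure M R * incr (\<lambda>Q. maxav v Q powr \<beta>) R
      \<le> \<beta> / (1 - \<beta>) * ((LINT x:R|M. v x) * incr \<Psi> R) + (if R = Q0 then measure M Q0 * m powr \<beta> else 0)"
    if R: "R \<in> S" for R
  proof (cases "R = Q0")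
    case True
    have "\<not> (\<exists>Q\<in>S. Q0 \<subset> Q)" using top(2) by blast
    then show ?thesis
      using True by (simp add: incr_def \<Psi>_def H0)
  next
    case False
    then have R': "\<exists>Q\<in>S. R \<subset> Q" using top(1) top(2)[OF R] by (intro bexI[of _ Q0]) auto
    note par = parent(1,2)[OF R R']
    show ?thesis
      using R
    proof (cases rule: runmax_cases[of R "\<lambda>Q. mean M Q v"])
      case 1
      then show ?thesis using False by (simp add: incr_def \<Psi>_def)
    next
      case 2
      have "measure M R * (maxav v R powr \<beta> - maxav v (parent R) powr \<beta>)
          \<le> measure M R * (\<beta> / (1 - \<beta>) * maxav v R * (maxav v (parent R) powr (\<beta> - 1) - maxav v R powr (\<beta> - 1)))"
        using Hm[OF par(1)] m antitone_parent(2)[OF anti R R'] \<beta>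
        by (intro mult_left_mono mult_powr_diff_le) auto
      also have "\<dots> = \<beta> / (1 - \<beta>) * ((measure M R * mean M R v) * incr \<Psi> R)"
        using R' 2 by (simp add: incr_def \<Psi>_def)
      also have "measure M R * mean M R v = (LINT x:R|M. v x)"
        using measure_pos[OF R] by (simp add: mean_def)
      finally show ?thesis using False R' by (simp add: incr_def)
    qed
  qed
  define \<nu> where "\<nu> = density M (\<lambda>x. ennreal (v x))"
  interpret \<nu>: measured_laminar_family S \<nu>
    unfolding \<nu>_def by (rule measured_density[OF v])
  have m\<nu>: "measure \<nu> R = (LINT x:R|M. v x)" if "R \<in> S" for R
    unfolding \<nu>_def using v v0 that by (intro measure_density_eq) auto
  have "(\<Sum>R\<in>S. (LINT x:R|M. v x) * incr \<Psi> R) \<le> (LINT x:Q0|M. v x) * m powr (\<beta> - 1)"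
    using \<nu>.sum_measure_incr_le[OF top, of \<Psi> "m powr (\<beta> - 1)"] m\<nu> top(1) by (simp add: \<Psi>_def)
  also have "(LINT x:Q0|M. v x) = measure M Q0 * m"
    using measure_pos[OF top(1)] by (simp add: m_def mean_def)
  also have "measure M Q0 * m * m powr (\<beta> - 1) = measure M Q0 * m powr \<beta>"
    using m by (simp add: powr_diff)
  finally have sum\<Psi>: "(\<Sum>R\<in>S. (LINT x:R|M. v x) * incr \<Psi> R) \<le> measure M Q0 * m powr \<beta>" .
  have "(\<Sum>Q\<in>S. measure M Q * mean M Q v powr \<beta>) \<le> (\<Sum>Q\<in>S. measure M Q * maxav v Q powr \<beta>)"
  proof (intro sum_mono mult_left_mono powr_mono2)
    fix Q assume Q: "Q \<in> S"
    show "0 \<le> mean M Q v" using mp[OF Q] by simp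
    show "mean M Q v \<le> maxav v Q" using Q by (rule runmax_ge[OF Q _ order_refl])
  qed (use \<beta> in auto)
  also have "\<dots> \<le> K * (\<Sum>R\<in>S. measure M R * incr (\<lambda>Q. maxav v Q powr \<beta>) R)"
    using K(1) anti \<beta> unfolding Carleson_def
    by (intro Carleson_summation antitone_powr) auto
  also have "(\<Sum>R\<in>S. measure M R * incr (\<lambda>Q. maxav v Q powr \<beta>) R)
     \<le> (\<Sum>R\<in>S. \<beta> / (1 - \<beta>) * ((LINT x:R|M. v x) * incr \<Psi> R) + (if R = Q0 then measure M Q0 * m powr \<beta> else 0))"
    by (intro sum_mono step)
  also have "\<dots> = \<beta> / (1 - \<beta>) * (\<Sum>R\<in>S. (LINT x:R|M. v x) * incr \<Psi> R) + measure M Q0 * m powr \<beta>"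
    using finite_family top(1) by (simp add: sum.distrib sum_distrib_left)
  also have "\<dots> \<le> \<beta> / (1 - \<beta>) * (measure M Q0 * m powr \<beta>) + measure M Q0 * m powr \<beta>"
    using sum\<Psi> \<beta> by (intro add_mono mult_left_mono) auto
  also have "\<dots> = 1 / (1 - \<beta>) * (measure M Q0 * m powr \<beta>)"
    using \<beta> by (simp add: field_simps)
  finally have "(\<Sum>Q\<in>S. measure M Q * mean M Q v powr \<beta>) \<le> K * (1 / (1 - \<beta>) * (measure M Q0 * m powr \<beta>))"
    using K(2) by (simp add: mult_left_mono)
  then show ?thesis by (simp add: m_def)
qed

lemma restrict_family:
  assumes "T \<subseteq> S"
  shows "measured_laminar_family T M"
proof -
  interpret T: laminar_family T by (rule subfamily[OF assms])
  show ?thesis using assms sets_family measure_pos by unfold_locales auto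
qed

theorem Kolmogorov_Carleson:
  fixes v :: "'a \<Rightarrow> real"
  assumes K: "Carleson K" "0 \<le> K" and \<beta>: "0 < \<beta>" "\<beta> < 1"
    and v: "v \<in> borel_measurable M" "\<And>x. 0 < v x" "\<And>Q. Q \<in> S \<Longrightarrow> set_integrable M Q v"
    and R: "R \<in> S"
  shows "(\<Sum>Q | Q \<in> S \<and> Q \<subseteq> R. measure M Q * mean M Q v powr \<beta>) \<le> K / (1 - \<beta>) * (measure M R * mean M R v powr \<beta>)"
proof -
  define T where "T = {Q. Q \<in> S \<and> Q \<subseteq> R}"
  interpret T: measured_laminar_family T M
    by (rule restrict_family) (auto simp: T_def)
  have "T.Carleson K"
    unfolding T.Carleson_def
  proof
    fix P assume P: "P \<in> T"
    then have "{Q \<in> T. Q \<subseteq> P} = {Q \<in> S. Q \<subseteq> P}" by (auto simp: T_def)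
    then show "(\<Sum>Q | Q \<in> T \<and> Q \<subseteq> P. measure M Q) \<le> K * measure M P"
      using K(1) P by (simp add: Carleson_def T_def)
  qed
  then have "(\<Sum>Q\<in>T. measure M Q * mean M Q v powr \<beta>) \<le> K / (1 - \<beta>) * (measure M R * mean M R v powr \<beta>)"
  proof (rule T.Kolmogorov_top[OF _ K(2) \<beta> v(1,2)])
    show "R \<in> T" using R by (simp add: T_def)
    show "set_integrable M Q v" "Q \<subseteq> R" if "Q \<in> T" for Q
      using v(3)[of Q] that by (simp_all add: T_def)
  qed
  then show ?thesis by (simp only: T_def)
qed

end

section \<open>Packing on a level set of the weight constant\<close>

text \<open>The amount of the level function that can be removed from \<open>\<Prod> v j powr \<theta> j\<close> while all exponents
  \<open>\<theta> j - s * e j\<close> stay positive; half of the largest possible value.\<close>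

definition pack_slope :: "'j set \<Rightarrow> ('j \<Rightarrow> real) \<Rightarrow> ('j \<Rightarrow> real) \<Rightarrow> real" where
  "pack_slope J \<theta> e = Min ((\<lambda>j. \<theta> j / e j) ` J) / 2"

definition pack_const :: "real \<Rightarrow> 'j set \<Rightarrow> ('j \<Rightarrow> real) \<Rightarrow> ('j \<Rightarrow> real) \<Rightarrow> real" where
  "pack_const K J \<theta> e = 2 powr pack_slope J \<theta> e *
     (K / (pack_slope J \<theta> e * (\<Sum>j\<in>J. e j) / (\<Sum>j\<in>J. \<theta> j))) powr (\<Sum>j\<in>J. \<theta> j)"

lemma pack_slope:
  assumes "finite J" "J \<noteq> {}" "\<And>j. j \<in> J \<Longrightarrow> 0 < \<theta> j" "\<And>j. j \<in> J \<Longrightarrow> 0 < e j"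
  shows "0 < pack_slope J \<theta> e" "j \<in> J \<Longrightarrow> pack_slope J \<theta> e * e j < \<theta> j"
proof -
  let ?m = "Min ((\<lambda>j. \<theta> j / e j) ` J)"
  have m: "0 < ?m" using assms by (subst Min_gr_iff) auto
  then show "0 < pack_slope J \<theta> e" by (simp add: pack_slope_def)
  assume j: "j \<in> J"
  have "?m \<le> \<theta> j / e j" using assms j by (intro Min_le) auto
  then have "?m / 2 < \<theta> j / e j" using m by linarith
  then show "pack_slope J \<theta> e * e j < \<theta> j"
    using assms(4)[OF j] by (simp add: pack_slope_def field_simps)
qed

context measured_laminar_family
begin

text \<open>Hoelder's inequality with weights \<open>\<beta> j / b\<close> reduces the product to single averages raised to the power \<open>b < 1\<close>.\<close>

lemma Kolmogorov_Carleson_prod: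
  fixes v :: "'j \<Rightarrow> 'a \<Rightarrow> real"
  assumes K: "Carleson K" "0 \<le> K" and J: "finite J"
    and \<beta>: "\<And>j. j \<in> J \<Longrightarrow> 0 < \<beta> j" "0 < (\<Sum>j\<in>J. \<beta> j)" "(\<Sum>j\<in>J. \<beta> j) < 1"
    and v: "\<And>j. j \<in> J \<Longrightarrow> v j \<in> borel_measurable M" "\<And>j x. j \<in> J \<Longrightarrow> 0 < v j x"
      "\<And>j Q. j \<in> J \<Longrightarrow> Q \<in> S \<Longrightarrow> set_integrable M Q (v j)"
    and R: "R \<in> S"
  shows "(\<Sum>Q | Q \<in> S \<and> Q \<subseteq> R. measure M Q * (\<Prod>j\<in>J. mean M Q (v j) powr \<beta> j))
     \<le> K / (1 - (\<Sum>j\<in>J. \<beta> j)) * (measure M R * (\<Prod>j\<in>J. mean M R (v j) powr \<beta> j))"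
proof -
  define b where "b = (\<Sum>j\<in>J. \<beta> j)"
  have b: "0 < b" "b < 1" using \<beta> by (auto simp: b_def)
  have sum1: "(\<Sum>j\<in>J. \<beta> j / b) = 1" using b by (simp add: b_def flip: sum_divide_distrib)
  have m0: "0 \<le> mean M Q (v j)" if "j \<in> J" for Q j
    using v(2)[OF that] by (intro mean_nonneg less_imp_le)
  have split: "(\<Prod>j\<in>J. (c * (measure M Q * mean M Q (v j) powr b)) powr (\<beta> j / b))
     = c * (measure M Q * (\<Prod>j\<in>J. mean M Q (v j) powr \<beta> j))" if "0 \<le> c" "Q \<in> S" for Q c
  proof -
    have *: "(\<Prod>j\<in>J. d powr (\<beta> j / b)) = d" if "0 \<le> d" for d
    proof (cases "d = 0")
      case True
      moreover have "J \<noteq> {}" using b by (auto simp: b_def)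
      ultimately show ?thesis using J by (simp add: card_gt_0_iff)
    next
      case False
      then show ?thesis using that sum1 by (simp flip: powr_sum)
    qed
    have "(\<Prod>j\<in>J. (c * (measure M Q * mean M Q (v j) powr b)) powr (\<beta> j / b))
       = (\<Prod>j\<in>J. (c * measure M Q) powr (\<beta> j / b) * mean M Q (v j) powr \<beta> j)"
      using that m0 b by (intro prod.cong refl) (simp add: powr_mult powr_powr)
    then show ?thesis using that by (simp add: prod.distrib *)
  qed
  define T where "T = {Q. Q \<in> S \<and> Q \<subseteq> R}"
  have T: "finite T" "T \<subseteq> S" using finite_family by (auto simp: T_def)
  have "(\<Sum>Q\<in>T. measure M Q * (\<Prod>j\<in>J. mean M Q (v j) powr \<beta> j))
      = (\<Sum>Q\<in>T. \<Prod>j\<in>J. (measure M Q * mean M Q (v j) powr b) powr (\<beta> j / b))"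
    using split[of 1] T by (intro sum.cong refl) auto
  also have "\<dots> \<le> (\<Prod>j\<in>J. (\<Sum>Q\<in>T. measure M Q * mean M Q (v j) powr b) powr (\<beta> j / b))"
    using \<beta>(1) b sum1 by (intro Holder_sum_prod_powr T J) auto
  also have "\<dots> \<le> (\<Prod>j\<in>J. (K / (1 - b) * (measure M R * mean M R (v j) powr b)) powr (\<beta> j / b))"
  proof (intro prod_mono conjI powr_mono2)
    fix j assume j: "j \<in> J"
    show "(\<Sum>Q\<in>T. measure M Q * mean M Q (v j) powr b) \<le> K / (1 - b) * (measure M R * mean M R (v j) powr b)"
      unfolding T_def using j by (intro Kolmogorov_Carleson K b v R)
  qed (use \<beta>(1) b in \<open>auto intro!: sum_nonneg simp: less_imp_le\<close>)
  also have "\<dots> = K / (1 - b) * (measure M R * (\<Prod>j\<in>J. mean M R (v j) powr \<beta> j))"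
    using b K(2) R by (intro split) auto
  finally show ?thesis by (simp only: b_def T_def)
qed

text \<open>On cubes where the product \<open>N = \<Prod> \<langle>v j\<rangle> powr e j\<close> is essentially constant, a factor \<open>N powr s\<close> can be
  pulled out of the sum. The remaining exponents of the averages have total below that of the measure, so the
  powers of averages are small powers and Kolmogorov's inequality applies. The total power \<open>A \<ge> 1\<close> of
  the whole expression is handled by the embedding of summable families into those with summable \<open>A\<close>-th powers.\<close>

theorem Carleson_packing_on_level:
  fixes v :: "'j \<Rightarrow> 'a \<Rightarrow> real"
  assumes K: "Carleson K" "0 \<le> K" and J: "finite J"
    and \<theta>: "\<And>j. j \<in> J \<Longrightarrow> 0 < \<theta> j" "1 \<le> (\<Sum>j\<in>J. \<theta> j)" and e: "\<And>j. j \<in> J \<Longrightarrow> 0 < e j"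
    and v: "\<And>j. j \<in> J \<Longrightarrow> v j \<in> borel_measurable M" "\<And>j x. j \<in> J \<Longrightarrow> 0 < v j x"
      "\<And>j Q. j \<in> J \<Longrightarrow> Q \<in> S \<Longrightarrow> set_integrable M Q (v j)"
    and level: "0 < lo" "\<And>Q. Q \<in> S \<Longrightarrow> lo \<le> (\<Prod>j\<in>J. mean M Q (v j) powr e j)"
      "\<And>Q. Q \<in> S \<Longrightarrow> (\<Prod>j\<in>J. mean M Q (v j) powr e j) \<le> 2 * lo"
    and R: "R \<in> S"
  shows "(\<Sum>Q | Q \<in> S \<and> Q \<subseteq> R. \<Prod>j\<in>J. (LINT x:Q|M. v j x) powr \<theta> j)
     \<le> pack_const K J \<theta> e * (\<Prod>j\<in>J. (LINT x:R|M. v j x) powr \<theta> j)"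
proof -
  have J0: "J \<noteq> {}" using \<theta> by auto
  define s where "s = pack_slope J \<theta> e"
  have s: "0 < s" "\<And>j. j \<in> J \<Longrightarrow> s * e j < \<theta> j"
    using pack_slope[OF J J0 \<theta>(1) e] by (auto simp: s_def)
  define A where "A = (\<Sum>j\<in>J. \<theta> j)"
  have A: "1 \<le> A" using \<theta> by (simp add: A_def)
  define \<beta> where "\<beta> j = (\<theta> j - s * e j) / A" for j
  define b where "b = (\<Sum>j\<in>J. \<beta> j)"
  have b: "1 - b = s * (\<Sum>j\<in>J. e j) / A"
    unfolding b_def \<beta>_def using A
    by (simp add: A_def sum_subtractf diff_divide_distrib sum_distrib_left flip: sum_divide_distrib)
  have se: "0 < (\<Sum>j\<in>J. e j)" using J J0 e by (intro sum_pos)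
  have b1: "b < 1" using b s(1) se A by (smt (verit) divide_pos_pos mult_pos_pos)
  have \<beta>: "0 < \<beta> j" if "j \<in> J" for j using s(2)[OF that] A by (simp add: \<beta>_def)
  have b0: "0 < b" unfolding b_def using J J0 \<beta> by (intro sum_pos)
  have m0: "0 < mean M Q (v j)" if "j \<in> J" "Q \<in> S" for Q j
    unfolding mean_def using that v measure_pos by (auto intro!: divide_pos_pos set_integral_pos)
  define N where "N Q = (\<Prod>j\<in>J. mean M Q (v j) powr e j)" for Q
  define P where "P Q = measure M Q * (\<Prod>j\<in>J. mean M Q (v j) powr \<beta> j)" for Q
  have P0: "0 \<le> P Q" for Q by (simp add: P_def prod_nonneg)
  have eq: "(\<Prod>j\<in>J. (LINT x:Q|M. v j x) powr \<theta> j) = N Q powr s * P Q powr A" if Q: "Q \<in> S" for Q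
  proof -
    have "N Q powr s * P Q powr A = measure M Q powr A * ((\<Prod>j\<in>J. mean M Q (v j) powr (e j * s)) * (\<Prod>j\<in>J. mean M Q (v j) powr (\<beta> j * A)))"
      by (simp add: N_def P_def powr_mult prod_nonneg powr_powr prod_powr_distrib)
    also have "measure M Q powr A = (\<Prod>j\<in>J. measure M Q powr \<theta> j)"
      using measure_pos[OF Q] by (simp add: A_def powr_sum)
    also have "(\<Prod>j\<in>J. mean M Q (v j) powr (e j * s)) * (\<Prod>j\<in>J. mean M Q (v j) powr (\<beta> j * A)) = (\<Prod>j\<in>J. mean M Q (v j) powr \<theta> j)"
      using A by (simp add: \<beta>_def mult.commute flip: prod.distrib powr_add)
    also have "(\<Prod>j\<in>J. measure M Q powr \<theta> j) * \<dots> = (\<Prod>j\<in>J. (LINT x:Q|M. v j x) powr \<theta> j)"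
      unfolding prod.distrib[symmetric]
    proof (intro prod.cong refl)
      fix j assume j: "j \<in> J"
      have "(LINT x:Q|M. v j x) = measure M Q * mean M Q (v j)"
        using measure_pos[OF Q] by (simp add: mean_def)
      then show "measure M Q powr \<theta> j * mean M Q (v j) powr \<theta> j = (LINT x:Q|M. v j x) powr \<theta> j"
        using m0[OF j Q] by (simp add: powr_mult)
    qed
    finally show ?thesis ..
  qed
  define T where "T = {Q. Q \<in> S \<and> Q \<subseteq> R}"
  have T: "finite T" "T \<subseteq> S" using finite_family by (auto simp: T_def)
  have "(\<Sum>Q\<in>T. P Q powr A) \<le> (\<Sum>Q\<in>T. P Q) powr A"
    using Holder_sum_prod_powr[OF T(1), of "{()}" "\<lambda>_. A" "\<lambda>_. P"] A P0 by simp
  also have "\<dots> \<le> (K / (1 - b) * P R) powr A"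
  proof (rule powr_mono2)
    show "(\<Sum>Q\<in>T. P Q) \<le> K / (1 - b) * P R"
      unfolding P_def T_def b_def using \<beta> b0 b1
      by (intro Kolmogorov_Carleson_prod K J v R) (auto simp: b_def)
  qed (use A P0 in \<open>auto intro: sum_nonneg\<close>)
  also have "\<dots> = (K / (1 - b)) powr A * P R powr A"
    by (rule powr_mult)
  finally have PA: "(\<Sum>Q\<in>T. P Q powr A) \<le> (K / (1 - b)) powr A * P R powr A" .
  have "(\<Sum>Q\<in>T. \<Prod>j\<in>J. (LINT x:Q|M. v j x) powr \<theta> j) = (\<Sum>Q\<in>T. N Q powr s * P Q powr A)"
    using T eq by (intro sum.cong refl) auto
  also have "\<dots> \<le> (\<Sum>Q\<in>T. (2 * lo) powr s * P Q powr A)"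
    using level T s(1) P0 unfolding N_def
    by (intro sum_mono mult_right_mono powr_mono2) (auto intro!: prod_nonneg)
  also have "\<dots> = (2 * lo) powr s * (\<Sum>Q\<in>T. P Q powr A)"
    by (simp add: sum_distrib_left)
  also have "\<dots> \<le> (2 * lo) powr s * ((K / (1 - b)) powr A * P R powr A)"
    by (intro mult_left_mono PA) simp
  also have "\<dots> = 2 powr s * (K / (1 - b)) powr A * (lo powr s * P R powr A)"
    using level(1) by (simp add: powr_mult)
  also have "\<dots> \<le> 2 powr s * (K / (1 - b)) powr A * (N R powr s * P R powr A)"
    using level(1) level(2)[OF R] s(1) unfolding N_def
    by (intro mult_left_mono mult_right_mono powr_mono2) auto
  also have "\<dots> = pack_const K J \<theta> e * (\<Prod>j\<in>J. (LINT x:R|M. v j x) powr \<theta> j)"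
    unfolding eq[OF R] by (simp add: pack_const_def b s_def A_def)
  finally show ?thesis by (simp only: T_def)
qed

end

section \<open>Multilinear embeddings\<close>

lemma sum_dyadic_powr_le:
  fixes F :: "int set" and \<tau> A :: real
  assumes "finite F" "0 < \<tau>" "0 < A" "\<And>a. a \<in> F \<Longrightarrow> 2 powr a \<le> A"
  shows "(\<Sum>a\<in>F. (2 powr a) powr \<tau>) \<le> A powr \<tau> / (1 - 2 powr - \<tau>)"
proof -
  define x :: real where "x = 2 powr - \<tau>"
  have x: "0 < x" "x < 1" using assms(2) powr_less_mono[of "-\<tau>" 0 2] by (auto simp: x_def)
  define b where "b = \<lfloor>log 2 A\<rfloor>"
  have le: "a \<le> b" if "a \<in> F" for a
    using assms(3) assms(4)[OF that] by (simp add: b_def le_floor_iff le_log_iff)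
  have pb: "2 powr b \<le> A"
    using assms(3) by (subst le_log_iff[symmetric]) (auto simp: b_def)
  have "(\<Sum>a\<in>F. (2 powr a) powr \<tau>) = (\<Sum>a\<in>F. (2 powr b) powr \<tau> * x ^ nat (b - a))"
  proof (intro sum.cong refl)
    fix a assume "a \<in> F"
    have "x ^ nat (b - a) = x powr (real_of_int b - real_of_int a)"
      using x le[OF \<open>a \<in> F\<close>] by (subst powr_realpow[symmetric]) auto
    then show "(2 powr real_of_int a) powr \<tau> = (2 powr b) powr \<tau> * x ^ nat (b - a)"
      by (simp add: x_def powr_powr algebra_simps flip: powr_add)
  qed
  also have "\<dots> = (2 powr b) powr \<tau> * (\<Sum>n\<in>(\<lambda>a. nat (b - a)) ` F. x ^ n)"
  proof -
    have "inj_on (\<lambda>a. nat (b - a)) F"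
      using le by (intro inj_onI) (smt (verit) nat_eq_iff)
    then show ?thesis by (simp add: sum.reindex sum_distrib_left)
  qed
  also have "\<dots> \<le> A powr \<tau> * (1 / (1 - x))"
  proof (intro mult_mono powr_mono2)
    have "(\<Sum>n\<in>(\<lambda>a. nat (b - a)) ` F. x ^ n) \<le> (\<Sum>n. x ^ n)"
      using assms(1) x by (intro sum_le_suminf summable_geometric) auto
    also have "\<dots> = 1 / (1 - x)" using x by (intro suminf_geometric) auto
    finally show "(\<Sum>n\<in>(\<lambda>a. nat (b - a)) ` F. x ^ n) \<le> 1 / (1 - x)" .
  qed (use pb assms x in \<open>auto intro!: sum_nonneg\<close>)
  finally show ?thesis by (simp add: x_def)
qed

context measured_laminar_family
begin

lemma Carleson_subfamily:
  assumes "Carleson K" "T \<subseteq> S"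
  shows "measured_laminar_family.Carleson T M K"
proof -
  interpret T: measured_laminar_family T M by (rule restrict_family[OF assms(2)])
  have "(\<Sum>Q | Q \<in> T \<and> Q \<subseteq> R. measure M Q) \<le> K * measure M R" if "R \<in> T" for R
  proof -
    have "(\<Sum>Q | Q \<in> T \<and> Q \<subseteq> R. measure M Q) \<le> (\<Sum>Q | Q \<in> S \<and> Q \<subseteq> R. measure M Q)"
      using assms(2) finite_family by (intro sum_mono2) auto
    also have "\<dots> \<le> K * measure M R" using assms that by (auto simp: Carleson_def)
    finally show ?thesis .
  qed
  then show ?thesis by (simp add: T.Carleson_def)
qed

text \<open>The common right-hand side of the logarithmic embedding and, for \<open>K \<ge> 1\<close>, of the maximal inequality.\<close>

definition embed_bound :: "real \<Rightarrow> real \<Rightarrow> ('a \<Rightarrow> real) \<Rightarrow> ('a \<Rightarrow> real) \<Rightarrow> real" where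
  "embed_bound K r v h = 4 * K * (r / (r - 1)) powr r * (\<integral>x. h x powr r * v x \<partial>M)"

definition ln_mean :: "('a \<Rightarrow> real) \<Rightarrow> 'a set \<Rightarrow> real" where
  "ln_mean v Q = exp (mean M Q (\<lambda>x. ln (v x)))"

text \<open>The quotient of the arithmetic and the geometric mean, whose supremum over all cubes is the logarithmic
  \<open>A\<^sub>\<infinity>\<close> constant of Hrushchev.\<close>

definition Ainf_quotient :: "('a \<Rightarrow> real) \<Rightarrow> 'a set \<Rightarrow> real" where
  "Ainf_quotient v Q = mean M Q v / ln_mean v Q"

context
  fixes K :: real and J :: "'j set" and \<theta> r :: "'j \<Rightarrow> real" and v h :: "'j \<Rightarrow> 'a \<Rightarrow> real"
  assumes K: "Carleson K" "1 \<le> K" and J: "finite J"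
    and \<theta>: "\<And>j. j \<in> J \<Longrightarrow> 0 < \<theta> j" "1 \<le> (\<Sum>j\<in>J. \<theta> j)" and r: "\<And>j. j \<in> J \<Longrightarrow> 1 < r j"
    and v: "\<And>j. j \<in> J \<Longrightarrow> v j \<in> borel_measurable M" "\<And>j x. j \<in> J \<Longrightarrow> 0 < v j x"
      "\<And>j Q. j \<in> J \<Longrightarrow> Q \<in> S \<Longrightarrow> set_integrable M Q (v j)"
      "\<And>j Q. j \<in> J \<Longrightarrow> Q \<in> S \<Longrightarrow> set_integrable M Q (\<lambda>x. ln (v j x))"
    and h: "\<And>j. j \<in> J \<Longrightarrow> h j \<in> borel_measurable M" "\<And>j x. j \<in> J \<Longrightarrow> 0 \<le> h j x"
      "\<And>j. j \<in> J \<Longrightarrow> integrable M (\<lambda>x. h j x powr r j * v j x)"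
begin

abbreviation h_mean :: "'j \<Rightarrow> 'a set \<Rightarrow> real" where
  "h_mean j \<equiv> wmean (v j) (h j)"

abbreviation h_bound :: "'j \<Rightarrow> real" where
  "h_bound j \<equiv> embed_bound K (r j) (v j) (h j)"

lemma wmean_nonneg: "j \<in> J \<Longrightarrow> 0 \<le> h_mean j Q"
  using v(2)[of j] h(2)[of j] unfolding wmean_def set_lebesgue_integral_def
  by (auto intro!: divide_nonneg_nonneg integral_nonneg simp: less_imp_le)

lemma embedding_term:
  assumes "j \<in> J"
  shows "(\<Sum>Q\<in>S. measure M Q * ln_mean (v j) Q * runmax (h_mean j) Q powr r j)
      \<le> h_bound j"
  unfolding embed_bound_def ln_mean_def
  using assms K by (intro log_Carleson_embedding r v h) auto

lemma maximal_term:
  assumes "j \<in> J"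
  shows "(\<Sum>Q\<in>S. (LINT x:Q|M. v j x) * incr (\<lambda>Q. runmax (h_mean j) Q powr r j) Q)
      \<le> h_bound j"
proof -
  let ?X = "(r j / (r j - 1)) powr r j * (\<integral>x. h j x powr r j * v j x \<partial>M)"
  have "0 \<le> ?X"
    using v(2)[OF assms] by (intro mult_nonneg_nonneg integral_nonneg) (auto simp: less_imp_le)
  then have "1 * ?X \<le> (4 * K) * ?X"
    using K by (intro mult_right_mono) auto
  moreover have "(\<Sum>Q\<in>S. (LINT x:Q|M. v j x) * incr (\<lambda>Q. runmax (h_mean j) Q powr r j) Q) \<le> ?X"
    using assms by (intro weighted_maximal_inequality r v h)
  ultimately show ?thesis
    by (simp add: embed_bound_def mult_ac)
qed

lemma antitone_runmax_wmean: "j \<in> J \<Longrightarrow> antitone (runmax (h_mean j))"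
  by (intro runmax_antitone wmean_nonneg)

theorem multilinear_log_embedding:
  "(\<Sum>Q\<in>S. \<Prod>j\<in>J. (measure M Q * ln_mean (v j) Q * h_mean j Q powr r j) powr \<theta> j)
    \<le> (\<Prod>j\<in>J. h_bound j powr \<theta> j)"
proof -
  have "(\<Sum>Q\<in>S. \<Prod>j\<in>J. (measure M Q * ln_mean (v j) Q * h_mean j Q powr r j) powr \<theta> j)
    \<le> (\<Prod>j\<in>J. (\<Sum>Q\<in>S. measure M Q * ln_mean (v j) Q * h_mean j Q powr r j) powr \<theta> j)"
    using \<theta> by (intro Holder_sum_prod_powr finite_family J) (auto simp: ln_mean_def)
  also have "\<dots> \<le> (\<Prod>j\<in>J. h_bound j powr \<theta> j)"
  proof (intro prod_mono conjI powr_mono2)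
    fix j assume j: "j \<in> J"
    have "(\<Sum>Q\<in>S. measure M Q * ln_mean (v j) Q * h_mean j Q powr r j)
        \<le> (\<Sum>Q\<in>S. measure M Q * ln_mean (v j) Q * runmax (h_mean j) Q powr r j)"
      using r[OF j] wmean_nonneg[OF j]
      by (intro sum_mono mult_left_mono powr_mono2 runmax_ge) (auto simp: ln_mean_def)
    also note embedding_term[OF j]
    finally show "(\<Sum>Q\<in>S. measure M Q * ln_mean (v j) Q * h_mean j Q powr r j)
        \<le> h_bound j" .
  qed (use \<theta> in \<open>auto intro!: sum_nonneg simp: ln_mean_def less_imp_le\<close>)
  finally show ?thesis .
qed

text \<open>Replace the averages of \<open>h j\<close> by their running maxima \<open>H j\<close> and put \<open>Y j = H j powr (r j * \<theta> j)\<close>.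
  The packing condition on the level allows summation by parts, and the product rule splits the increment of \<open>\<Prod> Y j\<close> into
  terms in which only one factor \<open>k\<close> is differentiated. There the arithmetic mean of \<open>v k\<close> is affordable, because increments are
  controlled by the maximal inequality for any weight; for the other factors the arithmetic
  mean is exchanged for the geometric one at the cost of the quotients in \<open>T k\<close>, and the logarithmic
  embedding applies. This is why the constants omit one weight at a time. Hoelder's inequality
  joins the factors.\<close>

theorem multilinear_level_embedding:
  fixes T e :: "'j \<Rightarrow> real"
  assumes \<theta>1: "\<And>j. j \<in> J \<Longrightarrow> \<theta> j \<le> 1" and e: "\<And>j. j \<in> J \<Longrightarrow> 0 < e j"
    and level: "0 < lo" "\<And>Q. Q \<in> S \<Longrightarrow> lo \<le> (\<Prod>j\<in>J. mean M Q (v j) powr e j)"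
      "\<And>Q. Q \<in> S \<Longrightarrow> (\<Prod>j\<in>J. mean M Q (v j) powr e j) \<le> 2 * lo"
    and T0: "\<And>k. k \<in> J \<Longrightarrow> 0 \<le> T k"
    and T: "\<And>k Q. k \<in> J \<Longrightarrow> Q \<in> S \<Longrightarrow> (\<Prod>j\<in>J - {k}. Ainf_quotient (v j) Q powr \<theta> j) \<le> T k"
  shows "(\<Sum>Q\<in>S. \<Prod>j\<in>J. ((LINT x:Q|M. v j x) * h_mean j Q powr r j) powr \<theta> j)
    \<le> pack_const K J \<theta> e * (\<Sum>k\<in>J. T k) * (\<Prod>j\<in>J. h_bound j powr \<theta> j)"
proof -
  have J0: "J \<noteq> {}" using \<theta> by auto
  define H where "H j = runmax (h_mean j)" for j
  define Y where "Y j Q = H j Q powr (r j * \<theta> j)" for j Q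
  define \<kappa> where "\<kappa> Q = (\<Prod>j\<in>J. (LINT x:Q|M. v j x) powr \<theta> j)" for Q
  define E where "E = (\<Prod>j\<in>J. h_bound j powr \<theta> j)"
  have H: "antitone (H j)" if "j \<in> J" for j
    unfolding H_def using that by (rule antitone_runmax_wmean)
  have Y: "antitone (Y j)" if "j \<in> J" for j
    unfolding Y_def using H[OF that] r[OF that] \<theta>(1)[OF that] by (intro antitone_powr) auto
  have \<kappa>0: "0 \<le> \<kappa> Q" for Q by (simp add: \<kappa>_def prod_nonneg)
  have vpos: "0 < (LINT x:Q|M. v j x)" if "j \<in> J" "Q \<in> S" for j Q
    using that v measure_pos by (auto intro!: set_integral_pos)
  have pc: "0 \<le> pack_const K J \<theta> e" by (simp add: pack_const_def)
  have term_k: "(\<Sum>Q\<in>S. \<kappa> Q * (incr (Y k) Q * (\<Prod>j\<in>J - {k}. Y j Q))) \<le> T k * E" if k: "k \<in> J" for k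
  proof -
    \<comment> \<open>The \<open>k\<close>-th factor keeps its arithmetic mean and its increment; the power \<open>1 / \<theta> j\<close> prepares for Hoelder's inequality.\<close>
    define x where "x j Q = (if j = k then (LINT x:Q|M. v j x) * incr (Y j) Q powr (1 / \<theta> j)
      else measure M Q * ln_mean (v j) Q * H j Q powr r j)" for j Q
    have x0: "0 \<le> x j Q" if "j \<in> J" "Q \<in> S" for j Q
      using vpos[OF that] by (auto simp: x_def ln_mean_def)
    have pt: "\<kappa> Q * (incr (Y k) Q * (\<Prod>j\<in>J - {k}. Y j Q)) \<le> T k * (\<Prod>j\<in>J. x j Q powr \<theta> j)" if Q: "Q \<in> S" for Q
    proof -
      have 1: "x k Q powr \<theta> k = (LINT x:Q|M. v k x) powr \<theta> k * incr (Y k) Q"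
        using \<theta>(1)[OF k] incr_nonneg[OF Y[OF k] Q] by (simp add: x_def powr_mult powr_powr)
      have 2: "(LINT x:Q|M. v j x) powr \<theta> j * Y j Q = Ainf_quotient (v j) Q powr \<theta> j * x j Q powr \<theta> j"
        if j: "j \<in> J - {k}" for j
      proof -
        have "(LINT x:Q|M. v j x) = Ainf_quotient (v j) Q * (measure M Q * ln_mean (v j) Q)"
          using measure_pos[OF Q] by (simp add: Ainf_quotient_def mean_def ln_mean_def)
        then have "(LINT x:Q|M. v j x) * H j Q powr r j = Ainf_quotient (v j) Q * x j Q"
          using j by (simp add: x_def)
        then have "((LINT x:Q|M. v j x) * H j Q powr r j) powr \<theta> j = (Ainf_quotient (v j) Q * x j Q) powr \<theta> j"
          by simp
        then show ?thesis by (simp add: powr_mult powr_powr Y_def)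
      qed
      have 3: "(\<Prod>j\<in>J - {k}. (LINT x:Q|M. v j x) powr \<theta> j) * (\<Prod>j\<in>J - {k}. Y j Q)
          = (\<Prod>j\<in>J - {k}. Ainf_quotient (v j) Q powr \<theta> j) * (\<Prod>j\<in>J - {k}. x j Q powr \<theta> j)"
        unfolding prod.distrib[symmetric] by (intro prod.cong refl 2)
      have "\<kappa> Q * (incr (Y k) Q * (\<Prod>j\<in>J - {k}. Y j Q))
          = ((LINT x:Q|M. v k x) powr \<theta> k * incr (Y k) Q) *
            ((\<Prod>j\<in>J - {k}. (LINT x:Q|M. v j x) powr \<theta> j) * (\<Prod>j\<in>J - {k}. Y j Q))"
        unfolding \<kappa>_def prod.remove[OF J k] by (simp only: mult_ac)
      also have "\<dots> = (\<Prod>j\<in>J - {k}. Ainf_quotient (v j) Q powr \<theta> j) * (\<Prod>j\<in>J. x j Q powr \<theta> j)"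
        unfolding 3 1[symmetric] prod.remove[OF J k] by (simp only: mult_ac)
      also have "\<dots> \<le> T k * (\<Prod>j\<in>J. x j Q powr \<theta> j)"
        using T[OF k Q] by (intro mult_right_mono) (auto intro: prod_nonneg)
      finally show ?thesis .
    qed
    have "(\<Sum>Q\<in>S. \<kappa> Q * (incr (Y k) Q * (\<Prod>j\<in>J - {k}. Y j Q))) \<le> T k * (\<Sum>Q\<in>S. \<Prod>j\<in>J. x j Q powr \<theta> j)"
      unfolding sum_distrib_left by (intro sum_mono pt)
    also have "\<dots> \<le> T k * E"
    proof (rule mult_left_mono[OF _ T0[OF k]])
      have "(\<Sum>Q\<in>S. \<Prod>j\<in>J. x j Q powr \<theta> j) \<le> (\<Prod>j\<in>J. (\<Sum>Q\<in>S. x j Q) powr \<theta> j)"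
        using \<theta> x0 by (intro Holder_sum_prod_powr finite_family J)
      also have "\<dots> \<le> E"
        unfolding E_def
      proof (intro prod_mono conjI powr_mono2)
        fix j assume j: "j \<in> J"
        show "(\<Sum>Q\<in>S. x j Q) \<le> h_bound j"
        proof (cases "j = k")
          case True
          have "(\<Sum>Q\<in>S. x j Q) \<le> (\<Sum>Q\<in>S. (LINT x:Q|M. v j x) * incr (\<lambda>Q. H j Q powr r j) Q)"
          proof (intro sum_mono)
            fix Q assume Q: "Q \<in> S"
            \<comment> \<open>This is the step that requires \<open>\<theta> j \<le> 1\<close>.\<close>
            have "incr (Y j) Q powr (1 / \<theta> j) \<le> incr (\<lambda>Q. Y j Q powr (1 / \<theta> j)) Q"
              using Y[OF j] \<theta>(1)[OF j] \<theta>1[OF j] Q by (intro incr_powr_le) auto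
            also have "(\<lambda>Q. Y j Q powr (1 / \<theta> j)) = (\<lambda>Q. H j Q powr r j)"
              using \<theta>(1)[OF j] by (simp add: Y_def powr_powr)
            finally show "x j Q \<le> (LINT x:Q|M. v j x) * incr (\<lambda>Q. H j Q powr r j) Q"
              using True vpos[OF j Q] by (simp add: x_def mult_left_mono)
          qed
          also have "\<dots> \<le> h_bound j"
            unfolding H_def by (rule maximal_term[OF j])
          finally show ?thesis .
        next
          case False
          then show ?thesis using embedding_term[OF j] by (simp add: x_def H_def)
        qed
      qed (use \<theta> x0 in \<open>auto intro!: sum_nonneg simp: less_imp_le\<close>)
      finally show "(\<Sum>Q\<in>S. \<Prod>j\<in>J. x j Q powr \<theta> j) \<le> E" .
    qed
    finally show ?thesis .
  qed
  have "(\<Sum>Q\<in>S. \<Prod>j\<in>J. ((LINT x:Q|M. v j x) * h_mean j Q powr r j) powr \<theta> j)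
      \<le> (\<Sum>Q\<in>S. \<kappa> Q * (\<Prod>j\<in>J. Y j Q))"
  proof (rule sum_mono)
    fix Q assume Q: "Q \<in> S"
    have "(\<Prod>j\<in>J. ((LINT x:Q|M. v j x) * h_mean j Q powr r j) powr \<theta> j)
        = \<kappa> Q * (\<Prod>j\<in>J. h_mean j Q powr (r j * \<theta> j))"
      by (simp add: \<kappa>_def powr_mult powr_powr prod.distrib)
    also have "\<dots> \<le> \<kappa> Q * (\<Prod>j\<in>J. Y j Q)"
    proof (intro mult_left_mono prod_mono \<kappa>0 conjI)
      fix j assume j: "j \<in> J"
      show "h_mean j Q powr (r j * \<theta> j) \<le> Y j Q"
        unfolding Y_def H_def using r[OF j] \<theta>(1)[OF j] wmean_nonneg[OF j] Q
        by (intro powr_mono2 runmax_ge) auto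
    qed auto
    finally show "(\<Prod>j\<in>J. ((LINT x:Q|M. v j x) * h_mean j Q powr r j) powr \<theta> j) \<le> \<kappa> Q * (\<Prod>j\<in>J. Y j Q)" .
  qed
  also have "\<dots> \<le> pack_const K J \<theta> e * (\<Sum>Q\<in>S. \<kappa> Q * incr (\<lambda>Q. \<Prod>j\<in>J. Y j Q) Q)"
    unfolding \<kappa>_def using K
    by (intro Carleson_summation antitone_prod Y Carleson_packing_on_level[OF _ _ J \<theta> e v(1-3) level]) auto
  also have "(\<Sum>Q\<in>S. \<kappa> Q * incr (\<lambda>Q. \<Prod>j\<in>J. Y j Q) Q)
      \<le> (\<Sum>Q\<in>S. \<kappa> Q * (\<Sum>k\<in>J. incr (Y k) Q * (\<Prod>j\<in>J - {k}. Y j Q)))"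
    using Y by (intro sum_mono mult_left_mono incr_prod_le \<kappa>0 J J0)
  also have "\<dots> = (\<Sum>k\<in>J. \<Sum>Q\<in>S. \<kappa> Q * (incr (Y k) Q * (\<Prod>j\<in>J - {k}. Y j Q)))"
    by (simp only: sum_distrib_left sum.swap[of _ J S])
  also have "\<dots> \<le> (\<Sum>k\<in>J. T k * E)"
    by (intro sum_mono term_k)
  finally have "(\<Sum>Q\<in>S. \<Prod>j\<in>J. ((LINT x:Q|M. v j x) * h_mean j Q powr r j) powr \<theta> j)
      \<le> pack_const K J \<theta> e * (\<Sum>k\<in>J. T k * E)"
    using pc by (simp add: mult_left_mono)
  then show ?thesis by (simp add: E_def sum_distrib_right mult.assoc)
qed

text \<open>The packing argument needs the product \<open>N\<close> to be constant up to a factor 2, so the family is cut into the level sets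
  \<open>2 powr k \<le> N \<le> 2 * 2 powr k\<close>. The bound on each of them does not depend on \<open>k\<close>, and the
  factor \<open>N powr \<tau>\<close> makes the sum over \<open>k\<close> geometric, dominated by the largest level \<open>A\<close>.\<close>

theorem multilinear_embedding:
  fixes T e :: "'j \<Rightarrow> real"
  assumes \<theta>1: "\<And>j. j \<in> J \<Longrightarrow> \<theta> j \<le> 1" and e: "\<And>j. j \<in> J \<Longrightarrow> 0 < e j"
    and \<tau>: "0 < \<tau>" and A: "0 < A" "\<And>Q. Q \<in> S \<Longrightarrow> (\<Prod>j\<in>J. mean M Q (v j) powr e j) \<le> A"
    and T0: "\<And>k. k \<in> J \<Longrightarrow> 0 \<le> T k"
    and T: "\<And>k Q. k \<in> J \<Longrightarrow> Q \<in> S \<Longrightarrow> (\<Prod>j\<in>J - {k}. Ainf_quotient (v j) Q powr \<theta> j) \<le> T k"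
  shows "(\<Sum>Q\<in>S. (\<Prod>j\<in>J. mean M Q (v j) powr e j) powr \<tau> *
        (\<Prod>j\<in>J. ((LINT x:Q|M. v j x) * h_mean j Q powr r j) powr \<theta> j))
    \<le> 2 powr \<tau> * A powr \<tau> / (1 - 2 powr - \<tau>) *
      (pack_const K J \<theta> e * (\<Sum>k\<in>J. T k) * (\<Prod>j\<in>J. h_bound j powr \<theta> j))"
proof -
  define N where "N Q = (\<Prod>j\<in>J. mean M Q (v j) powr e j)" for Q
  define X where "X Q = (\<Prod>j\<in>J. ((LINT x:Q|M. v j x) * h_mean j Q powr r j) powr \<theta> j)" for Q
  define B where "B = pack_const K J \<theta> e * (\<Sum>k\<in>J. T k) * (\<Prod>j\<in>J. h_bound j powr \<theta> j)"
  define a where "a Q = \<lfloor>log 2 (N Q)\<rfloor>" for Q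
  have N: "0 < N Q" if Q: "Q \<in> S" for Q
    unfolding N_def
  proof (intro prod_pos)
    fix j assume j: "j \<in> J"
    have "0 < mean M Q (v j)"
      unfolding mean_def using measure_pos[OF Q] set_integral_pos[of M Q "v j"] Q j v by simp
    then show "0 < mean M Q (v j) powr e j" by simp
  qed
  have a: "2 powr a Q \<le> N Q" "N Q \<le> 2 * 2 powr a Q" if Q: "Q \<in> S" for Q
  proof -
    show "2 powr a Q \<le> N Q"
      using N[OF Q] by (subst le_log_iff[symmetric]) (auto simp: a_def)
    have "log 2 (N Q) \<le> a Q + 1" unfolding a_def by linarith
    then have "N Q \<le> 2 powr (a Q + 1)"
      using N[OF Q] by (subst (asm) log_le_iff) auto
    then show "N Q \<le> 2 * 2 powr a Q" by (simp add: powr_add)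
  qed
  have X0: "0 \<le> X Q" for Q by (simp add: X_def prod_nonneg)
  have B0: "0 \<le> B"
    unfolding B_def using T0 by (intro mult_nonneg_nonneg sum_nonneg prod_nonneg) (auto simp: pack_const_def)
  have level: "(\<Sum>Q\<in>{Q \<in> S. a Q = k}. X Q) \<le> B" if "k \<in> a ` S" for k
  proof -
    define U where "U = {Q \<in> S. a Q = k}"
    have U: "U \<subseteq> S" by (auto simp: U_def)
    interpret U: measured_laminar_family U M by (rule restrict_family[OF U])
    show ?thesis
      unfolding X_def B_def U_def[symmetric]
    proof (rule U.multilinear_level_embedding[where lo = "2 powr real_of_int k"])
      show "U.Carleson K" by (rule Carleson_subfamily[OF K(1) U])
      show "2 powr real_of_int k \<le> (\<Prod>j\<in>J. mean M Q (v j) powr e j)"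
        "(\<Prod>j\<in>J. mean M Q (v j) powr e j) \<le> 2 * 2 powr real_of_int k" if "Q \<in> U" for Q
        using a[of Q] that by (auto simp: U_def N_def)
    qed (use K J \<theta> r v h \<theta>1 e T0 T U in auto)
  qed
  have "(\<Sum>Q\<in>S. N Q powr \<tau> * X Q) \<le> (\<Sum>Q\<in>S. (2 * 2 powr a Q) powr \<tau> * X Q)"
    using a N \<tau> X0 by (intro sum_mono mult_right_mono powr_mono2) (auto simp: less_imp_le)
  also have "\<dots> = (\<Sum>k\<in>a ` S. \<Sum>Q\<in>{Q \<in> S. a Q = k}. (2 * 2 powr a Q) powr \<tau> * X Q)"
    by (rule sum.image_gen[OF finite_family])
  also have "\<dots> = (\<Sum>k\<in>a ` S. 2 powr \<tau> * ((2 powr k) powr \<tau> * (\<Sum>Q\<in>{Q \<in> S. a Q = k}. X Q)))"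
    unfolding sum_distrib_left by (intro sum.cong refl) (auto simp: powr_mult)
  also have "\<dots> \<le> (\<Sum>k\<in>a ` S. 2 powr \<tau> * ((2 powr k) powr \<tau> * B))"
    using level by (intro sum_mono mult_left_mono) auto
  also have "\<dots> = 2 powr \<tau> * ((\<Sum>k\<in>a ` S. (2 powr k) powr \<tau>) * B)"
    by (simp add: sum_distrib_left sum_distrib_right)
  also have "\<dots> \<le> 2 powr \<tau> * (A powr \<tau> / (1 - 2 powr - \<tau>) * B)"
  proof (intro mult_left_mono mult_right_mono sum_dyadic_powr_le \<tau> A B0)
    show "2 powr k \<le> A" if "k \<in> a ` S" for k
      using that a(1) A(2) unfolding N_def by force
  qed (use finite_family in auto)
  finally show ?thesis by (simp add: N_def X_def B_def)
qed

end

end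

section \<open>Finite sparse sums\<close>

text \<open>Here \<open>\<mu>\<close> is the measure of a cube, \<open>s i\<close> the average of the \<open>i\<close>-th weight and \<open>w i\<close> a weighted average, so
  that \<open>s i * w i\<close> is an average of \<open>\<bar>f i\<bar> powr p0\<close>. The second factor on the right belongs to the weight
  constant and the third is the shape the multilinear embeddings expect; the value of \<open>\<eta>\<close> makes the powers of \<open>\<mu>\<close> match.\<close>

lemma sparse_factorization:
  fixes \<mu> p0 q a \<eta> :: real and s w p :: "'i \<Rightarrow> real"
  assumes "finite I" "0 < \<mu>" "0 < p0" "0 < q" "\<And>i. i \<in> I \<Longrightarrow> 0 < p i"
    and s: "\<And>i. i \<in> I \<Longrightarrow> 0 < s i" and \<eta>: "\<eta> = (\<Sum>i\<in>I. 1 / p i) - 1 / q"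
  shows "(\<mu> powr \<eta> * (\<Prod>i\<in>I. (s i * w i) powr (1 / p0))) powr a
    = \<mu> powr - (a / q) * (\<Prod>i\<in>I. s i powr (q * (1 / p0 - 1 / p i))) powr (a / q)
      * (\<Prod>i\<in>I. (\<mu> * (s i * w i powr (p i / p0))) powr (a / p i))"
proof -
  have "(\<Prod>i\<in>I. s i powr (q * (1 / p0 - 1 / p i))) powr (a / q)
      * (\<Prod>i\<in>I. (\<mu> * (s i * w i powr (p i / p0))) powr (a / p i))
    = (\<Prod>i\<in>I. \<mu> powr (a / p i) * (s i * w i) powr (a / p0))"
    unfolding prod_powr_distrib prod.distrib[symmetric]
  proof (intro prod.cong refl)
    fix i assume i: "i \<in> I"
    have "(s i powr (q * (1 / p0 - 1 / p i))) powr (a / q) * (\<mu> * (s i * w i powr (p i / p0))) powr (a / p i)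
      = \<mu> powr (a / p i) * ((s i powr ((1 / p0 - 1 / p i) * a) * s i powr (a / p i)) * w i powr (a / p0))"
      using assms(4) assms(5)[OF i] by (simp add: powr_mult powr_powr)
    also have "s i powr ((1 / p0 - 1 / p i) * a) * s i powr (a / p i) = s i powr (a / p0)"
      by (simp add: algebra_simps flip: powr_add)
    finally show "(s i powr (q * (1 / p0 - 1 / p i))) powr (a / q) * (\<mu> * (s i * w i powr (p i / p0))) powr (a / p i)
      = \<mu> powr (a / p i) * (s i * w i) powr (a / p0)" by (simp add: powr_mult)
  qed
  also have "\<dots> = \<mu> powr (\<Sum>i\<in>I. a / p i) * (\<Prod>i\<in>I. (s i * w i) powr (a / p0))"
    using assms(1,2) by (simp add: prod.distrib powr_sum)
  also have "(\<Sum>i\<in>I. a / p i) = a * \<eta> + a / q"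
    by (simp add: \<eta> algebra_simps sum_distrib_left)
  finally have eq: "(\<Prod>i\<in>I. s i powr (q * (1 / p0 - 1 / p i))) powr (a / q)
      * (\<Prod>i\<in>I. (\<mu> * (s i * w i powr (p i / p0))) powr (a / p i))
    = \<mu> powr (a * \<eta> + a / q) * (\<Prod>i\<in>I. (s i * w i) powr (a / p0))" .
  show ?thesis
    unfolding mult.assoc eq
    by (simp add: powr_mult powr_powr prod_powr_distrib mult_ac flip: powr_add)
qed

lemma sum_powr_le_powr_sum:
  fixes x :: "'b \<Rightarrow> real"
  assumes "finite S" "0 < a" "a \<le> 1" "\<And>Q. Q \<in> S \<Longrightarrow> 0 \<le> x Q"
  shows "(\<Sum>Q\<in>S. x Q) powr a \<le> (\<Sum>Q\<in>S. x Q powr a)"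
proof -
  have "(\<Sum>Q\<in>S. x Q) = (\<Sum>Q\<in>S. (x Q powr a) powr (1 / a))"
    using assms by (intro sum.cong refl) (simp add: powr_powr)
  also have "\<dots> \<le> (\<Sum>Q\<in>S. x Q powr a) powr (1 / a)"
    using Holder_sum_prod_powr[OF assms(1), of "{()}" "\<lambda>_. 1 / a" "\<lambda>_ Q. x Q powr a"] assms by simp
  finally have "(\<Sum>Q\<in>S. x Q) powr a \<le> ((\<Sum>Q\<in>S. x Q powr a) powr (1 / a)) powr a"
    using assms by (intro powr_mono2 sum_nonneg) auto
  then show ?thesis using assms by (simp add: powr_powr sum_nonneg)
qed

text \<open>For \<open>q > \<gamma>\<close> the weight \<open>u\<close>, paired with a dual function in \<open>L\<^bsup>t\<^esup>(u)\<close> for the conjugate exponent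
  \<open>t = q / (q - \<gamma>)\<close> of \<open>q / \<gamma>\<close>, is treated on the same footing as the \<open>\<sigma> i\<close> and gets the index 0.\<close>

definition dual_exponent :: "real \<Rightarrow> real \<Rightarrow> (nat \<Rightarrow> real) \<Rightarrow> nat \<Rightarrow> real" where
  "dual_exponent q \<gamma> p j = (if j = 0 then 1 - \<gamma> / q else \<gamma> / p j)"

definition dual_power :: "real \<Rightarrow> real \<Rightarrow> real \<Rightarrow> (nat \<Rightarrow> real) \<Rightarrow> nat \<Rightarrow> real" where
  "dual_power p0 q \<gamma> p j = (if j = 0 then q / (q - \<gamma>) else p j / p0)"

definition level_exponent :: "real \<Rightarrow> real \<Rightarrow> (nat \<Rightarrow> real) \<Rightarrow> nat \<Rightarrow> real" where
  "level_exponent p0 q p j = (if j = 0 then 1 else q * (1 / p0 - 1 / p j))"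

definition large_q_const :: "real \<Rightarrow> real \<Rightarrow> real \<Rightarrow> real \<Rightarrow> nat \<Rightarrow> (nat \<Rightarrow> real) \<Rightarrow> real" where
  "large_q_const K p0 q \<gamma> m p = 2 powr (\<gamma> / q) / (1 - 2 powr - (\<gamma> / q)) *
     pack_const K (insert 0 {1..m}) (dual_exponent q \<gamma> p) (level_exponent p0 q p) *
     (\<Prod>j\<in>insert 0 {1..m}. (4 * K * (dual_power p0 q \<gamma> p j / (dual_power p0 q \<gamma> p j - 1)) powr dual_power p0 q \<gamma> p j)
        powr dual_exponent q \<gamma> p j)"

definition sparse_const :: "real \<Rightarrow> real \<Rightarrow> real \<Rightarrow> real \<Rightarrow> nat \<Rightarrow> (nat \<Rightarrow> real) \<Rightarrow> real" where
  "sparse_const K p0 q \<gamma> m p = 1 + (\<Prod>i=1..m. (4 * K * (p i / p0 / (p i / p0 - 1)) powr (p i / p0)) powr (1 / p i)) +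
     (real m + 1) powr (1 / \<gamma>) * large_q_const K p0 q \<gamma> m p powr (1 / \<gamma>)"

context measured_laminar_family
begin

definition sparse_coeff :: "real \<Rightarrow> real \<Rightarrow> nat \<Rightarrow> (nat \<Rightarrow> 'a \<Rightarrow> real) \<Rightarrow> 'a set \<Rightarrow> real" where
  "sparse_coeff \<eta> p0 m f Q = measure M Q powr \<eta> * (\<Prod>i=1..m. mean M Q (\<lambda>x. \<bar>f i x\<bar> powr p0) powr (1 / p0))"

definition sparse_sum :: "real \<Rightarrow> real \<Rightarrow> real \<Rightarrow> nat \<Rightarrow> (nat \<Rightarrow> 'a \<Rightarrow> real) \<Rightarrow> 'a \<Rightarrow> real" where
  "sparse_sum \<eta> p0 \<gamma> m f x = (\<Sum>Q\<in>S. sparse_coeff \<eta> p0 m f Q powr \<gamma> * indicator Q x)"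

lemma sparse_sum_nonneg: "0 \<le> sparse_sum \<eta> p0 \<gamma> m f x"
  by (simp add: sparse_sum_def sum_nonneg)

lemma measurable_sparse_sum [measurable]: "sparse_sum \<eta> p0 \<gamma> m f \<in> borel_measurable M"
  unfolding sparse_sum_def[abs_def] by measurable

lemma integrable_sparse_sum_powr:
  assumes "0 < a" "u \<in> borel_measurable M" "\<And>x. 0 < u x" "\<And>Q. Q \<in> S \<Longrightarrow> set_integrable M Q u"
  shows "integrable M (\<lambda>x. sparse_sum \<eta> p0 \<gamma> m f x powr a * u x)"
proof -
  define C where "C = (\<Sum>Q\<in>S. sparse_coeff \<eta> p0 m f Q powr \<gamma>)"
  have [measurable]: "u \<in> borel_measurable M" by fact
  have "integrable M (\<lambda>x. C powr a * (\<Sum>Q\<in>S. indicator Q x *\<^sub>R u x))"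
    using assms(4) unfolding set_integrable_def
    by (intro integrable_mult_right Bochner_Integration.integrable_sum)
  then show ?thesis
  proof (rule Bochner_Integration.integrable_bound)
    show "AE x in M. norm (sparse_sum \<eta> p0 \<gamma> m f x powr a * u x) \<le> norm (C powr a * (\<Sum>Q\<in>S. indicator Q x *\<^sub>R u x))"
    proof (rule AE_I2)
      fix x
      have u: "0 \<le> u x" using assms(3)[of x] by simp
      have "sparse_sum \<eta> p0 \<gamma> m f x powr a * u x \<le> C powr a * (\<Sum>Q\<in>S. indicator Q x *\<^sub>R u x)"
      proof (cases "\<exists>Q\<in>S. x \<in> Q")
        case True
        then obtain Q where Q: "Q \<in> S" "x \<in> Q" by auto
        have "sparse_sum \<eta> p0 \<gamma> m f x \<le> C"
          unfolding sparse_sum_def C_def by (intro sum_mono) (auto simp: indicator_def)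
        then have "sparse_sum \<eta> p0 \<gamma> m f x powr a \<le> C powr a"
          using assms(1) sparse_sum_nonneg by (intro powr_mono2) auto
        moreover have "indicator Q x *\<^sub>R u x \<le> (\<Sum>Q\<in>S. indicator Q x *\<^sub>R u x)"
          using Q u finite_family by (intro member_le_sum) auto
        ultimately show ?thesis using Q u by (intro mult_mono) auto
      next
        case False
        then have "sparse_sum \<eta> p0 \<gamma> m f x = 0"
          unfolding sparse_sum_def by (intro sum.neutral) auto
        then show ?thesis using u by (simp add: sum_nonneg)
      qed
      then show "norm (sparse_sum \<eta> p0 \<gamma> m f x powr a * u x) \<le> norm (C powr a * (\<Sum>Q\<in>S. indicator Q x *\<^sub>R u x))"
        using u by (simp add: abs_mult sum_nonneg)
    qed
  qed measurable
qed

context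
  fixes K p0 q \<gamma> \<eta> A :: real and m :: nat and p :: "nat \<Rightarrow> real" and u :: "'a \<Rightarrow> real"
    and \<sigma> f :: "nat \<Rightarrow> 'a \<Rightarrow> real"
  assumes K: "Carleson K" "1 \<le> K" and m: "1 \<le> m" and \<gamma>: "0 < \<gamma>" and q: "0 < q" and p0: "1 \<le> p0"
    and p: "\<And>i. i \<in> {1..m} \<Longrightarrow> p0 < p i" and \<eta>: "\<eta> = (\<Sum>i=1..m. 1 / p i) - 1 / q" "0 \<le> \<eta>"
    and u: "u \<in> borel_measurable M" "\<And>x. 0 < u x" "\<And>Q. Q \<in> S \<Longrightarrow> set_integrable M Q u"
    and \<sigma>: "\<And>i. i \<in> {1..m} \<Longrightarrow> \<sigma> i \<in> borel_measurable M" "\<And>i x. i \<in> {1..m} \<Longrightarrow> 0 < \<sigma> i x"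
      "\<And>i Q. i \<in> {1..m} \<Longrightarrow> Q \<in> S \<Longrightarrow> set_integrable M Q (\<sigma> i)"
      "\<And>i Q. i \<in> {1..m} \<Longrightarrow> Q \<in> S \<Longrightarrow> set_integrable M Q (\<lambda>x. ln (\<sigma> i x))"
    and f: "\<And>i. i \<in> {1..m} \<Longrightarrow> f i \<in> borel_measurable M"
      "\<And>i. i \<in> {1..m} \<Longrightarrow> integrable M (\<lambda>x. \<bar>f i x\<bar> powr p i * \<sigma> i x powr (1 - p i / p0))"
    and A: "0 < A" "\<And>Q. Q \<in> S \<Longrightarrow> mean M Q u * (\<Prod>i=1..m. mean M Q (\<sigma> i) powr (q * (1 / p0 - 1 / p i))) \<le> A"
begin

abbreviation f_power :: "nat \<Rightarrow> real" where
  "f_power i \<equiv> (\<integral>x. \<bar>f i x\<bar> powr p i * \<sigma> i x powr (1 - p i / p0) \<partial>M)"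

abbreviation \<sigma>_level :: "'a set \<Rightarrow> real" where
  "\<sigma>_level Q \<equiv> (\<Prod>i=1..m. mean M Q (\<sigma> i) powr (q * (1 / p0 - 1 / p i)))"

text \<open>The density of \<open>\<bar>f i\<bar> powr p0\<close> relative to \<open>\<sigma> i\<close>: its norm in \<open>L\<^bsup>p i / p0\<^esup>(\<sigma> i)\<close> is the \<open>p0\<close>-th power
  of that of \<open>f i\<close> in \<open>L\<^bsup>p i\<^esup>(\<sigma> i powr (1 - p i / p0))\<close>.\<close>

definition rel_density :: "nat \<Rightarrow> 'a \<Rightarrow> real" where
  "rel_density i x = \<bar>f i x\<bar> powr p0 / \<sigma> i x"

lemma rel_density_props:
  assumes i: "i \<in> {1..m}"
  shows "rel_density i \<in> borel_measurable M" "0 \<le> rel_density i x"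
    "rel_density i x * \<sigma> i x = \<bar>f i x\<bar> powr p0"
    "rel_density i x powr (p i / p0) * \<sigma> i x = \<bar>f i x\<bar> powr p i * \<sigma> i x powr (1 - p i / p0)"
proof -
  have [measurable]: "f i \<in> borel_measurable M" "\<sigma> i \<in> borel_measurable M" using f(1) \<sigma>(1) i by auto
  show "rel_density i \<in> borel_measurable M" unfolding rel_density_def[abs_def] by measurable
  have s: "0 < \<sigma> i x" using \<sigma>(2) i by auto
  then show "0 \<le> rel_density i x" "rel_density i x * \<sigma> i x = \<bar>f i x\<bar> powr p0" by (auto simp: rel_density_def)
  have "\<sigma> i x powr (1 - p i / p0) = \<sigma> i x / \<sigma> i x powr (p i / p0)"
    using s by (simp add: powr_diff)
  then show "rel_density i x powr (p i / p0) * \<sigma> i x = \<bar>f i x\<bar> powr p i * \<sigma> i x powr (1 - p i / p0)"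
    using s p0 by (simp add: rel_density_def powr_divide powr_powr)
qed

lemma integrable_rel_density: "i \<in> {1..m} \<Longrightarrow> integrable M (\<lambda>x. rel_density i x powr (p i / p0) * \<sigma> i x)"
  using f(2) by (simp only: rel_density_props(4))

lemma mean_pos: "i \<in> {1..m} \<Longrightarrow> Q \<in> S \<Longrightarrow> 0 < mean M Q (\<sigma> i)"
  unfolding mean_def using measure_pos[of Q] set_integral_pos[of M Q "\<sigma> i"] \<sigma> by simp

lemma u_mean_pos: "Q \<in> S \<Longrightarrow> 0 < mean M Q u"
  unfolding mean_def using measure_pos[of Q] set_integral_pos[of M Q u] u by simp

lemma sparse_coeff_factorization:
  assumes Q: "Q \<in> S"
  shows "sparse_coeff \<eta> p0 m f Q powr a
    = measure M Q powr - (a / q) * \<sigma>_level Q powr (a / q)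
      * (\<Prod>i=1..m. ((LINT x:Q|M. \<sigma> i x) * wmean (\<sigma> i) (rel_density i) Q powr (p i / p0)) powr (a / p i))"
proof -
  have m1: "mean M Q (\<lambda>x. \<bar>f i x\<bar> powr p0) = mean M Q (\<sigma> i) * wmean (\<sigma> i) (rel_density i) Q" if i: "i \<in> {1..m}" for i
    using mean_pos[OF i Q] unfolding mean_def wmean_def rel_density_props(3)[OF i]
    by (cases "(LINT x:Q|M. \<sigma> i x) = 0") auto
  have m2: "(LINT x:Q|M. \<sigma> i x) = measure M Q * mean M Q (\<sigma> i)" for i
    using measure_pos[OF Q] by (simp add: mean_def)
  have "sparse_coeff \<eta> p0 m f Q
    = measure M Q powr \<eta> * (\<Prod>i=1..m. (mean M Q (\<sigma> i) * wmean (\<sigma> i) (rel_density i) Q) powr (1 / p0))"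
    unfolding sparse_coeff_def using m1 by simp
  then show ?thesis
    unfolding m2 mult.assoc[of "measure M Q" "mean M Q _"]
    using sparse_factorization[of "{1..m}" "measure M Q" p0 q p "\<lambda>i. mean M Q (\<sigma> i)" \<eta> "\<lambda>i. wmean (\<sigma> i) (rel_density i) Q" a]
      measure_pos[OF Q] p0 p q \<eta>(1) mean_pos[OF _ Q] by force
qed

text \<open>Since \<open>q / \<gamma> \<le> 1\<close> the power can be taken inside the sum, which removes all interaction between cubes.
  The weight \<open>u\<close> is absorbed by the weight constant, and all \<open>\<sigma> i\<close> pass to geometric means.\<close>

theorem sparse_bound_small_q:
  assumes "q \<le> \<gamma>" and T0: "0 \<le> T" and T: "\<And>Q. Q \<in> S \<Longrightarrow> (\<Prod>i=1..m. Ainf_quotient (\<sigma> i) Q powr (q / p i)) \<le> T"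
  shows "(\<integral>x. sparse_sum \<eta> p0 \<gamma> m f x powr (q / \<gamma>) * u x \<partial>M)
    \<le> A * T * (\<Prod>i=1..m. (4 * K * (p i / p0 / (p i / p0 - 1)) powr (p i / p0) *
         f_power i) powr (q / p i))"
proof -
  have iQ: "integrable M (\<lambda>x. sparse_coeff \<eta> p0 m f Q powr q * (indicator Q x *\<^sub>R u x))" if "Q \<in> S" for Q
    using u(3)[OF that] unfolding set_integrable_def by (rule integrable_mult_right)
  define Z where "Z Q = (\<Prod>i=1..m. (measure M Q * ln_mean (\<sigma> i) Q * wmean (\<sigma> i) (rel_density i) Q powr (p i / p0)) powr (q / p i))" for Q
  have "(\<integral>x. sparse_sum \<eta> p0 \<gamma> m f x powr (q / \<gamma>) * u x \<partial>M)
      \<le> (\<integral>x. (\<Sum>Q\<in>S. sparse_coeff \<eta> p0 m f Q powr q * (indicator Q x *\<^sub>R u x)) \<partial>M)"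
  proof (intro integral_mono integrable_sparse_sum_powr u Bochner_Integration.integrable_sum iQ)
    fix x
    have "sparse_sum \<eta> p0 \<gamma> m f x powr (q / \<gamma>)
        \<le> (\<Sum>Q\<in>S. (sparse_coeff \<eta> p0 m f Q powr \<gamma> * indicator Q x) powr (q / \<gamma>))"
      unfolding sparse_sum_def using \<gamma> q assms(1)
      by (intro sum_powr_le_powr_sum finite_family) auto
    also have "\<dots> = (\<Sum>Q\<in>S. sparse_coeff \<eta> p0 m f Q powr q * indicator Q x)"
      using \<gamma> by (intro sum.cong refl) (auto simp: indicator_def powr_powr)
    finally have "sparse_sum \<eta> p0 \<gamma> m f x powr (q / \<gamma>) * u x
      \<le> (\<Sum>Q\<in>S. sparse_coeff \<eta> p0 m f Q powr q * indicator Q x) * u x"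
      using u(2)[of x] by (intro mult_right_mono) auto
    then show "sparse_sum \<eta> p0 \<gamma> m f x powr (q / \<gamma>) * u x
      \<le> (\<Sum>Q\<in>S. sparse_coeff \<eta> p0 m f Q powr q * (indicator Q x *\<^sub>R u x))"
      by (simp add: sum_distrib_right mult.assoc)
  qed (use q \<gamma> in auto)
  also have "\<dots> = (\<Sum>Q\<in>S. sparse_coeff \<eta> p0 m f Q powr q * (LINT x:Q|M. u x))"
    using iQ by (simp add: Bochner_Integration.integral_sum set_lebesgue_integral_def)
  also have "\<dots> \<le> (\<Sum>Q\<in>S. A * T * Z Q)"
  proof (rule sum_mono)
    fix Q assume Q: "Q \<in> S"
    have v: "(LINT x:Q|M. \<sigma> i x) = Ainf_quotient (\<sigma> i) Q * (measure M Q * ln_mean (\<sigma> i) Q)" for i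
      using measure_pos[OF Q] by (simp add: Ainf_quotient_def mean_def ln_mean_def)
    have "sparse_coeff \<eta> p0 m f Q powr q * (LINT x:Q|M. u x)
       = (mean M Q u * \<sigma>_level Q)
         * ((\<Prod>i=1..m. Ainf_quotient (\<sigma> i) Q powr (q / p i)) * Z Q)"
    proof -
      have "(\<Prod>i=1..m. ((LINT x:Q|M. \<sigma> i x) * wmean (\<sigma> i) (rel_density i) Q powr (p i / p0)) powr (q / p i))
         = (\<Prod>i=1..m. Ainf_quotient (\<sigma> i) Q powr (q / p i)) * Z Q"
        unfolding Z_def v prod.distrib[symmetric] by (simp only: powr_mult mult.assoc)
      moreover have "(LINT x:Q|M. u x) = measure M Q * mean M Q u"
        using measure_pos[OF Q] by (simp add: mean_def)
      moreover have "measure M Q powr - 1 * measure M Q = 1"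
        using measure_pos[OF Q] by (simp add: powr_minus_divide)
      moreover have "\<sigma>_level Q powr 1
         = \<sigma>_level Q"
        by (simp add: prod_nonneg)
      ultimately show ?thesis
        unfolding sparse_coeff_factorization[OF Q] using q measure_pos[OF Q] by simp
    qed
    also have "\<dots> \<le> A * (T * Z Q)"
      using A T Q u_mean_pos[OF Q]
      by (intro mult_mono A T mult_right_mono mult_nonneg_nonneg) (auto simp: Z_def prod_nonneg)
    finally show "sparse_coeff \<eta> p0 m f Q powr q * (LINT x:Q|M. u x) \<le> A * T * Z Q"
      by (simp add: mult.assoc)
  qed
  also have "\<dots> = A * T * (\<Sum>Q\<in>S. Z Q)" by (simp add: sum_distrib_left)
  also have "\<dots> \<le> A * T * (\<Prod>i=1..m. embed_bound K (p i / p0) (\<sigma> i) (rel_density i) powr (q / p i))"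
  proof -
    have th: "1 \<le> (\<Sum>i=1..m. q / p i)"
    proof -
      have "(\<Sum>i=1..m. q / p i) = q * \<eta> + 1"
        using q by (simp add: \<eta>(1) algebra_simps sum_distrib_left)
      then show ?thesis using q \<eta>(2) by simp
    qed
    have r: "1 < p i / p0" "0 < q / p i" if "i \<in> {1..m}" for i
      using p[OF that] p0 q by auto
    have "(\<Sum>Q\<in>S. Z Q) \<le> (\<Prod>i=1..m. embed_bound K (p i / p0) (\<sigma> i) (rel_density i) powr (q / p i))"
      unfolding Z_def using rel_density_props(1,2)
      by (intro multilinear_log_embedding K r th \<sigma> integrable_rel_density) auto
    then show ?thesis using A(1) T0 by (intro mult_left_mono) auto
  qed
  also have "(\<Prod>i=1..m. embed_bound K (p i / p0) (\<sigma> i) (rel_density i) powr (q / p i))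
      = (\<Prod>i=1..m. (4 * K * (p i / p0 / (p i / p0 - 1)) powr (p i / p0) *
         f_power i) powr (q / p i))"
    unfolding embed_bound_def by (intro prod.cong refl) (simp only: rel_density_props(4))
  finally show ?thesis .
qed

text \<open>Duality in \<open>L\<^bsup>q / \<gamma>\<^esup>(u)\<close>: the extremal dual function \<open>h = \<phi> powr (q / \<gamma> - 1)\<close> can be named, since the sum \<open>\<phi>\<close> is
  finite. The multilinear embedding then bounds \<open>X\<close>, the integral of \<open>\<phi> powr (q / \<gamma>)\<close> against \<open>u\<close>, by a
  multiple of \<open>X powr (1 - \<gamma> / q)\<close>, and a division by the finite number \<open>X powr (1 - \<gamma> / q)\<close> gives the claim.\<close>

theorem sparse_bound_large_q:
  fixes T :: "nat \<Rightarrow> real"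
  assumes q\<gamma>: "\<gamma> < q" and p\<gamma>: "\<And>i. i \<in> {1..m} \<Longrightarrow> \<gamma> < p i"
    and uln: "\<And>Q. Q \<in> S \<Longrightarrow> set_integrable M Q (\<lambda>x. ln (u x))"
    and T0: "\<And>k. k \<in> insert 0 {1..m} \<Longrightarrow> 0 \<le> T k"
    and T\<sigma>: "\<And>Q. Q \<in> S \<Longrightarrow> (\<Prod>i=1..m. Ainf_quotient (\<sigma> i) Q powr (\<gamma> / p i)) \<le> T 0"
    and Tu: "\<And>i Q. i \<in> {1..m} \<Longrightarrow> Q \<in> S \<Longrightarrow>
      Ainf_quotient u Q powr (1 - \<gamma> / q) * (\<Prod>j\<in>{1..m} - {i}. Ainf_quotient (\<sigma> j) Q powr (\<gamma> / p j)) \<le> T i"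
  shows "(\<integral>x. sparse_sum \<eta> p0 \<gamma> m f x powr (q / \<gamma>) * u x \<partial>M) powr (\<gamma> / q)
    \<le> large_q_const K p0 q \<gamma> m p * A powr (\<gamma> / q) * (\<Sum>k\<in>insert 0 {1..m}. T k) *
       (\<Prod>i=1..m. f_power i powr (\<gamma> / p i))"
proof -
  define J where "J = insert 0 {1..m}"
  define \<phi> where "\<phi> = sparse_sum \<eta> p0 \<gamma> m f"
  define h where "h x = \<phi> x powr (q / \<gamma> - 1)" for x
  define X where "X = (\<integral>x. \<phi> x powr (q / \<gamma>) * u x \<partial>M)"
  define v where "v j = (if j = 0 then u else \<sigma> j)" for j
  define H where "H j = (if j = 0 then h else rel_density j)" for j
  define r where "r j = dual_power p0 q \<gamma> p j" for j
  define \<theta> where "\<theta> j = dual_exponent q \<gamma> p j" for j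
  define e where "e j = level_exponent p0 q p j" for j
  have s: "1 < q / \<gamma>" using q\<gamma> \<gamma> by simp
  have v_simps: "v 0 = u" "H 0 = h" "\<And>i. i \<in> {1..m} \<Longrightarrow> v i = \<sigma> i" "\<And>i. i \<in> {1..m} \<Longrightarrow> H i = rel_density i"
    by (auto simp: v_def H_def)
  have e_simps: "r 0 = q / (q - \<gamma>)" "\<theta> 0 = 1 - \<gamma> / q" "e 0 = 1"
    "\<And>i. i \<in> {1..m} \<Longrightarrow> r i = p i / p0" "\<And>i. i \<in> {1..m} \<Longrightarrow> \<theta> i = \<gamma> / p i"
    "\<And>i. i \<in> {1..m} \<Longrightarrow> e i = q * (1 / p0 - 1 / p i)"
    by (auto simp: r_def \<theta>_def e_def dual_power_def dual_exponent_def level_exponent_def)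
  have prod_J: "(\<Prod>j\<in>J. G j) = G 0 * (\<Prod>i=1..m. G i)" for G :: "nat \<Rightarrow> real"
    by (simp add: J_def)
  have \<phi>0: "0 \<le> \<phi> x" for x unfolding \<phi>_def by (rule sparse_sum_nonneg)
  have [measurable]: "\<phi> \<in> borel_measurable M" "h \<in> borel_measurable M"
    unfolding h_def[abs_def] \<phi>_def by measurable
  have hr: "h x powr (q / (q - \<gamma>)) = \<phi> x powr (q / \<gamma>)" for x
  proof -
    have "q / \<gamma> - 1 = (q - \<gamma>) / \<gamma>" using \<gamma> by (simp add: diff_divide_distrib)
    then have "(q / \<gamma> - 1) * (q / (q - \<gamma>)) = q / \<gamma>" using q\<gamma> by simp
    then show ?thesis by (simp only: h_def powr_powr)
  qed
  have int\<phi>: "integrable M (\<lambda>x. \<phi> x powr a * u x)" if "0 < a" for a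
    unfolding \<phi>_def using that u by (rule integrable_sparse_sum_powr)
  have inth: "integrable M (\<lambda>x. h x powr (q / (q - \<gamma>)) * u x)"
    unfolding hr using s by (intro int\<phi>) simp
  have hQ: "integrable M (\<lambda>x. indicator Q x *\<^sub>R (h x * u x))" if "Q \<in> S" for Q
    unfolding h_def using that s by (intro integrable_mult_indicator int\<phi>) auto
  have uQ: "(LINT x:Q|M. u x) = measure M Q * mean M Q u" if "Q \<in> S" for Q
    using measure_pos[OF that] by (simp add: mean_def)
  have X_sum: "X = (\<Sum>Q\<in>S. sparse_coeff \<eta> p0 m f Q powr \<gamma> * ((LINT x:Q|M. u x) * wmean u h Q))"
  proof -
    have "\<phi> x powr (q / \<gamma>) * u x = (\<Sum>Q\<in>S. sparse_coeff \<eta> p0 m f Q powr \<gamma> * (indicator Q x *\<^sub>R (h x * u x)))" for x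
    proof -
      have 1: "\<phi> x powr (q / \<gamma>) = \<phi> x * h x"
        using \<phi>0[of x] by (cases "\<phi> x = 0") (auto simp: h_def powr_diff)
      have 2: "\<phi> x = (\<Sum>Q\<in>S. sparse_coeff \<eta> p0 m f Q powr \<gamma> * indicator Q x)"
        by (simp add: \<phi>_def sparse_sum_def)
      have "\<phi> x powr (q / \<gamma>) * u x
          = (\<Sum>Q\<in>S. sparse_coeff \<eta> p0 m f Q powr \<gamma> * indicator Q x) * h x * u x"
        by (simp only: 1 2[symmetric])
      then show ?thesis by (simp only: sum_distrib_right mult.assoc real_scaleR_def)
    qed
    then have "X = (\<integral>x. (\<Sum>Q\<in>S. sparse_coeff \<eta> p0 m f Q powr \<gamma> * (indicator Q x *\<^sub>R (h x * u x))) \<partial>M)"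
      by (simp only: X_def)
    also have "\<dots> = (\<Sum>Q\<in>S. \<integral>x. sparse_coeff \<eta> p0 m f Q powr \<gamma> * (indicator Q x *\<^sub>R (h x * u x)) \<partial>M)"
      by (intro Bochner_Integration.integral_sum integrable_mult_right hQ)
    also have "\<dots> = (\<Sum>Q\<in>S. sparse_coeff \<eta> p0 m f Q powr \<gamma> * (LINT x:Q|M. h x * u x))"
      by (simp only: set_lebesgue_integral_def integral_mult_right_zero)
    also have "\<dots> = (\<Sum>Q\<in>S. sparse_coeff \<eta> p0 m f Q powr \<gamma> * ((LINT x:Q|M. u x) * wmean u h Q))"
      using u_mean_pos measure_pos by (intro sum.cong refl) (force simp: wmean_def uQ)
    finally show ?thesis .
  qed
  have term_eq: "sparse_coeff \<eta> p0 m f Q powr \<gamma> * ((LINT x:Q|M. u x) * wmean u h Q)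
      = (\<Prod>j\<in>J. mean M Q (v j) powr e j) powr (\<gamma> / q) *
        (\<Prod>j\<in>J. ((LINT x:Q|M. v j x) * wmean (v j) (H j) Q powr r j) powr \<theta> j)" if Q: "Q \<in> S" for Q
  proof -
    define P1 where "P1 = \<sigma>_level Q"
    define P2 where "P2 = (\<Prod>i=1..m. ((LINT x:Q|M. \<sigma> i x) * wmean (\<sigma> i) (rel_density i) Q powr (p i / p0)) powr (\<gamma> / p i))"
    have 1: "(\<Prod>j\<in>J. mean M Q (v j) powr e j) = mean M Q u * P1"
      unfolding prod_J P1_def using u_mean_pos[OF Q] by (simp add: v_simps e_simps cong: prod.cong_simp)
    have 2: "(\<Prod>j\<in>J. ((LINT x:Q|M. v j x) * wmean (v j) (H j) Q powr r j) powr \<theta> j)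
        = ((LINT x:Q|M. u x) * wmean u h Q powr (q / (q - \<gamma>))) powr (1 - \<gamma> / q) * P2"
      unfolding prod_J P2_def by (simp add: v_simps e_simps cong: prod.cong_simp)
    have w0: "0 \<le> wmean u h Q"
      unfolding wmean_def set_lebesgue_integral_def
      by (intro divide_nonneg_nonneg integral_nonneg) (auto simp: h_def u(2) less_imp_le)
    have w: "(wmean u h Q powr (q / (q - \<gamma>))) powr (1 - \<gamma> / q) = wmean u h Q"
    proof -
      have "q / (q - \<gamma>) * (1 - \<gamma> / q) = 1" using q q\<gamma> by (simp add: field_simps)
      then show ?thesis using w0 by (simp only: powr_powr powr_one)
    qed
    have "(mean M Q u * P1) powr (\<gamma> / q) *
        (((LINT x:Q|M. u x) * wmean u h Q powr (q / (q - \<gamma>))) powr (1 - \<gamma> / q) * P2)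
      = (mean M Q u powr (\<gamma> / q) * mean M Q u powr (1 - \<gamma> / q)) * measure M Q powr (1 - \<gamma> / q) * (P1 powr (\<gamma> / q) * P2 * wmean u h Q)"
      unfolding uQ[OF Q] powr_mult w by (simp only: mult_ac)
    also have "mean M Q u powr (\<gamma> / q) * mean M Q u powr (1 - \<gamma> / q) = mean M Q u"
      using u_mean_pos[OF Q] by (simp flip: powr_add)
    also have "measure M Q powr (1 - \<gamma> / q) = measure M Q * measure M Q powr - (\<gamma> / q)"
      using measure_pos[OF Q] by (simp add: powr_diff powr_minus_divide)
    finally show ?thesis
      unfolding 1 2 sparse_coeff_factorization[OF Q] P1_def[symmetric] P2_def[symmetric] uQ[OF Q]
      by (simp only: mult_ac)
  qed
  have J_cases: "j = 0 \<or> j \<in> {1..m}" if "j \<in> J" for j using that by (auto simp: J_def)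
  have \<theta>: "0 < \<theta> j \<and> \<theta> j \<le> 1" if "j \<in> J" for j
    using J_cases[OF that] q q\<gamma> \<gamma> p\<gamma>[of j] by (auto simp: e_simps field_simps)
  have r: "1 < r j" if "j \<in> J" for j
    using J_cases[OF that] q q\<gamma> \<gamma> p0 p[of j] by (auto simp: e_simps field_simps)
  have e: "0 < e j" if "j \<in> J" for j
    using J_cases[OF that] q p0 p[of j] by (auto simp: e_simps field_simps)
  have \<theta>sum: "1 \<le> (\<Sum>j\<in>J. \<theta> j)"
  proof -
    have "(\<Sum>j\<in>J. \<theta> j) = 1 - \<gamma> / q + (\<Sum>i=1..m. \<gamma> / p i)"
      by (simp add: J_def e_simps cong: sum.cong_simp)
    also have "\<dots> = 1 + \<gamma> * \<eta>" by (simp add: \<eta>(1) algebra_simps sum_distrib_left)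
    finally show ?thesis using \<gamma> \<eta>(2) by simp
  qed
  have v: "v j \<in> borel_measurable M" "0 < v j x"
    "Q \<in> S \<Longrightarrow> set_integrable M Q (v j)" "Q \<in> S \<Longrightarrow> set_integrable M Q (\<lambda>x. ln (v j x))"
    "H j \<in> borel_measurable M" "0 \<le> H j x" "integrable M (\<lambda>x. H j x powr r j * v j x)"
    if "j \<in> J" for j x Q
    using J_cases[OF that] u uln \<sigma> rel_density_props(1,2) integrable_rel_density inth
    by (auto simp: v_simps e_simps h_def[of x])
  have TJ: "(\<Prod>j\<in>J - {k}. Ainf_quotient (v j) Q powr \<theta> j) \<le> T k" if "k \<in> J" "Q \<in> S" for k Q
    using J_cases[OF that(1)]
  proof
    assume "k = 0"
    moreover have "J - {0} = {1..m}" by (auto simp: J_def)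
    ultimately show ?thesis
      using T\<sigma>[OF that(2)] by (simp add: v_simps e_simps cong: prod.cong_simp)
  next
    assume k: "k \<in> {1..m}"
    then have "J - {k} = insert 0 ({1..m} - {k})" by (auto simp: J_def)
    moreover have "(\<Prod>j\<in>{1..m} - {k}. Ainf_quotient (v j) Q powr \<theta> j)
        = (\<Prod>j\<in>{1..m} - {k}. Ainf_quotient (\<sigma> j) Q powr (\<gamma> / p j))"
      by (intro prod.cong refl) (simp add: v_simps e_simps)
    ultimately show ?thesis
      using Tu[OF k that(2)] by (simp add: v_simps e_simps)
  qed
  define F where "F = (\<Prod>i=1..m. f_power i powr (\<gamma> / p i))"
  define D where "D j = 4 * K * (r j / (r j - 1)) powr r j" for j
  have "X \<le> 2 powr (\<gamma> / q) * A powr (\<gamma> / q) / (1 - 2 powr - (\<gamma> / q)) *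
      (pack_const K J \<theta> e * (\<Sum>k\<in>J. T k) * (\<Prod>j\<in>J. embed_bound K (r j) (v j) (H j) powr \<theta> j))"
    unfolding X_sum
  proof (subst sum.cong[OF refl term_eq], assumption, rule multilinear_embedding)
    show "(\<Prod>j\<in>J. mean M Q (v j) powr e j) \<le> A" if "Q \<in> S" for Q
      unfolding prod_J using A(2)[OF that] u_mean_pos[OF that] by (simp add: v_simps e_simps cong: prod.cong_simp)
    show "finite J" by (simp add: J_def)
    show "0 \<le> T k" if "k \<in> J" for k using T0 that by (simp only: J_def)
  qed (use K \<theta> \<theta>sum r e v TJ A \<gamma> q in \<open>auto simp: J_def[symmetric]\<close>)
  also have "(\<Prod>j\<in>J. embed_bound K (r j) (v j) (H j) powr \<theta> j) = (\<Prod>j\<in>J. D j powr \<theta> j) * (F * X powr (1 - \<gamma> / q))"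
  proof -
    have "(\<Prod>j\<in>J. embed_bound K (r j) (v j) (H j) powr \<theta> j)
        = (\<Prod>j\<in>J. D j powr \<theta> j) * (\<Prod>j\<in>J. (\<integral>x. H j x powr r j * v j x \<partial>M) powr \<theta> j)"
      by (simp add: embed_bound_def D_def powr_mult prod.distrib)
    also have "(\<Prod>j\<in>J. (\<integral>x. H j x powr r j * v j x \<partial>M) powr \<theta> j) = F * X powr (1 - \<gamma> / q)"
      unfolding prod_J F_def X_def by (simp add: v_simps e_simps hr rel_density_props(4) cong: prod.cong_simp)
    finally show ?thesis .
  qed
  finally have main: "X \<le> large_q_const K p0 q \<gamma> m p * A powr (\<gamma> / q) * (\<Sum>k\<in>J. T k) * F * X powr (1 - \<gamma> / q)"
    unfolding large_q_const_def D_def r_def \<theta>_def[abs_def] e_def[abs_def] J_def by (simp add: mult_ac)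
  define B where "B = large_q_const K p0 q \<gamma> m p * A powr (\<gamma> / q) * (\<Sum>k\<in>J. T k) * F"
  have X0: "0 \<le> X" unfolding X_def using u(2) by (intro Bochner_Integration.integral_nonneg) (simp add: less_imp_le)
  have c0: "0 \<le> large_q_const K p0 q \<gamma> m p"
    using \<gamma> q powr_mono[of "- (\<gamma> / q)" 0 2] unfolding large_q_const_def
    by (intro mult_nonneg_nonneg prod_nonneg divide_nonneg_nonneg) (auto simp: pack_const_def)
  have B0: "0 \<le> B"
    unfolding B_def F_def using c0 T0 by (intro mult_nonneg_nonneg sum_nonneg prod_nonneg) (auto simp: J_def)
  have "X powr (\<gamma> / q) \<le> B"
  proof (cases "X = 0")
    case False
    then have "X powr (\<gamma> / q) * X powr (1 - \<gamma> / q) = X" using X0 by (simp flip: powr_add)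
    with main have "X powr (\<gamma> / q) * X powr (1 - \<gamma> / q) \<le> B * X powr (1 - \<gamma> / q)" by (simp add: B_def)
    then show ?thesis using False X0 by simp
  qed (use B0 in simp)
  then show ?thesis by (simp add: B_def X_def \<phi>_def J_def F_def)
qed

theorem sparse_bound:
  fixes H :: real and H' :: "nat \<Rightarrow> real"
  assumes dich: "q \<le> \<gamma> \<or> (\<gamma> < q \<and> (\<forall>i\<in>{1..m}. \<gamma> < p i) \<and> (\<forall>Q\<in>S. set_integrable M Q (\<lambda>x. ln (u x))))"
    and H0: "0 \<le> H" "\<And>i. i \<in> {1..m} \<Longrightarrow> 0 \<le> H' i"
    and H: "\<And>Q. Q \<in> S \<Longrightarrow> (\<Prod>i=1..m. Ainf_quotient (\<sigma> i) Q powr (q / p i)) \<le> H"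
    and H': "\<And>i Q. i \<in> {1..m} \<Longrightarrow> Q \<in> S \<Longrightarrow> \<gamma> < q \<Longrightarrow>
      Ainf_quotient u Q powr (conj_exp (p i) * (1 / \<gamma> - 1 / q)) *
      (\<Prod>j\<in>{1..m} - {i}. Ainf_quotient (\<sigma> j) Q powr (conj_exp (p i) / p j)) \<le> H' i"
  shows "(\<integral>x. sparse_sum \<eta> p0 \<gamma> m f x powr (q / \<gamma>) * u x \<partial>M) powr (1 / q)
    \<le> sparse_const K p0 q \<gamma> m p * A powr (1 / q) * (H powr (1 / q) + (\<Sum>i=1..m. H' i powr (1 / conj_exp (p i)))) *
       (\<Prod>i=1..m. f_power i powr (1 / p i))"
proof -
  define X where "X = (\<integral>x. sparse_sum \<eta> p0 \<gamma> m f x powr (q / \<gamma>) * u x \<partial>M)"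
  define Y where "Y i = f_power i" for i
  define F where "F = (\<Prod>i=1..m. Y i powr (1 / p i))"
  define B where "B i = 4 * K * (p i / p0 / (p i / p0 - 1)) powr (p i / p0)" for i
  define c1 where "c1 = (\<Prod>i=1..m. B i powr (1 / p i))"
  define c2 where "c2 = (real m + 1) powr (1 / \<gamma>) * large_q_const K p0 q \<gamma> m p powr (1 / \<gamma>)"
  define Hs where "Hs = (\<Sum>i=1..m. H' i powr (1 / conj_exp (p i)))"
  have c: "sparse_const K p0 q \<gamma> m p = 1 + c1 + c2" by (simp only: sparse_const_def c1_def c2_def B_def)
  have c0: "0 \<le> c1" "0 \<le> c2" "0 \<le> F" "0 \<le> Hs"
    by (auto simp: c1_def c2_def F_def Hs_def prod_nonneg sum_nonneg)
  have X0: "0 \<le> X"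
    unfolding X_def using u(2) by (intro Bochner_Integration.integral_nonneg) (simp add: less_imp_le)
  have "X powr (1 / q) \<le> sparse_const K p0 q \<gamma> m p * A powr (1 / q) * (H powr (1 / q) + Hs) * F"
  proof (cases "q \<le> \<gamma>")
    case True
    have "X powr (1 / q) \<le> (A * H * (\<Prod>i=1..m. (B i * Y i) powr (q / p i))) powr (1 / q)"
      using sparse_bound_small_q[OF True H0(1) H, folded X_def] X0 q unfolding Y_def B_def
      by (intro powr_mono2) auto
    also have "\<dots> = A powr (1 / q) * H powr (1 / q) * (c1 * F)"
      using q by (simp add: c1_def F_def powr_mult powr_powr prod_powr_distrib prod.distrib)
    also have "\<dots> = c1 * A powr (1 / q) * H powr (1 / q) * F" by (simp only: mult_ac)
    also have "\<dots> \<le> (1 + c1 + c2) * A powr (1 / q) * (H powr (1 / q) + Hs) * F"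
      using c0 by (intro mult_right_mono mult_mono) auto
    finally show ?thesis by (simp only: c)
  next
    case False
    then have qg: "\<gamma> < q" and pg: "\<And>i. i \<in> {1..m} \<Longrightarrow> \<gamma> < p i"
      and uln: "\<And>Q. Q \<in> S \<Longrightarrow> set_integrable M Q (\<lambda>x. ln (u x))"
      using dich by auto
    have conj: "0 < conj_exp (p i)" if "i \<in> {1..m}" for i
      using p[OF that] p0 by (simp add: conj_exp_def)
    define T where "T k = (if k = 0 then H powr (\<gamma> / q) else H' k powr (\<gamma> / conj_exp (p k)))" for k
    have T0: "0 \<le> T k" for k by (simp add: T_def)
    define L where "L = large_q_const K p0 q \<gamma> m p"
    have "X powr (\<gamma> / q) \<le> L * A powr (\<gamma> / q) * (\<Sum>k\<in>insert 0 {1..m}. T k) * (\<Prod>i=1..m. Y i powr (\<gamma> / p i))"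
      unfolding X_def Y_def L_def
    proof (rule sparse_bound_large_q[OF qg pg uln T0])
      fix Q assume Q: "Q \<in> S"
      have "(\<Prod>i=1..m. Ainf_quotient (\<sigma> i) Q powr (\<gamma> / p i)) = (\<Prod>i=1..m. Ainf_quotient (\<sigma> i) Q powr (q / p i)) powr (\<gamma> / q)"
        using q by (simp add: prod_powr_distrib powr_powr)
      also have "\<dots> \<le> H powr (\<gamma> / q)"
        using H[OF Q] \<gamma> q by (intro powr_mono2) (auto intro: prod_nonneg)
      finally show "(\<Prod>i=1..m. Ainf_quotient (\<sigma> i) Q powr (\<gamma> / p i)) \<le> T 0" by (simp add: T_def)
    next
      fix i Q assume i: "i \<in> {1..m}" and Q: "Q \<in> S"
      let ?c = "conj_exp (p i)"
      have e1: "?c * (1 / \<gamma> - 1 / q) * (\<gamma> / ?c) = 1 - \<gamma> / q"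
        using conj[OF i] \<gamma> by (simp add: field_simps)
      have e2: "?c / p j * (\<gamma> / ?c) = \<gamma> / p j" for j
        using conj[OF i] by simp
      have "Ainf_quotient u Q powr (1 - \<gamma> / q) * (\<Prod>j\<in>{1..m} - {i}. Ainf_quotient (\<sigma> j) Q powr (\<gamma> / p j))
        = (Ainf_quotient u Q powr (?c * (1 / \<gamma> - 1 / q)) * (\<Prod>j\<in>{1..m} - {i}. Ainf_quotient (\<sigma> j) Q powr (?c / p j))) powr (\<gamma> / ?c)"
        by (simp only: powr_mult prod_powr_distrib powr_powr e1 e2)
      also have "\<dots> \<le> H' i powr (\<gamma> / ?c)"
        using H'[OF i Q qg] \<gamma> conj[OF i] by (intro powr_mono2) (auto intro!: mult_nonneg_nonneg prod_nonneg)
      also have "\<dots> = T i" using i by (simp add: T_def)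
      finally show "Ainf_quotient u Q powr (1 - \<gamma> / q) * (\<Prod>j\<in>{1..m} - {i}. Ainf_quotient (\<sigma> j) Q powr (\<gamma> / p j)) \<le> T i" .
    qed
    then have "(X powr (\<gamma> / q)) powr (1 / \<gamma>)
        \<le> (L * A powr (\<gamma> / q) * (\<Sum>k\<in>insert 0 {1..m}. T k) * (\<Prod>i=1..m. Y i powr (\<gamma> / p i))) powr (1 / \<gamma>)"
      using \<gamma> by (intro powr_mono2) auto
    also have "(X powr (\<gamma> / q)) powr (1 / \<gamma>) = X powr (1 / q)" using \<gamma> by (simp add: powr_powr)
    also have "(L * A powr (\<gamma> / q) * (\<Sum>k\<in>insert 0 {1..m}. T k) * (\<Prod>i=1..m. Y i powr (\<gamma> / p i))) powr (1 / \<gamma>)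
      = L powr (1 / \<gamma>) * A powr (1 / q) * (\<Sum>k\<in>insert 0 {1..m}. T k) powr (1 / \<gamma>) * F"
      using \<gamma> by (simp add: powr_mult powr_powr prod_powr_distrib F_def)
    also have "\<dots> \<le> L powr (1 / \<gamma>) * A powr (1 / q) * ((real m + 1) powr (1 / \<gamma>) * (H powr (1 / q) + Hs)) * F"
    proof (intro mult_left_mono mult_right_mono c0 mult_nonneg_nonneg)
      define W where "W = H powr (1 / q) + Hs"
      have W0: "0 \<le> W" using c0 by (simp add: W_def)
      have "T k \<le> W powr \<gamma>" if "k \<in> insert 0 {1..m}" for k
      proof -
        have "T k powr (1 / \<gamma>) \<le> W"
        proof (cases "k = 0")
          case True
          then show ?thesis using c0 \<gamma> by (simp add: T_def W_def powr_powr)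
        next
          case False
          then have k: "k \<in> {1..m}" using that by auto
          then have "H' k powr (1 / conj_exp (p k)) \<le> Hs"
            unfolding Hs_def by (intro member_le_sum) auto
          then have "H' k powr (1 / conj_exp (p k)) \<le> W"
            unfolding W_def by (rule add_increasing[rotated]) simp
          then show ?thesis using False \<gamma> by (simp add: T_def powr_powr)
        qed
        then have "(T k powr (1 / \<gamma>)) powr \<gamma> \<le> W powr \<gamma>" using \<gamma> by (intro powr_mono2) auto
        then show ?thesis using \<gamma> T0[of k] by (simp add: powr_powr)
      qed
      then have "(\<Sum>k\<in>insert 0 {1..m}. T k) \<le> (real m + 1) * W powr \<gamma>"
        using sum_bounded_above[of "insert 0 {1..m}" T "W powr \<gamma>"] by (simp add: add.commute)
      then have "(\<Sum>k\<in>insert 0 {1..m}. T k) powr (1 / \<gamma>) \<le> ((real m + 1) * W powr \<gamma>) powr (1 / \<gamma>)"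
        using \<gamma> T0 by (intro powr_mono2 sum_nonneg) auto
      also have "\<dots> = (real m + 1) powr (1 / \<gamma>) * W" using \<gamma> W0 by (simp add: powr_mult powr_powr)
      finally show "(\<Sum>k\<in>insert 0 {1..m}. T k) powr (1 / \<gamma>) \<le> (real m + 1) powr (1 / \<gamma>) * (H powr (1 / q) + Hs)"
        by (simp only: W_def)
    qed auto
    also have "\<dots> = c2 * A powr (1 / q) * (H powr (1 / q) + Hs) * F"
      by (simp only: c2_def L_def mult_ac)
    also have "\<dots> \<le> (1 + c1 + c2) * A powr (1 / q) * (H powr (1 / q) + Hs) * F"
      using c0 by (intro mult_right_mono) auto
    finally show ?thesis by (simp only: c)
  qed
  then show ?thesis by (simp only: X_def Hs_def F_def Y_def)
qed

end

end

section \<open>Powers and countable sums in the extended half-line\<close>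

lemma ennreal_epowr: "0 \<le> x \<Longrightarrow> 0 < a \<or> 0 < x \<Longrightarrow> ennreal x epowr a = ennreal (x powr a)"
  by (auto simp: epowr_def)

lemma epowr_one [simp]: "x epowr 1 = x"
  by (cases x rule: ennreal_cases) (auto simp: epowr_def)

lemma epowr_epowr: "0 < a \<Longrightarrow> 0 < b \<Longrightarrow> (x epowr a) epowr b = x epowr (a * b)"
  by (cases x rule: ennreal_cases) (auto simp: epowr_def powr_powr)

lemma epowr_eq_top_iff: "0 < a \<Longrightarrow> x epowr a = \<infinity> \<longleftrightarrow> x = \<infinity>"
  by (auto simp: epowr_def)

lemma epowr_eq_0_iff: "0 < a \<Longrightarrow> x epowr a = 0 \<longleftrightarrow> x = 0"
  by (cases x rule: ennreal_cases) (auto simp: epowr_def)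

lemma epowr_mono:
  assumes "0 < a" "x \<le> y"
  shows "x epowr a \<le> y epowr a"
proof (cases y rule: ennreal_cases)
  case (real s)
  then obtain r where r: "x = ennreal r" "0 \<le> r" "r \<le> s"
    using assms(2) by (cases x rule: ennreal_cases) (auto simp: top_unique)
  then show ?thesis
    using real assms(1) by (auto simp: ennreal_epowr intro!: ennreal_leI powr_mono2)
qed (use assms in \<open>auto simp: epowr_def\<close>)

text \<open>Positive powers are order isomorphisms of the extended half-line, so they commute with suprema.\<close>

lemma SUP_epowr_le:
  assumes "0 < a"
  shows "(SUP i\<in>I. f i) epowr a \<le> (SUP i\<in>I. f i epowr a)"
proof -
  define c where "c = (SUP i\<in>I. f i epowr a)"
  have "f i \<le> c epowr (1 / a)" if "i \<in> I" for i
  proof -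
    have "f i epowr a \<le> c" using that unfolding c_def by (rule SUP_upper)
    then have "(f i epowr a) epowr (1 / a) \<le> c epowr (1 / a)"
      using assms by (intro epowr_mono) auto
    then show ?thesis using assms by (simp add: epowr_epowr)
  qed
  then have "(SUP i\<in>I. f i) epowr a \<le> (c epowr (1 / a)) epowr a"
    using assms by (intro epowr_mono SUP_least)
  then show ?thesis using assms by (simp add: epowr_epowr c_def)
qed

lemma countable_infsum_eq_SUP:
  fixes S :: "'b set"
  assumes "countable S"
  obtains F :: "nat \<Rightarrow> 'b set" where "\<And>n. finite (F n)" "\<And>n. F n \<subseteq> S" "incseq F"
    "\<And>t :: 'b \<Rightarrow> ennreal. (\<Sum>\<^sub>\<infinity>Q\<in>S. t Q) = (SUP n. \<Sum>Q\<in>F n. t Q)"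
proof -
  obtain c :: "'b \<Rightarrow> nat" where c: "inj_on c S" using assms by (auto simp: countable_def)
  define F where "F n = {Q \<in> S. c Q < n}" for n
  have fin: "finite (F n)" for n
    using c by (intro finite_imageD[of c]) (auto simp: F_def inj_on_def intro: finite_subset[of _ "{..<n}"])
  have sub: "F n \<subseteq> S" for n by (auto simp: F_def)
  have inc: "incseq F" by (auto simp: F_def incseq_def)
  have "(\<Sum>\<^sub>\<infinity>Q\<in>S. t Q) = (SUP n. \<Sum>Q\<in>F n. t Q)" for t :: "'b \<Rightarrow> ennreal"
  proof -
    have "(\<Sum>\<^sub>\<infinity>Q\<in>S. t Q) = (SUP G\<in>{G. finite G \<and> G \<subseteq> S}. sum t G)"
      by (rule nonneg_infsum_complete) auto
    also have "\<dots> = (SUP n. \<Sum>Q\<in>F n. t Q)"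
    proof (rule antisym)
      show "(SUP G\<in>{G. finite G \<and> G \<subseteq> S}. sum t G) \<le> (SUP n. \<Sum>Q\<in>F n. t Q)"
      proof (rule SUP_least)
        fix G assume G: "G \<in> {G. finite G \<and> G \<subseteq> S}"
        have "G \<subseteq> F (Suc (Max (c ` G)))"
          using G by (auto simp: F_def less_Suc_eq_le)
        then have "sum t G \<le> (\<Sum>Q\<in>F (Suc (Max (c ` G))). t Q)"
          by (intro sum_mono2 fin) auto
        also have "\<dots> \<le> (SUP n. \<Sum>Q\<in>F n. t Q)" by (rule SUP_upper) simp
        finally show "sum t G \<le> (SUP n. \<Sum>Q\<in>F n. t Q)" .
      qed
      show "(SUP n. \<Sum>Q\<in>F n. t Q) \<le> (SUP G\<in>{G. finite G \<and> G \<subseteq> S}. sum t G)"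
        using fin sub by (intro SUP_mono) blast
    qed
    finally show ?thesis .
  qed
  then show ?thesis using that fin sub inc by blast
qed

text \<open>Monotone convergence reduces a countable family of cubes to its finite subfamilies.\<close>

lemma nn_integral_infsum_epowr_le:
  fixes t :: "'a set \<Rightarrow> ennreal" and u :: "'a \<Rightarrow> real"
  assumes S: "countable S" and a: "0 < a" and u: "u \<in> borel_measurable M"
    and B: "\<And>F. finite F \<Longrightarrow> F \<subseteq> S \<Longrightarrow> (\<integral>\<^sup>+x. (\<Sum>Q\<in>F. t Q * indicator Q x) epowr a * ennreal (u x) \<partial>M) \<le> B"
    and meas: "\<And>F. finite F \<Longrightarrow> F \<subseteq> S \<Longrightarrow> (\<lambda>x. (\<Sum>Q\<in>F. t Q * indicator Q x) epowr a) \<in> borel_measurable M"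
  shows "(\<integral>\<^sup>+x. (\<Sum>\<^sub>\<infinity>Q\<in>S. t Q * indicator Q x) epowr a * ennreal (u x) \<partial>M) \<le> B"
proof -
  obtain F where F: "\<And>n. finite (F n)" "\<And>n. F n \<subseteq> S" "incseq F"
    "\<And>t :: 'a set \<Rightarrow> ennreal. (\<Sum>\<^sub>\<infinity>Q\<in>S. t Q) = (SUP n. \<Sum>Q\<in>F n. t Q)"
    using countable_infsum_eq_SUP[OF S] by blast
  define Y where "Y n x = (\<Sum>Q\<in>F n. t Q * indicator Q x) epowr a * ennreal (u x)" for n x
  have [measurable]: "Y n \<in> borel_measurable M" for n
    using meas[OF F(1,2)] u unfolding Y_def[abs_def] by measurable
  have inc: "incseq Y"
    unfolding incseq_def le_fun_def Y_def
    by (intro allI impI mult_right_mono epowr_mono a sum_mono2 F(1) incseqD[OF F(3)]) auto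
  have "(\<integral>\<^sup>+x. (\<Sum>\<^sub>\<infinity>Q\<in>S. t Q * indicator Q x) epowr a * ennreal (u x) \<partial>M) \<le> (\<integral>\<^sup>+x. (SUP n. Y n x) \<partial>M)"
  proof (rule nn_integral_mono)
    fix x
    have "(\<Sum>\<^sub>\<infinity>Q\<in>S. t Q * indicator Q x) epowr a \<le> (SUP n. (\<Sum>Q\<in>F n. t Q * indicator Q x) epowr a)"
      unfolding F(4) by (rule SUP_epowr_le[OF a])
    then have "(\<Sum>\<^sub>\<infinity>Q\<in>S. t Q * indicator Q x) epowr a * ennreal (u x) \<le> (SUP n. (\<Sum>Q\<in>F n. t Q * indicator Q x) epowr a) * ennreal (u x)"
      by (rule mult_right_mono) simp
    then show "(\<Sum>\<^sub>\<infinity>Q\<in>S. t Q * indicator Q x) epowr a * ennreal (u x) \<le> (SUP n. Y n x)"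
      by (simp add: Y_def SUP_mult_right_ennreal)
  qed
  also have "\<dots> = (SUP n. \<integral>\<^sup>+x. Y n x \<partial>M)"
    by (intro nn_integral_monotone_convergence_SUP inc) measurable
  also have "\<dots> \<le> B"
    unfolding Y_def by (intro SUP_least B F)
  finally show ?thesis .
qed

section \<open>Cubes and weights\<close>

text \<open>Weights are positive only almost everywhere; the value 1 elsewhere keeps all logarithms and negative powers meaningful.\<close>

definition pos_version :: "('a \<Rightarrow> real) \<Rightarrow> 'a \<Rightarrow> real" where
  "pos_version w x = (if 0 < w x then w x else 1)"

lemma pos_version_pos: "0 < pos_version w x"
  by (simp add: pos_version_def)

lemma pos_version_measurable [measurable]:
  assumes [measurable]: "w \<in> borel_measurable M"
  shows "pos_version w \<in> borel_measurable M"
  unfolding pos_version_def[abs_def] by measurable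

text \<open>The doubling condition at half the radius shows that balls have positive and finite measure.\<close>

lemma qball_facts:
  assumes "homogeneous_space d \<mu>" "0 < r"
  shows "qball d x r \<in> sets \<mu>" "0 < emeasure \<mu> (qball d x r)" "emeasure \<mu> (qball d x r) < \<infinity>"
proof -
  obtain C where C: "\<And>x r. 0 < r \<Longrightarrow> 0 < emeasure \<mu> (qball d x (2 * r)) \<and>
        emeasure \<mu> (qball d x (2 * r)) \<le> ennreal C * emeasure \<mu> (qball d x r) \<and>
        ennreal C * emeasure \<mu> (qball d x r) < \<infinity>" and
    sets: "sets \<mu> = sigma_sets UNIV ({U. qopen d U} \<union> {qball d x r | x r. 0 < r})"
    using assms(1) unfolding homogeneous_space_def by blast
  show "qball d x r \<in> sets \<mu>"
    unfolding sets using assms(2) by (intro sigma_sets.Basic) auto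
  show "0 < emeasure \<mu> (qball d x r)" "emeasure \<mu> (qball d x r) < \<infinity>"
    using C[of "r / 2" x] assms(2) by auto
qed

lemma dyadic_lattice_withD:
  assumes "dyadic_lattice_with d \<mu> D \<delta>0 a1 A1 M c"
  shows "0 < \<delta>0" "0 < a1" "a1 \<le> A1" "countable (cubes D)" "cubes D \<subseteq> sets \<mu>" "\<Union>(D k) = UNIV"
    and "k \<le> l \<Longrightarrow> Q \<in> D l \<Longrightarrow> R \<in> D k \<Longrightarrow> Q \<subseteq> R \<or> Q \<inter> R = {}"
    and "Q \<in> D k \<Longrightarrow> qball d (c k Q) (a1 * \<delta>0 powi k) \<subseteq> Q"
    and "Q \<in> D k \<Longrightarrow> Q \<subseteq> qball d (c k Q) (A1 * \<delta>0 powi k)"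
proof -
  note D = assms[unfolded dyadic_lattice_with_def]
  show "0 < \<delta>0" by (rule D[THEN conjunct1])
  show "0 < a1" by (rule D[THEN conjunct2, THEN conjunct2, THEN conjunct1])
  show "a1 \<le> A1" by (rule D[THEN conjunct2, THEN conjunct2, THEN conjunct2, THEN conjunct1])
  show "countable (cubes D)" by (rule D[THEN conjunct2, THEN conjunct2, THEN conjunct2, THEN conjunct2, THEN conjunct1])
  show "cubes D \<subseteq> sets \<mu>" by (rule D[THEN conjunct2, THEN conjunct2, THEN conjunct2, THEN conjunct2, THEN conjunct2, THEN conjunct1])
  show "\<Union>(D k) = UNIV" using D[THEN conjunct2, THEN conjunct2, THEN conjunct2, THEN conjunct2, THEN conjunct2, THEN conjunct2, THEN conjunct1] by simp
  show "Q \<subseteq> R \<or> Q \<inter> R = {}" if "k \<le> l" "Q \<in> D l" "R \<in> D k"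
    using D[THEN conjunct2, THEN conjunct2, THEN conjunct2, THEN conjunct2, THEN conjunct2, THEN conjunct2, THEN conjunct2, THEN conjunct1] that by simp
  show "qball d (c k Q) (a1 * \<delta>0 powi k) \<subseteq> Q" "Q \<subseteq> qball d (c k Q) (A1 * \<delta>0 powi k)" if "Q \<in> D k"
    using D[THEN conjunct2, THEN conjunct2, THEN conjunct2, THEN conjunct2, THEN conjunct2, THEN conjunct2, THEN conjunct2, THEN conjunct2, THEN conjunct2, THEN conjunct2, THEN conjunct1] that by simp_all
qed

lemma cube_facts:
  assumes "homogeneous_space d \<mu>" "dyadic_lattice d \<mu> D" "Q \<in> cubes D"
  shows "Q \<in> sets \<mu>" "0 < measure \<mu> Q" "emeasure \<mu> Q = ennreal (measure \<mu> Q)" "Q \<noteq> {}"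
    and "\<exists>x r. 0 < r \<and> Q \<subseteq> qball d x r"
proof -
  obtain \<delta>0 a1 A1 M c where D: "dyadic_lattice_with d \<mu> D \<delta>0 a1 A1 M c"
    using assms(2) by (auto simp: dyadic_lattice_def)
  obtain k where k: "Q \<in> D k" using assms(3) by (auto simp: cubes_def)
  show Q: "Q \<in> sets \<mu>" using dyadic_lattice_withD(5)[OF D] assms(3) by auto
  have pos: "0 < a1 * \<delta>0 powi k" "0 < A1 * \<delta>0 powi k"
    using dyadic_lattice_withD(1-3)[OF D] by auto
  have sub: "qball d (c k Q) (a1 * \<delta>0 powi k) \<subseteq> Q" "Q \<subseteq> qball d (c k Q) (A1 * \<delta>0 powi k)"
    by (rule dyadic_lattice_withD(8,9)[OF D k])+
  show "\<exists>x r. 0 < r \<and> Q \<subseteq> qball d x r" using pos sub by blast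
  have "0 < emeasure \<mu> (qball d (c k Q) (a1 * \<delta>0 powi k))"
    by (rule qball_facts[OF assms(1) pos(1)])
  also have "\<dots> \<le> emeasure \<mu> Q" using sub Q by (intro emeasure_mono)
  finally have 1: "0 < emeasure \<mu> Q" .
  have "emeasure \<mu> Q \<le> emeasure \<mu> (qball d (c k Q) (A1 * \<delta>0 powi k))"
    using sub qball_facts[OF assms(1) pos(2)] by (intro emeasure_mono) auto
  also have "\<dots> < \<infinity>" by (rule qball_facts[OF assms(1) pos(2)])
  finally have 2: "emeasure \<mu> Q < \<infinity>" .
  show e: "emeasure \<mu> Q = ennreal (measure \<mu> Q)"
    using 2 by (intro emeasure_eq_ennreal_measure) auto
  show "0 < measure \<mu> Q" using 1 unfolding e by simp
  show "Q \<noteq> {}" using 1 by auto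
qed

lemma cubes_nested:
  assumes "dyadic_lattice d \<mu> D" "Q \<in> cubes D" "R \<in> cubes D"
  shows "Q \<subseteq> R \<or> R \<subseteq> Q \<or> Q \<inter> R = {}"
proof -
  obtain \<delta>0 a1 A1 M c where D: "dyadic_lattice_with d \<mu> D \<delta>0 a1 A1 M c"
    using assms(1) by (auto simp: dyadic_lattice_def)
  note * = dyadic_lattice_withD(7)[OF D]
  obtain k l where "Q \<in> D k" "R \<in> D l" using assms by (auto simp: cubes_def)
  then show ?thesis using *[of k l R Q] *[of l k Q R] by (cases "k \<le> l") auto
qed

lemma cubes_countable: "dyadic_lattice d \<mu> D \<Longrightarrow> countable (cubes D)"
  unfolding dyadic_lattice_def by (elim exE) (rule dyadic_lattice_withD(4))

lemma cubes_nonempty: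
  assumes "dyadic_lattice d \<mu> D"
  shows "cubes D \<noteq> {}"
proof -
  have "\<Union>(D 0) = UNIV"
    using assms unfolding dyadic_lattice_def by (elim exE) (rule dyadic_lattice_withD(6))
  then have "D 0 \<noteq> {}" by auto
  then show ?thesis unfolding cubes_def by blast
qed

lemma measured_laminar_cubes:
  assumes "homogeneous_space d \<mu>" "dyadic_lattice d \<mu> D" "finite F" "F \<subseteq> cubes D"
  shows "measured_laminar_family F \<mu>"
proof
  note F = subsetD[OF assms(4)]
  show "{} \<notin> F" using cube_facts(4)[OF assms(1,2) F] by blast
  show "F \<subseteq> sets \<mu>" using cube_facts(1)[OF assms(1,2) F] by blast
  show "0 < measure \<mu> Q" if "Q \<in> F" for Q by (rule cube_facts(2)[OF assms(1,2) F[OF that]])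
  show "Q \<subseteq> R \<or> R \<subseteq> Q \<or> Q \<inter> R = {}" if "Q \<in> F" "R \<in> F" for Q R
    by (rule cubes_nested[OF assms(2) F[OF that(1)] F[OF that(2)]])
qed (rule assms(3))

text \<open>The disjoint sets \<open>E Q\<close> for the cubes \<open>Q \<subseteq> R\<close> all lie in \<open>R\<close>, and each fills at least the fraction \<open>\<delta>\<close> of its cube.\<close>

lemma sparse_imp_Carleson:
  assumes hd: "homogeneous_space d \<mu>" "dyadic_lattice d \<mu> D" and F: "finite F" "F \<subseteq> S" "S \<subseteq> cubes D"
    and sp: "sparse_family \<mu> \<delta> S" and \<delta>: "0 < \<delta>"
  shows "measured_laminar_family.Carleson F \<mu> (1 / \<delta>)"
proof -
  interpret F: measured_laminar_family F \<mu>
    by (rule measured_laminar_cubes[OF hd F(1)]) (use F in auto)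
  obtain E where E: "\<And>Q. Q \<in> S \<Longrightarrow> E Q \<in> sets \<mu>" "\<And>Q. Q \<in> S \<Longrightarrow> E Q \<subseteq> Q"
      "\<And>Q. Q \<in> S \<Longrightarrow> ennreal \<delta> * emeasure \<mu> Q \<le> emeasure \<mu> (E Q)" "disjoint_family_on E S"
    using sp unfolding sparse_family_def by blast
  have cf: "Q \<in> sets \<mu>" "emeasure \<mu> Q = ennreal (measure \<mu> Q)" if "Q \<in> S" for Q
    using cube_facts(1,3)[OF hd subsetD[OF F(3) that]] by auto
  have Efin: "emeasure \<mu> (E Q) = ennreal (measure \<mu> (E Q))" if "Q \<in> S" for Q
  proof -
    have "emeasure \<mu> (E Q) \<le> emeasure \<mu> Q" using E(2)[OF that] cf(1)[OF that] by (rule emeasure_mono)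
    then have "emeasure \<mu> (E Q) < \<infinity>" unfolding cf(2)[OF that] by (simp add: le_less_trans)
    then show ?thesis by (intro emeasure_eq_ennreal_measure) auto
  qed
  have "(\<Sum>Q | Q \<in> F \<and> Q \<subseteq> R. measure \<mu> Q) \<le> 1 / \<delta> * measure \<mu> R" if R: "R \<in> F" for R
  proof -
    define T where "T = {Q. Q \<in> F \<and> Q \<subseteq> R}"
    have T: "finite T" "T \<subseteq> S" using F by (auto simp: T_def)
    have "(\<Sum>Q\<in>T. measure \<mu> Q) \<le> (\<Sum>Q\<in>T. 1 / \<delta> * measure \<mu> (E Q))"
    proof (rule sum_mono)
      fix Q assume "Q \<in> T"
      then have Q: "Q \<in> S" using T by auto
      have "ennreal (\<delta> * measure \<mu> Q) \<le> ennreal (measure \<mu> (E Q))"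
        using E(3)[OF Q] \<delta> unfolding cf(2)[OF Q] Efin[OF Q] by (simp add: ennreal_mult)
      then show "measure \<mu> Q \<le> 1 / \<delta> * measure \<mu> (E Q)" using \<delta> by (simp add: field_simps)
    qed
    also have "\<dots> = 1 / \<delta> * (\<Sum>Q\<in>T. measure \<mu> (E Q))" by (simp add: sum_distrib_left)
    also have "(\<Sum>Q\<in>T. measure \<mu> (E Q)) = measure \<mu> (\<Union>Q\<in>T. E Q)"
      using T E(1) Efin disjoint_family_on_mono[OF T(2) E(4)]
      by (intro measure_finite_Union[symmetric]) auto
    also have "\<dots> \<le> measure \<mu> R"
    proof (rule measure_mono_fmeasurable)
      show "(\<Union>Q\<in>T. E Q) \<subseteq> R" using E(2) T(2) by (auto simp: T_def)
      show "(\<Union>Q\<in>T. E Q) \<in> sets \<mu>" using T E(1) by blast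
      show "R \<in> fmeasurable \<mu>" using R F cf[of R] by (auto simp: fmeasurable_def)
    qed
    finally show ?thesis using \<delta> by (simp add: T_def divide_right_mono)
  qed
  then show ?thesis by (simp add: F.Carleson_def)
qed

lemma weight_AE: "weight d \<mu> w \<Longrightarrow> AE x in \<mu>. pos_version w x = w x"
  unfolding weight_def by (auto elim!: eventually_mono simp: pos_version_def)

lemma weight_measurable: "weight d \<mu> w \<Longrightarrow> w \<in> borel_measurable \<mu>"
  by (simp add: weight_def)

lemma set_integrable_cong_AE_eq:
  fixes f g :: "'a \<Rightarrow> real"
  assumes "f \<in> borel_measurable M" "g \<in> borel_measurable M" "AE x in M. f x = g x" "Q \<in> sets M"
  shows "set_integrable M Q f \<longleftrightarrow> set_integrable M Q g" "(LINT x:Q|M. f x) = (LINT x:Q|M. g x)"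
proof -
  have *: "AE x in M. indicator Q x *\<^sub>R f x = indicator Q x *\<^sub>R g x"
    using assms(3) by eventually_elim simp
  show "set_integrable M Q f \<longleftrightarrow> set_integrable M Q g"
    unfolding set_integrable_def using assms * by (intro integrable_cong_AE) auto
  show "(LINT x:Q|M. f x) = (LINT x:Q|M. g x)"
    unfolding set_lebesgue_integral_def using assms * by (intro integral_cong_AE) auto
qed

lemma avg_eq_mean:
  fixes g :: "'a \<Rightarrow> real"
  assumes "Q \<in> sets M" "0 < measure M Q" "emeasure M Q = ennreal (measure M Q)"
    and "set_integrable M Q g" "\<And>x. 0 \<le> g x"
  shows "avg M Q (\<lambda>x. ennreal (g x)) = ennreal (mean M Q g)"
proof -
  have "(\<integral>\<^sup>+x\<in>Q. ennreal (g x) \<partial>M) = (\<integral>\<^sup>+x. ennreal (indicator Q x *\<^sub>R g x) \<partial>M)"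
    by (intro nn_integral_cong) (auto simp: indicator_def)
  also have "\<dots> = ennreal (LINT x:Q|M. g x)"
    unfolding set_lebesgue_integral_def using assms(4,5)
    by (intro nn_integral_eq_integral) (auto simp: set_integrable_def)
  finally show ?thesis
    using assms by (simp add: avg_def mean_def divide_ennreal set_lebesgue_integral_def integral_nonneg_AE)
qed

lemma avg_cong_AE:
  assumes "AE x in M. f x = g x"
  shows "avg M Q f = avg M Q g"
  unfolding avg_def using assms
  by (intro arg_cong2[where f = "(/)"] refl nn_integral_cong_AE) (auto elim!: eventually_mono)

lemma weight_on_cube:
  assumes hd: "homogeneous_space d \<mu>" "dyadic_lattice d \<mu> D" and Q: "Q \<in> cubes D" and w: "weight d \<mu> w"
  defines "v \<equiv> pos_version w"
  shows "set_integrable \<mu> Q v"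
    and "avg \<mu> Q (\<lambda>x. ennreal (w x)) = ennreal (mean \<mu> Q v)" and "0 < mean \<mu> Q v"
    and "exp_avg_log_inv \<mu> Q w \<noteq> \<infinity> \<Longrightarrow> set_integrable \<mu> Q (\<lambda>x. ln (v x))"
    and "exp_avg_log_inv \<mu> Q w \<noteq> \<infinity> \<Longrightarrow> exp_avg_log_inv \<mu> Q w = ennreal (1 / exp (mean \<mu> Q (\<lambda>x. ln (v x))))"
    and "exp_avg_log_inv \<mu> Q w \<noteq> 0"
proof -
  note cf = cube_facts[OF hd Q]
  note [measurable] = weight_measurable[OF w] cf(1)
  have [measurable]: "v \<in> borel_measurable \<mu>" unfolding v_def by measurable
  have AE: "AE x in \<mu>. v x = w x" unfolding v_def by (rule weight_AE[OF w])
  obtain x r where B: "0 < r" "Q \<subseteq> qball d x r" using cf(5) by blast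
  have "set_integrable \<mu> (qball d x r) w" using w B(1) by (simp add: weight_def)
  then have "set_integrable \<mu> Q w" by (rule set_integrable_subset) (use B cf in auto)
  then show 1: "set_integrable \<mu> Q v"
    using set_integrable_cong_AE_eq(1)[OF _ _ AE cf(1)] by simp
  have vpos: "0 < v x" for x by (simp add: v_def pos_version_pos)
  have "avg \<mu> Q (\<lambda>x. ennreal (w x)) = avg \<mu> Q (\<lambda>x. ennreal (v x))"
    using AE by (intro avg_cong_AE) (auto elim!: eventually_mono)
  also have "\<dots> = ennreal (mean \<mu> Q v)"
    using cf 1 vpos by (intro avg_eq_mean) (auto simp: less_imp_le)
  finally show "avg \<mu> Q (\<lambda>x. ennreal (w x)) = ennreal (mean \<mu> Q v)" .
  show "0 < mean \<mu> Q v"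
    unfolding mean_def using cf 1 vpos by (intro divide_pos_pos set_integral_pos) auto
  have AE': "AE x in \<mu>. - ln (v x) = ln (inverse (w x))"
    using AE by eventually_elim (metis vpos ln_inverse)
  have iff: "set_integrable \<mu> Q (\<lambda>x. - ln (v x)) \<longleftrightarrow> set_integrable \<mu> Q (\<lambda>x. ln (inverse (w x)))"
    and eq: "(LINT x:Q|\<mu>. - ln (v x)) = (LINT x:Q|\<mu>. ln (inverse (w x)))"
    using set_integrable_cong_AE_eq[OF _ _ AE' cf(1)] by auto
  have neg: "set_integrable \<mu> Q (\<lambda>x. - ln (v x)) \<longleftrightarrow> set_integrable \<mu> Q (\<lambda>x. ln (v x))"
    "(LINT x:Q|\<mu>. - ln (v x)) = - (LINT x:Q|\<mu>. ln (v x))"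
    unfolding set_integrable_def set_lebesgue_integral_def by simp_all
  show "set_integrable \<mu> Q (\<lambda>x. ln (v x))" if "exp_avg_log_inv \<mu> Q w \<noteq> \<infinity>"
    using that iff neg(1) unfolding exp_avg_log_inv_def by (auto split: if_splits)
  show "exp_avg_log_inv \<mu> Q w = ennreal (1 / exp (mean \<mu> Q (\<lambda>x. ln (v x))))" if "exp_avg_log_inv \<mu> Q w \<noteq> \<infinity>"
    using that unfolding exp_avg_log_inv_def eq[symmetric] neg(2) mean_def
    by (auto split: if_splits simp: exp_minus inverse_eq_divide)
  show "exp_avg_log_inv \<mu> Q w \<noteq> 0"
    by (auto simp: exp_avg_log_inv_def)
qed

abbreviation local_quotient :: "'a measure \<Rightarrow> 'a set \<Rightarrow> ('a \<Rightarrow> real) \<Rightarrow> real \<Rightarrow> ennreal" where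
  "local_quotient \<mu> Q w a \<equiv> avg \<mu> Q (\<lambda>x. ennreal (w x)) epowr a * exp_avg_log_inv \<mu> Q w epowr a"

lemma weight_avg_quotient:
  assumes hd: "homogeneous_space d \<mu>" "dyadic_lattice d \<mu> D" and Q: "Q \<in> cubes D" and w: "weight d \<mu> w"
    and fin: "exp_avg_log_inv \<mu> Q w \<noteq> \<infinity>"
  shows "local_quotient \<mu> Q w a
     = ennreal ((mean \<mu> Q (pos_version w) / exp (mean \<mu> Q (\<lambda>x. ln (pos_version w x)))) powr a)"
  using weight_on_cube(2,3,5)[OF hd Q w] fin
  by (simp add: ennreal_epowr powr_divide flip: ennreal_mult)

lemma weight_quotient_nonzero:
  assumes "homogeneous_space d \<mu>" "dyadic_lattice d \<mu> D" "Q \<in> cubes D" "weight d \<mu> w" "0 < a"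
  shows "local_quotient \<mu> Q w a \<noteq> 0"
  using weight_on_cube(2,3,6)[OF assms(1-4)] assms(5) by (simp add: epowr_eq_0_iff)

lemma weight_quotient_top:
  assumes "homogeneous_space d \<mu>" "dyadic_lattice d \<mu> D" "Q \<in> cubes D" "weight d \<mu> w" "0 < a"
    and "local_quotient \<mu> Q w a \<noteq> \<infinity>"
  shows "exp_avg_log_inv \<mu> Q w \<noteq> \<infinity>"
  using weight_on_cube(2,3)[OF assms(1-4)] assms(5,6)
  by (auto simp: epowr_def ennreal_mult_eq_top_iff split: if_splits)

lemma factor_finite:
  fixes x :: "'i \<Rightarrow> ennreal"
  assumes "finite I" "\<And>i. i \<in> I \<Longrightarrow> x i \<noteq> 0" "(\<Prod>i\<in>I. x i) \<noteq> \<infinity>" "i \<in> I"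
  shows "x i \<noteq> \<infinity>"
proof -
  have "(\<Prod>i\<in>I - {i}. x i) \<noteq> 0" using assms by auto
  then show ?thesis
    using assms(3) by (auto simp: prod.remove[OF assms(1,4)] ennreal_mult_eq_top_iff)
qed

lemma Lnorm_finite:
  fixes f w :: "'a \<Rightarrow> real"
  assumes s: "0 < s" and [measurable]: "f \<in> borel_measurable M" "w \<in> borel_measurable M"
    and w: "\<And>x. 0 \<le> w x" and fin: "Lnorm M s w (\<lambda>x. ennreal \<bar>f x\<bar>) < \<infinity>"
  shows "integrable M (\<lambda>x. \<bar>f x\<bar> powr s * w x)"
    and "Lnorm M s w (\<lambda>x. ennreal \<bar>f x\<bar>) = ennreal ((\<integral>x. \<bar>f x\<bar> powr s * w x \<partial>M) powr (1 / s))"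
proof -
  have eq: "(\<integral>\<^sup>+x. ennreal \<bar>f x\<bar> epowr s * ennreal (w x) \<partial>M) = (\<integral>\<^sup>+x. ennreal (\<bar>f x\<bar> powr s * w x) \<partial>M)"
    using s w by (intro nn_integral_cong) (simp add: ennreal_epowr ennreal_mult)
  have "(\<integral>\<^sup>+x. ennreal (\<bar>f x\<bar> powr s * w x) \<partial>M) \<noteq> \<infinity>"
  proof
    assume "(\<integral>\<^sup>+x. ennreal (\<bar>f x\<bar> powr s * w x) \<partial>M) = \<infinity>"
    then have "Lnorm M s w (\<lambda>x. ennreal \<bar>f x\<bar>) = \<infinity>"
      using s unfolding Lnorm_def eq by (subst epowr_eq_top_iff) auto
    then show False using fin by simp
  qed
  then show int: "integrable M (\<lambda>x. \<bar>f x\<bar> powr s * w x)"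
    using w by (intro integrableI_nonneg) (auto simp: less_top)
  show "Lnorm M s w (\<lambda>x. ennreal \<bar>f x\<bar>) = ennreal ((\<integral>x. \<bar>f x\<bar> powr s * w x \<partial>M) powr (1 / s))"
    unfolding Lnorm_def eq using int w s
    by (subst nn_integral_eq_integral) (auto simp: ennreal_epowr integral_nonneg_AE)
qed

lemma Lnorm_cong_AE:
  assumes "AE x in M. w x = w' x"
  shows "Lnorm M s w g = Lnorm M s w' g"
  unfolding Lnorm_def using assms
  by (intro arg_cong2[where f = "(epowr)"] refl nn_integral_cong_AE) (auto elim!: eventually_mono)

text \<open>\<open>\<bar>f\<bar> powr p0\<close> is a function in \<open>L\<^bsup>p / p0\<^esup>(v)\<close> times \<open>v\<close>, hence locally integrable.\<close>

lemma set_integrable_abs_powr: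
  fixes f v :: "'a \<Rightarrow> real"
  assumes [measurable]: "f \<in> borel_measurable M" "v \<in> borel_measurable M" "Q \<in> sets M"
    and v: "\<And>x. 0 < v x" "set_integrable M Q v" and p: "0 < p0" "p0 \<le> p"
    and int: "integrable M (\<lambda>x. \<bar>f x\<bar> powr p * v x powr (1 - p / p0))"
  shows "set_integrable M Q (\<lambda>x. \<bar>f x\<bar> powr p0)"
proof -
  have eq: "(\<bar>f x\<bar> powr p0 / v x) powr (p / p0) * v x = \<bar>f x\<bar> powr p * v x powr (1 - p / p0)" for x
    using v(1)[of x] p by (simp add: powr_divide powr_powr powr_diff)
  have "set_integrable M Q (\<lambda>x. (\<bar>f x\<bar> powr p0 / v x) * v x)"
    using v p int by (intro set_integrable_of_powr[where r = "p / p0"]) (auto simp: eq less_imp_le)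
  moreover have "(\<bar>f x\<bar> powr p0 / v x) * v x = \<bar>f x\<bar> powr p0" for x
    using v(1)[of x] by simp
  ultimately show ?thesis by simp
qed

section \<open>The norm of the sparse operator\<close>

lemma prod_ennreal_nonzero:
  fixes x :: "'i \<Rightarrow> ennreal"
  shows "(\<And>i. i \<in> I \<Longrightarrow> x i \<noteq> 0) \<Longrightarrow> (\<Prod>i\<in>I. x i) \<noteq> 0"
  by (cases "finite I") auto

lemma ennreal_left_factor_finite: "y \<noteq> 0 \<Longrightarrow> x * y < \<infinity> \<Longrightarrow> x \<noteq> (\<infinity> :: ennreal)"
  by (cases "x = \<infinity>") (auto simp: ennreal_top_mult)

lemma Astar_scaled_ge:
  assumes "Q \<in> cubes D" "1 \<le> p0" "0 < q" "\<And>i. i \<in> {1..m} \<Longrightarrow> p0 < p i"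
  shows "avg \<mu> Q (\<lambda>x. ennreal (u x)) * (\<Prod>i=1..m. avg \<mu> Q (\<lambda>x. ennreal (\<sigma> i x)) epowr (q * (1 / p0 - 1 / p i)))
    \<le> Astar \<mu> D m (\<lambda>i. p i / p0) (q / p0) u \<sigma>"
proof -
  have e: "q / p0 / conj_exp (p i / p0) = q * (1 / p0 - 1 / p i)" if "i \<in> {1..m}" for i
    using assms(2) assms(4)[OF that] by (simp add: conj_exp_def field_simps)
  have "avg \<mu> Q (\<lambda>x. ennreal (u x)) * (\<Prod>i=1..m. avg \<mu> Q (\<lambda>x. ennreal (\<sigma> i x)) epowr (q * (1 / p0 - 1 / p i)))
    = avg \<mu> Q (\<lambda>x. ennreal (u x)) * (\<Prod>i=1..m. avg \<mu> Q (\<lambda>x. ennreal (\<sigma> i x)) epowr (q / p0 / conj_exp (p i / p0)))"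
    by (intro arg_cong2[where f = "(*)"] refl prod.cong) (simp only: e)
  also have "\<dots> \<le> Astar \<mu> D m (\<lambda>i. p i / p0) (q / p0) u \<sigma>"
    unfolding Astar_def by (rule SUP_upper[OF assms(1)])
  finally show ?thesis .
qed

lemma ennreal_nonzero_mono: "x \<noteq> 0 \<Longrightarrow> x \<le> y \<Longrightarrow> y \<noteq> (0 :: ennreal)"
  by auto

context
  fixes d :: "'a \<Rightarrow> 'a \<Rightarrow> real" and \<mu> :: "'a measure" and D m p u \<sigma> H' and \<gamma> q p0 \<eta> \<delta> A H :: real
  assumes hd: "homogeneous_space d \<mu>" "dyadic_lattice d \<mu> D"
    and m: "1 \<le> m" and \<gamma>: "0 < \<gamma>" and q: "0 < q" and p0: "1 \<le> p0" and p: "\<And>i. i \<in> {1..m} \<Longrightarrow> p0 < p i"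
    and \<eta>: "\<eta> = (\<Sum>i=1..m. 1 / p i) - 1 / q" "0 \<le> \<eta>" and \<delta>: "0 < \<delta>" "\<delta> < 1"
    and dich: "q \<le> \<gamma> \<or> (\<gamma> < q \<and> (\<forall>i\<in>{1..m}. \<gamma> < p i))"
    and u: "weight d \<mu> u" and \<sigma>: "\<And>i. i \<in> {1..m} \<Longrightarrow> weight d \<mu> (\<sigma> i)"
    and A: "Astar \<mu> D m (\<lambda>i. p i / p0) (q / p0) u \<sigma> = ennreal A" "0 < A"
    and H: "Hinf \<mu> D m p q \<sigma> = ennreal H" "0 \<le> H"
    and H': "\<And>i. i \<in> {1..m} \<Longrightarrow> Hinf_dual \<mu> D m p q \<gamma> u \<sigma> i = ennreal (H' i)" "\<And>i. i \<in> {1..m} \<Longrightarrow> 0 \<le> H' i"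
begin

text \<open>Finite constants force \<open>\<langle>ln v\<rangle>\<^bsub>Q\<^esub>\<close> to exist for every weight involved, because all factors of the defining
  products are non-zero. All quantities are then real numbers, and the estimate for finite sparse sums applies with \<open>K = 1 / \<delta>\<close>.\<close>

lemma finite_sparse_bound:
  assumes f: "\<And>i. i \<in> {1..m} \<Longrightarrow> f i \<in> borel_measurable \<mu>"
      "\<And>i. i \<in> {1..m} \<Longrightarrow> integrable \<mu> (\<lambda>x. \<bar>f i x\<bar> powr p i * pos_version (\<sigma> i) x powr (1 - p i / p0))"
    and S: "S \<subseteq> cubes D" "sparse_family \<mu> \<delta> S" and F: "finite F" "F \<subseteq> S"
  defines "t \<equiv> \<lambda>Q. (emeasure \<mu> Q epowr \<eta> * (\<Prod>i=1..m. avg \<mu> Q (\<lambda>y. ennreal \<bar>f i y\<bar> epowr p0) epowr (1 / p0))) epowr \<gamma>"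
  shows "(\<integral>\<^sup>+x. (\<Sum>Q\<in>F. t Q * indicator Q x) epowr (q / \<gamma>) * ennreal (u x) \<partial>\<mu>)
    \<le> ennreal ((sparse_const (1 / \<delta>) p0 q \<gamma> m p * A powr (1 / q) *
        (H powr (1 / q) + (\<Sum>i=1..m. H' i powr (1 / conj_exp (p i)))) *
        (\<Prod>i=1..m. (\<integral>x. \<bar>f i x\<bar> powr p i * pos_version (\<sigma> i) x powr (1 - p i / p0) \<partial>\<mu>) powr (1 / p i))) powr q)"
    (is "_ \<le> ennreal (?B powr q)")
    and "(\<lambda>x. (\<Sum>Q\<in>F. t Q * indicator Q x) epowr (q / \<gamma>)) \<in> borel_measurable \<mu>"
proof -
  have FD: "F \<subseteq> cubes D" using F S by auto
  note cube = subsetD[OF FD]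
  interpret F: measured_laminar_family F \<mu>
    by (rule measured_laminar_cubes[OF hd F(1) FD])
  have Carl: "F.Carleson (1 / \<delta>)"
    by (rule sparse_imp_Carleson[OF hd F S \<delta>(1)])
  define v where "v i = pos_version (\<sigma> i)" for i
  define u' where "u' = pos_version u"
  have quot: "F.Ainf_quotient w Q = mean \<mu> Q w / exp (mean \<mu> Q (\<lambda>x. ln (w x)))" for w Q
    by (simp add: F.Ainf_quotient_def F.ln_mean_def)
  have p_pos: "0 < p i" if "i \<in> {1..m}" for i using p[OF that] p0 by simp
  have conj: "0 < conj_exp (p i)" if "i \<in> {1..m}" for i
    using p[OF that] p0 by (simp add: conj_exp_def)
  have \<sigma>fin: "exp_avg_log_inv \<mu> Q (\<sigma> i) \<noteq> \<infinity>" if Q: "Q \<in> cubes D" and i: "i \<in> {1..m}" for Q i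
  proof -
    let ?x = "\<lambda>i. local_quotient \<mu> Q (\<sigma> i) (q / p i)"
    have "(\<Prod>i=1..m. ?x i) \<le> ennreal H"
      unfolding H(1)[symmetric] Hinf_def by (rule SUP_upper[OF Q])
    then have "(\<Prod>i=1..m. ?x i) < \<infinity>" by (rule le_less_trans) simp
    then have "(\<Prod>i=1..m. ?x i) \<noteq> \<infinity>" by (rule less_imp_neq)
    then have prod: "(\<Prod>i\<in>{1..m}. ?x i) \<noteq> \<infinity>" .
    have "?x j \<noteq> 0" if "j \<in> {1..m}" for j
      by (rule weight_quotient_nonzero[OF hd Q \<sigma>[OF that]]) (use q p_pos[OF that] in simp)
    then have "?x i \<noteq> \<infinity>"
      by (rule factor_finite[OF finite_atLeastAtMost _ prod i])
    then show ?thesis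
      by (rule weight_quotient_top[OF hd Q \<sigma>[OF i], rotated]) (use q p_pos[OF i] in simp)
  qed
  have ufin: "exp_avg_log_inv \<mu> Q u \<noteq> \<infinity>" and
    dual: "i \<in> {1..m} \<Longrightarrow> F.Ainf_quotient u' Q powr (conj_exp (p i) * (1 / \<gamma> - 1 / q)) *
      (\<Prod>j\<in>{1..m} - {i}. F.Ainf_quotient (v j) Q powr (conj_exp (p i) / p j)) \<le> H' i"
    if Q: "Q \<in> cubes D" and qg: "\<gamma> < q" for Q i
  proof -
    define b where "b = 1 / \<gamma> - 1 / q"
    have b: "0 < b" "max (1 / \<gamma> - 1 / q) 0 = b" using qg \<gamma> by (auto simp: b_def field_simps)
    let ?y = "\<lambda>i. local_quotient \<mu> Q u (conj_exp (p i) * b)"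
    let ?x = "\<lambda>i j. local_quotient \<mu> Q (\<sigma> j) (conj_exp (p i) / p j)"
    have le: "?y i * (\<Prod>j\<in>{1..m} - {i}. ?x i j) \<le> ennreal (H' i)" if i: "i \<in> {1..m}" for i
    proof -
      have "?y i * (\<Prod>j\<in>{1..m} - {i}. ?x i j) \<le> Hinf_dual \<mu> D m p q \<gamma> u \<sigma> i"
        unfolding Hinf_dual_def b using qg by (auto intro: SUP_upper[OF Q])
      then show ?thesis by (simp only: H'(1)[OF i])
    qed
    have x: "?x i j = ennreal (F.Ainf_quotient (v j) Q powr (conj_exp (p i) / p j))" if "j \<in> {1..m}" for i j
      unfolding quot v_def using that by (intro weight_avg_quotient[OF hd Q \<sigma> \<sigma>fin[OF Q]])
    have prodx: "(\<Prod>j\<in>{1..m} - {i}. ?x i j) = ennreal (\<Prod>j\<in>{1..m} - {i}. F.Ainf_quotient (v j) Q powr (conj_exp (p i) / p j))" for i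
      using x by (subst prod_ennreal[symmetric]) (auto intro!: prod.cong)
    have 1: "1 \<in> {1..m}" using m by simp
    have "(\<Prod>j\<in>{1..m} - {1}. ?x 1 j) \<noteq> 0"
    proof (rule prod_ennreal_nonzero)
      fix j assume "j \<in> {1..m} - {1}"
      then have j: "j \<in> {1..m}" by (rule DiffD1)
      show "?x 1 j \<noteq> 0"
        by (rule weight_quotient_nonzero[OF hd Q \<sigma>[OF j]]) (use conj[OF 1] p_pos[OF j] in simp)
    qed
    moreover have "?y 1 * (\<Prod>j\<in>{1..m} - {1}. ?x 1 j) < \<infinity>"
      using le[OF 1] by (rule le_less_trans) simp
    ultimately have "?y 1 \<noteq> \<infinity>" by (rule ennreal_left_factor_finite)
    then show uf: "exp_avg_log_inv \<mu> Q u \<noteq> \<infinity>"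
      by (rule weight_quotient_top[OF hd Q u, rotated]) (use conj[OF 1] b(1) in simp)
    assume i: "i \<in> {1..m}"
    have y: "?y i = ennreal (F.Ainf_quotient u' Q powr (conj_exp (p i) * b))"
      unfolding quot u'_def by (rule weight_avg_quotient[OF hd Q u uf])
    have "ennreal (F.Ainf_quotient u' Q powr (conj_exp (p i) * b) *
      (\<Prod>j\<in>{1..m} - {i}. F.Ainf_quotient (v j) Q powr (conj_exp (p i) / p j))) \<le> ennreal (H' i)"
      using le[OF i] unfolding y prodx by (simp add: ennreal_mult prod_nonneg)
    then show "F.Ainf_quotient u' Q powr (conj_exp (p i) * (1 / \<gamma> - 1 / q)) *
      (\<Prod>j\<in>{1..m} - {i}. F.Ainf_quotient (v j) Q powr (conj_exp (p i) / p j)) \<le> H' i"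
      using H'(2)[OF i] by (simp add: b_def)
  qed
  have Hbound: "(\<Prod>i=1..m. F.Ainf_quotient (v i) Q powr (q / p i)) \<le> H" if Q: "Q \<in> cubes D" for Q
  proof -
    have "ennreal (\<Prod>i=1..m. F.Ainf_quotient (v i) Q powr (q / p i))
      = (\<Prod>i=1..m. ennreal (F.Ainf_quotient (v i) Q powr (q / p i)))"
      by (rule prod_ennreal[symmetric]) simp
    also have "\<dots> = (\<Prod>i=1..m. local_quotient \<mu> Q (\<sigma> i) (q / p i))"
      unfolding quot v_def by (intro prod.cong refl weight_avg_quotient[OF hd Q \<sigma> \<sigma>fin[OF Q], symmetric])
    also have "\<dots> \<le> ennreal H"
      unfolding H(1)[symmetric] Hinf_def by (rule SUP_upper[OF Q])
    finally show ?thesis using H(2) by simp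
  qed
  have Abound: "mean \<mu> Q u' * (\<Prod>i=1..m. mean \<mu> Q (v i) powr (q * (1 / p0 - 1 / p i))) \<le> A" if Q: "Q \<in> cubes D" for Q
  proof -
    have avgv: "avg \<mu> Q (\<lambda>x. ennreal (\<sigma> i x)) epowr a = ennreal (mean \<mu> Q (v i) powr a)" if "i \<in> {1..m}" for i a
      using weight_on_cube(2,3)[OF hd Q \<sigma>[OF that]] by (simp add: v_def ennreal_epowr)
    have "ennreal (mean \<mu> Q u' * (\<Prod>i=1..m. mean \<mu> Q (v i) powr (q * (1 / p0 - 1 / p i))))
      = avg \<mu> Q (\<lambda>x. ennreal (u x)) * (\<Prod>i=1..m. avg \<mu> Q (\<lambda>x. ennreal (\<sigma> i x)) epowr (q * (1 / p0 - 1 / p i)))"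
      using weight_on_cube(2,3)[OF hd Q u] avgv
      by (simp add: u'_def ennreal_mult prod_nonneg prod_ennreal cong: prod.cong_simp)
    also have "\<dots> \<le> ennreal A"
      unfolding A(1)[symmetric] by (rule Astar_scaled_ge[OF Q p0 q p])
    finally show ?thesis using A(2) by simp
  qed
  have vpos: "0 < v i x" "0 < u' x" for i x by (simp_all add: v_def u'_def pos_version_pos)
  have vmeas [measurable]: "v i \<in> borel_measurable \<mu>" if "i \<in> {1..m}" for i
    unfolding v_def using weight_measurable[OF \<sigma>[OF that]] by measurable
  have umeas [measurable]: "u' \<in> borel_measurable \<mu>"
    unfolding u'_def using weight_measurable[OF u] by measurable
  have vint: "set_integrable \<mu> Q (v i)" if "i \<in> {1..m}" "Q \<in> F" for Q i
    unfolding v_def by (rule weight_on_cube(1)[OF hd cube[OF that(2)] \<sigma>[OF that(1)]])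
  have uint: "set_integrable \<mu> Q u'" if "Q \<in> F" for Q
    unfolding u'_def by (rule weight_on_cube(1)[OF hd cube[OF that] u])
  define X where "X = (\<integral>x. F.sparse_sum \<eta> p0 \<gamma> m f x powr (q / \<gamma>) * u' x \<partial>\<mu>)"
  have "X powr (1 / q) \<le> ?B"
    unfolding X_def v_def[symmetric]
  proof (rule F.sparse_bound[OF Carl _ m \<gamma> q p0 p \<eta> umeas vpos(2) uint vmeas vpos(1) vint _ f(1) f(2)[folded v_def]
        A(2) Abound[OF cube] _ H(2) H'(2) Hbound[OF cube]])
    show "1 \<le> 1 / \<delta>" using \<delta> by simp
    show "set_integrable \<mu> Q (\<lambda>x. ln (v i x))" if "i \<in> {1..m}" "Q \<in> F" for i Q
      unfolding v_def using that
      by (intro weight_on_cube(4)[OF hd cube[OF that(2)] \<sigma>[OF that(1)] \<sigma>fin[OF cube[OF that(2)] that(1)]])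
    have "set_integrable \<mu> Q (\<lambda>x. ln (u' x))" if "Q \<in> F" "\<gamma> < q" for Q
      unfolding u'_def by (rule weight_on_cube(4)[OF hd cube[OF that(1)] u ufin[OF cube[OF that(1)] that(2)]])
    then show "q \<le> \<gamma> \<or> \<gamma> < q \<and> (\<forall>i\<in>{1..m}. \<gamma> < p i) \<and> (\<forall>Q\<in>F. set_integrable \<mu> Q (\<lambda>x. ln (u' x)))"
      using dich by blast
    show "F.Ainf_quotient u' Q powr (conj_exp (p i) * (1 / \<gamma> - 1 / q)) *
      (\<Prod>j\<in>{1..m} - {i}. F.Ainf_quotient (v j) Q powr (conj_exp (p i) / p j)) \<le> H' i"
      if "i \<in> {1..m}" "Q \<in> F" "\<gamma> < q" for i Q
      by (rule dual[OF cube[OF that(2)] that(3) that(1)])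
  qed
  have X0: "0 \<le> X"
    unfolding X_def using vpos(2) by (intro Bochner_Integration.integral_nonneg) (simp add: less_imp_le)
  then have XB: "X \<le> ?B powr q"
  proof -
    have "(X powr (1 / q)) powr q \<le> ?B powr q" using \<open>X powr (1 / q) \<le> ?B\<close> q by (intro powr_mono2) auto
    then show ?thesis using X0 q by (simp add: powr_powr)
  qed
  have avgf: "avg \<mu> Q (\<lambda>y. ennreal \<bar>f i y\<bar> epowr p0) = ennreal (mean \<mu> Q (\<lambda>x. \<bar>f i x\<bar> powr p0))"
    if Q: "Q \<in> F" and i: "i \<in> {1..m}" for Q i
  proof -
    have "avg \<mu> Q (\<lambda>y. ennreal \<bar>f i y\<bar> epowr p0) = avg \<mu> Q (\<lambda>y. ennreal (\<bar>f i y\<bar> powr p0))"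
      using p0 by (simp add: ennreal_epowr)
    also have "\<dots> = ennreal (mean \<mu> Q (\<lambda>x. \<bar>f i x\<bar> powr p0))"
      using p0 p[OF i] vpos(1)[of i] vint[OF i Q] f[OF i] vmeas[OF i] cube_facts(1-3)[OF hd cube[OF Q]]
      by (intro avg_eq_mean set_integrable_abs_powr[where v = "v i" and p = "p i"]) (auto simp: v_def)
    finally show ?thesis .
  qed
  have t: "t Q = ennreal (F.sparse_coeff \<eta> p0 m f Q powr \<gamma>)" if Q: "Q \<in> F" for Q
  proof -
    have "(\<Prod>i=1..m. avg \<mu> Q (\<lambda>y. ennreal \<bar>f i y\<bar> epowr p0) epowr (1 / p0))
       = (\<Prod>i=1..m. ennreal (mean \<mu> Q (\<lambda>x. \<bar>f i x\<bar> powr p0) powr (1 / p0)))"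
      using p0 avgf[OF Q] F.mean_nonneg
      by (intro prod.cong refl) (simp add: ennreal_epowr)
    also have "\<dots> = ennreal (\<Prod>i=1..m. mean \<mu> Q (\<lambda>x. \<bar>f i x\<bar> powr p0) powr (1 / p0))"
      by (rule prod_ennreal) simp
    finally show ?thesis
      using cube_facts(2,3)[OF hd cube[OF Q]] \<gamma>
      by (simp add: t_def F.sparse_coeff_def ennreal_epowr prod_nonneg flip: ennreal_mult)
  qed
  have sum_eq: "(\<Sum>Q\<in>F. t Q * indicator Q x) = ennreal (F.sparse_sum \<eta> p0 \<gamma> m f x)" for x
  proof -
    have "(\<Sum>Q\<in>F. t Q * indicator Q x) = (\<Sum>Q\<in>F. ennreal (F.sparse_coeff \<eta> p0 m f Q powr \<gamma> * indicator Q x))"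
      by (intro sum.cong refl) (simp add: t indicator_def)
    then show ?thesis by (simp add: F.sparse_sum_def)
  qed
  have pow_eq: "(\<Sum>Q\<in>F. t Q * indicator Q x) epowr (q / \<gamma>) = ennreal (F.sparse_sum \<eta> p0 \<gamma> m f x powr (q / \<gamma>))" for x
    unfolding sum_eq using F.sparse_sum_nonneg q \<gamma> by (simp add: ennreal_epowr)
  show "(\<lambda>x. (\<Sum>Q\<in>F. t Q * indicator Q x) epowr (q / \<gamma>)) \<in> borel_measurable \<mu>"
    unfolding pow_eq by measurable
  have "(\<integral>\<^sup>+x. (\<Sum>Q\<in>F. t Q * indicator Q x) epowr (q / \<gamma>) * ennreal (u x) \<partial>\<mu>)
     = (\<integral>\<^sup>+x. ennreal (F.sparse_sum \<eta> p0 \<gamma> m f x powr (q / \<gamma>) * u' x) \<partial>\<mu>)"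
    unfolding pow_eq using weight_AE[OF u, folded u'_def] vpos(2)
    by (intro nn_integral_cong_AE) (auto elim!: eventually_mono simp: ennreal_mult less_imp_le)
  also have "\<dots> = ennreal X"
    unfolding X_def using q \<gamma> umeas vpos(2) uint
    by (intro nn_integral_eq_integral F.integrable_sparse_sum_powr) (auto simp: less_imp_le)
  also have "\<dots> \<le> ennreal (?B powr q)" using XB by (rule ennreal_leI)
  finally show "(\<integral>\<^sup>+x. (\<Sum>Q\<in>F. t Q * indicator Q x) epowr (q / \<gamma>) * ennreal (u x) \<partial>\<mu>) \<le> ennreal (?B powr q)" .
qed

lemma sparse_op_norm_bound:
  assumes S: "S \<subseteq> cubes D" "sparse_family \<mu> \<delta> S"
  shows "op_norm \<mu> m p (\<lambda>i x. \<sigma> i x powr (1 - p i / p0)) q u (sparse_op \<mu> m \<eta> S p0 \<gamma>)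
    \<le> ennreal (sparse_const (1 / \<delta>) p0 q \<gamma> m p * A powr (1 / q) * (H powr (1 / q) + (\<Sum>i=1..m. H' i powr (1 / conj_exp (p i)))))"
    (is "_ \<le> ennreal ?R")
  unfolding op_norm_def
proof (rule Inf_lower, rule CollectI, intro allI impI)
  fix f :: "nat \<Rightarrow> 'a \<Rightarrow> real"
  assume f: "\<forall>i\<in>{1..m}. f i \<in> borel_measurable \<mu> \<and>
    Lnorm \<mu> (p i) (\<lambda>x. \<sigma> i x powr (1 - p i / p0)) (\<lambda>x. ennreal \<bar>f i x\<bar>) < \<infinity>"
  define w where "w i x = pos_version (\<sigma> i) x powr (1 - p i / p0)" for i x
  define Y where "Y i = (\<integral>x. \<bar>f i x\<bar> powr p i * w i x \<partial>\<mu>)" for i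
  have N: "integrable \<mu> (\<lambda>x. \<bar>f i x\<bar> powr p i * w i x)"
    "Lnorm \<mu> (p i) (\<lambda>x. \<sigma> i x powr (1 - p i / p0)) (\<lambda>x. ennreal \<bar>f i x\<bar>) = ennreal (Y i powr (1 / p i))"
    if i: "i \<in> {1..m}" for i
  proof -
    have eq: "Lnorm \<mu> (p i) (\<lambda>x. \<sigma> i x powr (1 - p i / p0)) g = Lnorm \<mu> (p i) (w i) g" for g
      unfolding w_def using weight_AE[OF \<sigma>[OF i]] by (intro Lnorm_cong_AE) (auto elim!: eventually_mono)
    have [measurable]: "\<sigma> i \<in> borel_measurable \<mu>" by (rule weight_measurable[OF \<sigma>[OF i]])
    have w: "w i \<in> borel_measurable \<mu>" "\<And>x. 0 \<le> w i x" unfolding w_def[abs_def] by measurable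
    have pi: "0 < p i" using p[OF i] p0 by simp
    have fi: "f i \<in> borel_measurable \<mu>" "Lnorm \<mu> (p i) (w i) (\<lambda>x. ennreal \<bar>f i x\<bar>) < \<infinity>"
      using bspec[OF f i] unfolding eq[symmetric] by auto
    note L = Lnorm_finite[OF pi fi(1) w fi(2)]
    show "integrable \<mu> (\<lambda>x. \<bar>f i x\<bar> powr p i * w i x)" by (rule L(1))
    show "Lnorm \<mu> (p i) (\<lambda>x. \<sigma> i x powr (1 - p i / p0)) (\<lambda>x. ennreal \<bar>f i x\<bar>) = ennreal (Y i powr (1 / p i))"
      unfolding eq Y_def by (rule L(2))
  qed
  define B where "B = ?R * (\<Prod>i=1..m. Y i powr (1 / p i))"
  have sc: "0 \<le> sparse_const (1 / \<delta>) p0 q \<gamma> m p"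
    by (auto simp: sparse_const_def intro!: add_nonneg_nonneg prod_nonneg)
  have R0: "0 \<le> ?R"
    using sc by (intro mult_nonneg_nonneg add_nonneg_nonneg sum_nonneg) auto
  have B0: "0 \<le> B" unfolding B_def by (rule mult_nonneg_nonneg[OF R0 prod_nonneg]) simp
  define t where "t Q = (emeasure \<mu> Q epowr \<eta> * (\<Prod>i=1..m. avg \<mu> Q (\<lambda>y. ennreal \<bar>f i y\<bar> epowr p0) epowr (1 / p0))) epowr \<gamma>" for Q
  have "(\<integral>\<^sup>+x. (\<Sum>\<^sub>\<infinity>Q\<in>S. t Q * indicator Q x) epowr (q / \<gamma>) * ennreal (u x) \<partial>\<mu>) \<le> ennreal (B powr q)"
  proof (rule nn_integral_infsum_epowr_le)
    show "countable S" using S(1) cubes_countable[OF hd(2)] by (rule countable_subset)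
    show "u \<in> borel_measurable \<mu>" by (rule weight_measurable[OF u])
    fix F assume F: "finite F" "F \<subseteq> S"
    note fs = finite_sparse_bound[OF _ _ S F, of f]
    show "(\<integral>\<^sup>+x. (\<Sum>Q\<in>F. t Q * indicator Q x) epowr (q / \<gamma>) * ennreal (u x) \<partial>\<mu>) \<le> ennreal (B powr q)"
      unfolding t_def B_def Y_def w_def using f N(1)[unfolded w_def] by (intro fs(1)) auto
    show "(\<lambda>x. (\<Sum>Q\<in>F. t Q * indicator Q x) epowr (q / \<gamma>)) \<in> borel_measurable \<mu>"
      unfolding t_def using f N(1)[unfolded w_def] by (intro fs(2)) auto
  qed (use q \<gamma> in simp)
  then have "(\<integral>\<^sup>+x. (\<Sum>\<^sub>\<infinity>Q\<in>S. t Q * indicator Q x) epowr (q / \<gamma>) * ennreal (u x) \<partial>\<mu>) epowr (1 / q)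
      \<le> ennreal (B powr q) epowr (1 / q)"
    using q by (intro epowr_mono) auto
  moreover have "sparse_op \<mu> m \<eta> S p0 \<gamma> f x epowr q = (\<Sum>\<^sub>\<infinity>Q\<in>S. t Q * indicator Q x) epowr (q / \<gamma>)" for x
    using q \<gamma> by (simp add: sparse_op_def t_def epowr_epowr)
  moreover have "ennreal (B powr q) epowr (1 / q) = ennreal B"
    using q B0 by (simp add: ennreal_epowr powr_powr)
  ultimately have "Lnorm \<mu> q u (sparse_op \<mu> m \<eta> S p0 \<gamma> f) \<le> ennreal B"
    by (simp add: Lnorm_def)
  also have "ennreal B = ennreal ?R * ennreal (\<Prod>i=1..m. Y i powr (1 / p i))"
    unfolding B_def using R0 by (rule ennreal_mult) (auto intro: prod_nonneg)
  also have "ennreal (\<Prod>i=1..m. Y i powr (1 / p i))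
      = (\<Prod>i=1..m. Lnorm \<mu> (p i) (\<lambda>x. \<sigma> i x powr (1 - p i / p0)) (\<lambda>x. ennreal \<bar>f i x\<bar>))"
    using N(2) by (subst prod_ennreal[symmetric]) (auto intro!: prod.cong)
  finally show "Lnorm \<mu> q u (sparse_op \<mu> m \<eta> S p0 \<gamma> f)
      \<le> ennreal ?R * (\<Prod>i=1..m. Lnorm \<mu> (p i) (\<lambda>x. \<sigma> i x powr (1 - p i / p0)) (\<lambda>x. ennreal \<bar>f i x\<bar>))" .
qed

end

theorem theorem1p19:
  fixes d :: "'a \<Rightarrow> 'a \<Rightarrow> real" and \<mu> :: "'a measure"
    and m :: nat and p :: "nat \<Rightarrow> real" and p0 q \<gamma> \<eta> \<delta> :: real
  assumes "homogeneous_space d \<mu>"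
    and "1 \<le> m" and "0 < \<gamma>" and "0 < q" and "1 \<le> p0" and "\<forall>i\<in>{1..m}. p0 < p i"
    and "\<eta> = (\<Sum>i=1..m. 1 / p i) - 1 / q" and "0 \<le> \<eta>" and "\<eta> < real m"
    and "0 < \<delta>" and "\<delta> < 1"
    and "(p0 \<le> \<gamma> \<and> \<gamma> < Min (p ` {1..m})) \<or> (\<gamma> < p0 \<and> \<gamma> < q)"
  shows "\<exists>C>0. \<forall>D u \<sigma>.
    dyadic_lattice d \<mu> D \<longrightarrow> weight d \<mu> u \<longrightarrow> (\<forall>i\<in>{1..m}. weight d \<mu> (\<sigma> i)) \<longrightarrow>
    Astar \<mu> D m p q u \<sigma> < \<infinity> \<longrightarrow>
    (SUP S\<in>{S. S \<subseteq> cubes D \<and> sparse_family \<mu> \<delta> S}.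
       op_norm \<mu> m p (\<lambda>i x. \<sigma> i x powr (1 - p i / p0)) q u (sparse_op \<mu> m \<eta> S p0 \<gamma>))
    \<le> ennreal C * Astar \<mu> D m (\<lambda>i. p i / p0) (q / p0) u \<sigma> epowr (1 / q) *
       (Hinf \<mu> D m p q \<sigma> epowr (1 / q) +
        (\<Sum>i=1..m. Hinf_dual \<mu> D m p q \<gamma> u \<sigma> i epowr (1 / conj_exp (p i))))"
proof -
  define C where "C = sparse_const (1 / \<delta>) p0 q \<gamma> m p"
  have "0 \<le> (\<Prod>i=1..m. (4 * (1 / \<delta>) * (p i / p0 / (p i / p0 - 1)) powr (p i / p0)) powr (1 / p i))"
    "0 \<le> (real m + 1) powr (1 / \<gamma>) * large_q_const (1 / \<delta>) p0 q \<gamma> m p powr (1 / \<gamma>)"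
    by (auto intro!: prod_nonneg mult_nonneg_nonneg)
  then have C: "0 < C" unfolding C_def sparse_const_def by linarith
  have p: "p0 < p i" if "i \<in> {1..m}" for i using assms(6) that by blast
  have \<gamma>p: "\<gamma> < p i" if i: "i \<in> {1..m}" for i
  proof -
    have "Min (p ` {1..m}) \<le> p i" using i by (intro Min_le) auto
    then show ?thesis using assms(12) p[OF i] by linarith
  qed
  have bound: "op_norm \<mu> m p (\<lambda>i x. \<sigma> i x powr (1 - p i / p0)) q u (sparse_op \<mu> m \<eta> S p0 \<gamma>)
    \<le> ennreal C * Astar \<mu> D m (\<lambda>i. p i / p0) (q / p0) u \<sigma> epowr (1 / q) *
       (Hinf \<mu> D m p q \<sigma> epowr (1 / q) +
        (\<Sum>i=1..m. Hinf_dual \<mu> D m p q \<gamma> u \<sigma> i epowr (1 / conj_exp (p i))))"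
    (is "_ \<le> ennreal C * ?As epowr _ * (?Hi epowr _ + (\<Sum>i=1..m. ?Hd i epowr _))")
    if D: "dyadic_lattice d \<mu> D" and u: "weight d \<mu> u" and \<sigma>: "\<And>i. i \<in> {1..m} \<Longrightarrow> weight d \<mu> (\<sigma> i)"
      and S: "S \<subseteq> cubes D" "sparse_family \<mu> \<delta> S" for D u \<sigma> S
  \<comment> \<open>An infinite right-hand side needs no proof. Otherwise each constant is finite, as its cofactors are non-zero.\<close>
  proof (cases "ennreal C * ?As epowr (1 / q) * (?Hi epowr (1 / q) + (\<Sum>i=1..m. ?Hd i epowr (1 / conj_exp (p i)))) = \<infinity>")
    case False
    note hd = assms(1) D
    have p_pos: "0 < p i" if "i \<in> {1..m}" for i using p[OF that] assms(5) by linarith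
    have conj: "0 < 1 / conj_exp (p i)" if "i \<in> {1..m}" for i
      using p[OF that] assms(5) by (simp add: conj_exp_def)
    obtain Q where Q: "Q \<in> cubes D" using cubes_nonempty[OF D] by blast
    have avg_pos: "avg \<mu> Q (\<lambda>x. ennreal (w x)) \<noteq> 0" if "weight d \<mu> w" for w
      using weight_on_cube(2,3)[OF hd Q that] by simp
    have As0: "?As \<noteq> 0"
    proof -
      have "avg \<mu> Q (\<lambda>x. ennreal (\<sigma> i x)) epowr (q * (1 / p0 - 1 / p i)) \<noteq> 0" if i: "i \<in> {1..m}" for i
      proof (subst epowr_eq_0_iff)
        have "1 / p i < 1 / p0" using assms(5) p[OF i] by (intro divide_strict_left_mono) auto
        then show "0 < q * (1 / p0 - 1 / p i)" using assms(4) by simp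
      qed (rule avg_pos[OF \<sigma>[OF i]])
      then have "(\<Prod>i=1..m. avg \<mu> Q (\<lambda>x. ennreal (\<sigma> i x)) epowr (q * (1 / p0 - 1 / p i))) \<noteq> 0"
        by (rule prod_ennreal_nonzero)
      then have "avg \<mu> Q (\<lambda>x. ennreal (u x)) * (\<Prod>i=1..m. avg \<mu> Q (\<lambda>x. ennreal (\<sigma> i x)) epowr (q * (1 / p0 - 1 / p i))) \<noteq> 0"
        using avg_pos[OF u] by simp
      then show ?thesis
        by (rule ennreal_nonzero_mono[OF _ Astar_scaled_ge[OF Q assms(5,4) p]])
    qed
    have Hi0: "?Hi \<noteq> 0"
    proof -
      have "(\<Prod>i=1..m. local_quotient \<mu> Q (\<sigma> i) (q / p i)) \<noteq> 0"
      proof (rule prod_ennreal_nonzero)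
        fix i assume i: "i \<in> {1..m}"
        show "local_quotient \<mu> Q (\<sigma> i) (q / p i) \<noteq> 0"
          by (rule weight_quotient_nonzero[OF hd Q \<sigma>[OF i]]) (use assms(4) p_pos[OF i] in simp)
      qed
      then show ?thesis
        unfolding Hinf_def by (rule ennreal_nonzero_mono[OF _ SUP_upper[OF Q]])
    qed
    have q1: "0 < 1 / q" using assms(4) by simp
    have As1: "?As epowr (1 / q) \<noteq> 0" and Hi1: "?Hi epowr (1 / q) \<noteq> 0"
      using As0 Hi0 by (simp_all only: epowr_eq_0_iff[OF q1] not_False_eq_True)
    have "?As epowr (1 / q) \<noteq> \<infinity>" "?Hi epowr (1 / q) + (\<Sum>i=1..m. ?Hd i epowr (1 / conj_exp (p i))) \<noteq> \<infinity>"
      using False As1 Hi1 C by (auto simp: ennreal_mult_eq_top_iff)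
    then have fin: "?As \<noteq> \<infinity>" "?Hi \<noteq> \<infinity>" "\<And>i. i \<in> {1..m} \<Longrightarrow> ?Hd i \<noteq> \<infinity>"
      using epowr_eq_top_iff[OF q1] epowr_eq_top_iff[OF conj] by (auto simp: ennreal_sum_eq_top)
    define A H H' where "A = enn2real ?As" and "H = enn2real ?Hi" and "H' i = enn2real (?Hd i)" for i
    have A: "?As = ennreal A" "0 < A"
      using fin(1) As0 by (auto simp: A_def enn2real_positive_iff less_top zero_less_iff_neq_zero)
    have H: "?Hi = ennreal H" "0 \<le> H"
      using fin(2) by (auto simp: H_def less_top)
    have H': "?Hd i = ennreal (H' i)" "0 \<le> H' i" if "i \<in> {1..m}" for i
      using fin(3)[OF that] by (auto simp: H'_def less_top)
    have "op_norm \<mu> m p (\<lambda>i x. \<sigma> i x powr (1 - p i / p0)) q u (sparse_op \<mu> m \<eta> S p0 \<gamma>)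
      \<le> ennreal (C * A powr (1 / q) * (H powr (1 / q) + (\<Sum>i=1..m. H' i powr (1 / conj_exp (p i)))))"
      unfolding C_def
    proof (rule sparse_op_norm_bound[OF hd assms(2-5) p assms(7,8,10,11) _ u \<sigma> A H H' S])
      show "q \<le> \<gamma> \<or> \<gamma> < q \<and> (\<forall>i\<in>{1..m}. \<gamma> < p i)" using \<gamma>p by (cases "q \<le> \<gamma>") auto
    qed
    also have "\<dots> = ennreal C * ?As epowr (1 / q) * (?Hi epowr (1 / q) + (\<Sum>i=1..m. ?Hd i epowr (1 / conj_exp (p i))))"
    proof -
      have "(\<Sum>i=1..m. ?Hd i epowr (1 / conj_exp (p i))) = (\<Sum>i=1..m. ennreal (H' i powr (1 / conj_exp (p i))))"
        using H' conj by (intro sum.cong refl) (simp add: ennreal_epowr)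
      then show ?thesis
        using A(2) H(2) C q1 unfolding A(1) H(1)
        by (simp add: ennreal_epowr ennreal_mult sum_nonneg)
    qed
    finally show ?thesis .
  qed simp
  show ?thesis
    by (intro exI[of _ C] conjI C allI impI SUP_least bound) auto
qed

end
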